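(* Let $1<p<\infty$ and let $\omega\in\mathcal{M}$ be a radial weight. Then the following statements are equivalent: (i) There exists $r_0=r_0(\omega)\in(0,\infty)$ such that $\mathrm{BMO}(\Delta)_{\omega,p,r}$ is well defined (that is, $\omega(\Delta(z,r))>0$ for all $z\in\mathbb{D}$) and does not depend on $r$, provided $r\ge r_0$. Moreover, denoting this common space by $\mathrm{BMO}(\Delta)_{\omega,p}$, the Bergman projection $P_\omega:\mathrm{BMO}(\Delta)_{\omega,p}\to\mathcal{B}$ is bounded. (ii) $P_\omega:L^\infty\to\mathcal{B}$ is bounded. (iii) $\omega\in\widehat{\mathcal{D}}$.
   Context: $\mathbb{D}$ is the open unit disc of $\mathbb{C}$, $dA(z)=\frac{dx\,dy}{\pi}$, $\mathcal{H}(\mathbb{D})$ is the space of analytic functions in $\mathbb{D}$, and $L^\infty=L^\infty(\mathbb{D})$. A radial weight is a non-negative function $\omega\in L^1([0,1))$ extended to $\mathbb{D}$ by $\omega(z)=\omega(|z|)$; it is always assumed that $\widehat{\omega}(z)=\int_{|z|}^1\omega(s)\,ds>0$ for all $z\in\mathbb{D}$. Its moments are $\omega_x=\int_0^1 r^x\omega(r)\,dr$, $x\ge0$, and $\omega(E)=\int_E\omega\,dA$. The class $\widehat{\mathcal{D}}$ consists of radial weights for which there is $C=C(\omega)>1$ with $\widehat{\omega}(r)\le C\widehat{\omega}\left(\frac{1+r}{2}\right)$ for all $0\le r<1$. The class $\mathcal{M}$ consists of radial weights for which there are $C=C(\omega)>1$ and $K=K(\omega)>1$ with $\omega_x\ge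 C\omega_{Kx}$ for all $x\ge1$. $L^p_\omega$ is the space of measurable $f:\mathbb{D}\to\mathbb{C}$ with $\|f\|_{L^p_\omega}^p=\int_{\mathbb{D}}|f|^p\omega\,dA<\infty$, and $A^p_\omega=L^p_\omega\cap\mathcal{H}(\mathbb{D})$. The reproducing kernels of the Hilbert space $A^2_\omega$ are denoted $B^\omega_z$; explicitly $B^\omega_z(\zeta)=\sum_{n=0}^\infty\frac{(\overline{z}\zeta)^n}{2\omega_{2n+1}}$. The Bergman projection is $P_\omega(f)(z)=\int_{\mathbb{D}}f(\zeta)\overline{B^\omega_z(\zeta)}\,\omega(\zeta)\,dA(\zeta)$. The Bloch space $\mathcal{B}$ consists of $f\in\mathcal{H}(\mathbb{D})$ with $\|f\|_{\mathcal{B}}=\sup_{z\in\mathbb{D}}|f'(z)|(1-|z|^2)<\infty$. Boundedness of $P_\omega:X\to\mathcal{B}$ means that $P_\omega(f)\in\mathcal{B}$ and $\|P_\omega(f)\|_{\mathcal{B}}\le C\|f\|_X$ for all $f\in X$, with $C$ independent of $f$. $\beta(z,\zeta)=\frac12\log\frac{1+|\varphi_z(\zeta)|}{1-|\varphi_z(\zeta)|}$, $\varphi_z(\zeta)=\frac{z-\zeta}{1-\overline{z}\zeta}$, is the hyperbolic distance, and $\Delta(z,r)=\{\zeta\in\mathbb{D}:\beta(z,\zeta)<r\}$. If $0<r<\infty$ and $\omega(\Delta(z,r))>0$ for all $z\in\mathbb{D}$, set $$\widehat{f}_{r,\omega}(z)=\frac{1}{\omega(\Delta(z,r))}\int_{\Delta(z,r)}f\omega\,dA,\qquad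 \mathrm{MO}_{\omega,p,r}(f)(z)=\left(\frac{1}{\omega(\Delta(z,r))}\int_{\Delta(z,r)}|f(\zeta)-\widehat{f}_{r,\omega}(z)|^p\omega(\zeta)\,dA(\zeta)\right)^{1/p}.$$ The space $\mathrm{BMO}(\Delta)_{\omega,p,r}$ consists of $f\in L^p_\omega$ with $$\|f\|_{\mathrm{BMO}(\Delta)_{\omega,p,r}}=\sup_{z\in\mathbb{D}}\mathrm{MO}_{\omega,p,r}(f)(z)<\infty.$$ The quantity $\|f\|_{\mathrm{BMO}(\Delta)_{\omega,p}}$ is $\|f\|_{\mathrm{BMO}(\Delta)_{\omega,p,r}}$ computed for a fixed $r\ge r_0$. *)

theory Defs
  imports "HOL-Analysis.Analysis" "HOL-Probability.Essential_Supremum"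
begin

(* All functions are total on the complex plane; every notion below only looks at their values
   on the open unit disc, and "measurable" means Lebesgue measurable. *)

abbreviation unit_disc :: "complex set" where
  "unit_disc \<equiv> ball 0 1"

definition disc_area :: "complex measure" where
  "disc_area = density (lebesgue_on unit_disc) (\<lambda>_. ennreal (1 / pi))"

subsection \<open>Radial weights\<close>

(* A radial weight is given by its profile on [0,1). *)

definition tail :: "(real \<Rightarrow> real) \<Rightarrow> real \<Rightarrow> real" where
  "tail \<omega> r = (LINT s:{r..<1}|lebesgue. \<omega> s)"

definition moment :: "(real \<Rightarrow> real) \<Rightarrow> real \<Rightarrow> real" where
  "moment \<omega> x = (LINT r:{0..<1}|lebesgue. r powr x * \<omega> r)"

definition radial_weight :: "(real \<Rightarrow> real) \<Rightarrow> bool" where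
  "radial_weight \<omega> \<longleftrightarrow>
     (\<forall>r\<in>{0..<1}. 0 \<le> \<omega> r) \<and> set_integrable lebesgue {0..<1} \<omega> \<and> (\<forall>r\<in>{0..<1}. 0 < tail \<omega> r)"

definition class_D_hat :: "(real \<Rightarrow> real) set" where
  "class_D_hat = {\<omega>. radial_weight \<omega> \<and>
     (\<exists>C>1. \<forall>r\<in>{0..<1}. tail \<omega> r \<le> C * tail \<omega> ((1 + r) / 2))}"

definition class_M :: "(real \<Rightarrow> real) set" where
  "class_M = {\<omega>. radial_weight \<omega> \<and>
     (\<exists>C>1. \<exists>K>1. \<forall>x\<ge>1. moment \<omega> x \<ge> C * moment \<omega> (K * x))}"

definition weighted_area :: "(real \<Rightarrow> real) \<Rightarrow> complex measure" where
  "weighted_area \<omega> = density disc_area (\<lambda>z. ennreal (\<omega> (norm z)))"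

subsection \<open>Function spaces and the Bergman projection\<close>

definition Lp_weighted :: "(real \<Rightarrow> real) \<Rightarrow> real \<Rightarrow> (complex \<Rightarrow> complex) set" where
  "Lp_weighted \<omega> p =
     {f. f \<in> borel_measurable disc_area \<and> integrable (weighted_area \<omega>) (\<lambda>z. norm (f z) powr p)}"

definition Linf_norm :: "(complex \<Rightarrow> complex) \<Rightarrow> ennreal" where
  "Linf_norm f = esssup disc_area (\<lambda>z. ennreal (norm (f z)))"

definition Linf :: "(complex \<Rightarrow> complex) set" where
  "Linf = {f. f \<in> borel_measurable disc_area \<and> Linf_norm f < \<infinity>}"

(* The reproducing kernel at z of the weighted Bergman space with exponent 2: the monomials are
   orthogonal there, with squared norms 2 * moment \<omega> (2 n + 1). *)
definition bergman_kernel :: "(real \<Rightarrow> real) \<Rightarrow> complex \<Rightarrow> complex \<Rightarrow> complex" where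
  "bergman_kernel \<omega> z \<zeta> =
     (\<Sum>n. (cnj z * \<zeta>) ^ n / complex_of_real (2 * moment \<omega> (2 * real n + 1)))"

definition bergman_projection ::
  "(real \<Rightarrow> real) \<Rightarrow> (complex \<Rightarrow> complex) \<Rightarrow> complex \<Rightarrow> complex" where
  "bergman_projection \<omega> f z =
     (LINT \<zeta>|weighted_area \<omega>. f \<zeta> * cnj (bergman_kernel \<omega> z \<zeta>))"

definition bloch_seminorm :: "(complex \<Rightarrow> complex) \<Rightarrow> ennreal" where
  "bloch_seminorm f = (SUP z\<in>unit_disc. ennreal (norm (deriv f z) * (1 - (norm z)\<^sup>2)))"

definition bloch :: "(complex \<Rightarrow> complex) set" where
  "bloch = {f. f holomorphic_on unit_disc \<and> bloch_seminorm f < \<infinity>}"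

definition bounded_into_bloch ::
  "((complex \<Rightarrow> complex) \<Rightarrow> complex \<Rightarrow> complex) \<Rightarrow> (complex \<Rightarrow> complex) set \<Rightarrow>
   ((complex \<Rightarrow> complex) \<Rightarrow> ennreal) \<Rightarrow> bool" where
  "bounded_into_bloch T X nrm \<longleftrightarrow>
     (\<exists>C>0. \<forall>f\<in>X. T f \<in> bloch \<and> bloch_seminorm (T f) \<le> ennreal C * nrm f)"

subsection \<open>Bounded mean oscillation on hyperbolic discs\<close>

definition disc_aut :: "complex \<Rightarrow> complex \<Rightarrow> complex" where
  "disc_aut z \<zeta> = (z - \<zeta>) / (1 - cnj z * \<zeta>)"

definition hyp_dist :: "complex \<Rightarrow> complex \<Rightarrow> real" where
  "hyp_dist z \<zeta> = 1 / 2 * ln ((1 + norm (disc_aut z \<zeta>)) / (1 - norm (disc_aut z \<zeta>)))"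

definition hyp_ball :: "complex \<Rightarrow> real \<Rightarrow> complex set" where
  "hyp_ball z r = {\<zeta>\<in>unit_disc. hyp_dist z \<zeta> < r}"

definition hyp_mean ::
  "(real \<Rightarrow> real) \<Rightarrow> real \<Rightarrow> (complex \<Rightarrow> complex) \<Rightarrow> complex \<Rightarrow> complex" where
  "hyp_mean \<omega> r f z =
     (LINT \<zeta>:hyp_ball z r|weighted_area \<omega>. f \<zeta>) /
     complex_of_real (measure (weighted_area \<omega>) (hyp_ball z r))"

definition mean_osc ::
  "(real \<Rightarrow> real) \<Rightarrow> real \<Rightarrow> real \<Rightarrow> (complex \<Rightarrow> complex) \<Rightarrow> complex \<Rightarrow> real" where
  "mean_osc \<omega> p r f z =
     ((LINT \<zeta>:hyp_ball z r|weighted_area \<omega>. norm (f \<zeta> - hyp_mean \<omega> r f z) powr p) /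
      measure (weighted_area \<omega>) (hyp_ball z r)) powr (1 / p)"

definition BMO_seminorm ::
  "(real \<Rightarrow> real) \<Rightarrow> real \<Rightarrow> real \<Rightarrow> (complex \<Rightarrow> complex) \<Rightarrow> ennreal" where
  "BMO_seminorm \<omega> p r f = (SUP z\<in>unit_disc. ennreal (mean_osc \<omega> p r f z))"

definition BMO :: "(real \<Rightarrow> real) \<Rightarrow> real \<Rightarrow> real \<Rightarrow> (complex \<Rightarrow> complex) set" where
  "BMO \<omega> p r = {f \<in> Lp_weighted \<omega> p. BMO_seminorm \<omega> p r f < \<infinity>}"

(* From r0 on, the space is well defined and independent of r, and the projection is bounded on
   it; the seminorm on the common space may be taken with any fixed radius r \<ge> r0, the bound
   being allowed to depend on that choice. *)
definition BMO_bloch_radius :: "(real \<Rightarrow> real) \<Rightarrow> real \<Rightarrow> real \<Rightarrow> bool" where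
  "BMO_bloch_radius \<omega> p r0 \<longleftrightarrow>
     0 < r0 \<and>
     (\<forall>r\<ge>r0. \<forall>z\<in>unit_disc. 0 < measure (weighted_area \<omega>) (hyp_ball z r)) \<and>
     (\<forall>r\<ge>r0. BMO \<omega> p r = BMO \<omega> p r0) \<and>
     (\<forall>r\<ge>r0. bounded_into_bloch (bergman_projection \<omega>) (BMO \<omega> p r0) (BMO_seminorm \<omega> p r))"

end

theory Submission
  imports Defs
begin

text \<open>
  Write \<open>m x\<close> for the moments of the weight. A weight lies in \<open>class_D_hat\<close> iff \<open>m x \<le> C m (2 x)\<close> for \<open>x \<ge> 1\<close>, and the
  projection of \<open>f\<close> is the power series with coefficients \<open>1 / (2 m (2 n + 1))\<close> times the moments of \<open>f\<close>
  against \<open>cnj \<zeta> ^ n\<close>. For \<open>f = Arg\<close> the derivative at \<open>- r\<close> is, up to a unimodular factor,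
  \<open>\<Sum>n. m (n + 2) / m (2 n + 3) r\<^sup>n\<close>; a bound \<open>C / (1 - r)\<close> for this positive series forces doubling.

  Conversely, doubling makes \<open>1 / m (2 n + 1)\<close> a symbol: its differences gain powers of \<open>1 / n\<close>. Summing by parts twice and
  using the polynomial growth in both directions that doubling and \<open>class_M\<close> provide, the derivative of the kernel is at most
  \<open>C / (h (1 - |a|) |1 - a|\<^sup>2)\<close> at \<open>a = z cnj \<zeta>\<close>, where \<open>h t = m (1 / t)\<close>. For radii \<open>r \<ge> r0\<close> the disc of centre \<open>u\<close> has
  mass comparable to \<open>h t t\<close>, \<open>t = 1 - |u|\<close>; hence means over neighbouring discs differ by the BMO
  seminorm, and a chain along the geodesic bounds the oscillation around the mean at \<open>z\<close> over the disc of centre \<open>u\<close> by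
  \<open>1 + hyp_dist z u\<close>, which a small power of \<open>|1 - cnj z u|\<^sup>2 / ((1 - |z|) (1 - |u|))\<close> dominates. As the projection
  maps constants to constants, \<open>f\<close> may be replaced by \<open>f\<close> minus its mean at \<open>z\<close>; averaging over small discs
  leaves a Forelli--Rudin integral of size \<open>1 / (1 - |z|)\<close>.
\<close>

subsection \<open>Polar coordinates\<close>

text \<open>The weight is accessible only through moments and tails; it may vanish on annuli wide
  enough to contain whole hyperbolic discs. So no pointwise bound on \<open>w\<close> is available:
  masses are bounded below on an annular sector near the centre (\<open>core\<close>), the radius
  has to be large enough to reach that sector, and sums over lattices are replaced by an average
  over all centres with respect to Lebesgue measure. The decay exponent \<open>e\<close> supplied by
  \<open>class_M\<close> is used three times. It removes the logarithm that the kernel series would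
  otherwise produce, it gives \<open>core\<close> its mass, and it yields the factor
  \<open>(t / d) powr e\<close> in the kernel bound (\<open>t\<close>, \<open>d\<close> the boundary
  distances of \<open>u\<close>, \<open>z\<close>). This factor pays for the growth of the means,
  which costs the power \<open>\<epsilon> = e / 2\<close>; half of the gain then remains to make the
  radial integral converge. The radius and the constants of the estimates do not depend on
  \<open>p\<close>, so one radius serves all exponents. The way back from BMO to bounded functions
  is an embedding: oscillation about 0 is at most the essential supremum.\<close>

lemma lborel_complex_eq: "(lborel :: complex measure) = distr (lborel \<Otimes>\<^sub>M lborel) borel (\<lambda>(x, y). Complex x y)"
proof (rule lborel_eqI)
  fix l u :: complex
  assume le: "\<And>b. b \<in> Basis \<Longrightarrow> l \<bullet> b \<le> u \<bullet> b"
  have le': "Re l \<le> Re u" "Im l \<le> Im u"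
    using le[of 1] le[of \<i>] by (simp_all add: Basis_complex_def)
  have m: "(\<lambda>(x, y). Complex x y) \<in> lborel \<Otimes>\<^sub>M lborel \<rightarrow>\<^sub>M borel"
    by (simp add: Complex_eq split_beta')
  have vim: "(\<lambda>(x, y). Complex x y) -` box l u = {Re l<..<Re u} \<times> {Im l<..<Im u}"
    by (auto simp: box_def Basis_complex_def)
  have "emeasure (distr (lborel \<Otimes>\<^sub>M lborel) borel (\<lambda>(x, y). Complex x y)) (box l u)
      = emeasure (lborel \<Otimes>\<^sub>M lborel) ({Re l<..<Re u} \<times> {Im l<..<Im u})"
    by (subst emeasure_distr) (auto simp: m vim space_pair_measure)
  also have "\<dots> = ennreal (Re u - Re l) * ennreal (Im u - Im l)"
    by (subst lborel.emeasure_pair_measure_Times) (auto simp: le')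
  also have "\<dots> = ennreal (\<Prod>b\<in>Basis. (u - l) \<bullet> b)"
    using le' by (simp add: Basis_complex_def ennreal_mult inner_diff_left)
  finally show "emeasure (distr (lborel \<Otimes>\<^sub>M lborel) borel (\<lambda>(x, y). Complex x y)) (box l u) = (\<Prod>b\<in>Basis. (u - l) \<bullet> b)" .
qed simp

lemma borel_measurable_Complex [measurable (raw)]:
  fixes f g :: "'a \<Rightarrow> real"
  assumes [measurable]: "f \<in> borel_measurable M" "g \<in> borel_measurable M"
  shows "(\<lambda>x. Complex (f x) (g x)) \<in> borel_measurable M"
  unfolding Complex_eq by measurable

lemma borel_measurable_cis [measurable]: "cis \<in> borel_measurable borel"
  unfolding cis.ctr by measurable

text \<open>Angular half of the passage to polar coordinates: on the line of slope
  \<open>tan t\<close> the ordinate is \<open>x * tan t\<close>, so only one-dimensional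
  substitutions are needed.\<close>

lemma lborel_tan_substitution:
  "(lborel :: real measure) = distr (density lborel (\<lambda>t. indicator {-pi/2<..<pi/2} t * ennreal (1 / (cos t)\<^sup>2))) borel tan"
proof (rule lborel_eqI)
  fix l u :: real
  assume "\<And>b. b \<in> Basis \<Longrightarrow> l \<bullet> b \<le> u \<bullet> b"
  then have le: "l \<le> u" by simp
  define a b where "a = arctan l" and "b = arctan u"
  have ab: "-pi/2 < a" "a \<le> b" "b < pi/2"
    using arctan_lbound[of l] arctan_ubound[of u] le by (auto simp: a_def b_def arctan_monotone')
  have [measurable]: "(tan :: real \<Rightarrow> real) \<in> borel_measurable borel"
    unfolding tan_def by measurable
  have 1: "l < tan t \<and> tan t < u \<longleftrightarrow> a < t \<and> t < b" if "-pi/2 < t" "t < pi/2" for t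
    using that ab unfolding a_def b_def
    by (metis arctan_less_iff arctan_tan minus_divide_left)
  have "emeasure (distr (density lborel (\<lambda>t. indicator {-pi/2<..<pi/2} t * ennreal (1 / (cos t)\<^sup>2))) borel tan) (box l u)
      = (\<integral>\<^sup>+t. indicator {-pi/2<..<pi/2} t * ennreal (1 / (cos t)\<^sup>2) * indicator (tan -` box l u) t \<partial>lborel)"
    using measurable_sets_borel[of tan borel "box l u"]
    by (subst emeasure_distr) (auto simp: emeasure_density)
  also have "\<dots> = (\<integral>\<^sup>+t. ennreal (1 / (cos t)\<^sup>2) * indicator {a..b} t \<partial>lborel)"
  proof (rule nn_integral_cong_AE)
    show "AE t in lborel. indicator {-pi/2<..<pi/2} t * ennreal (1 / (cos t)\<^sup>2) * indicator (tan -` box l u) t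
       = ennreal (1 / (cos t)\<^sup>2) * indicator {a..b} t"
      using AE_lborel_singleton[of a] AE_lborel_singleton[of b]
    proof eventually_elim
      case (elim t)
      show ?case
        using elim 1[of t] ab by (auto split: split_indicator simp: box_real)
    qed
  qed
  also have "\<dots> = ennreal (tan b - tan a)"
  proof (rule nn_integral_FTC_Icc)
    show "(tan has_real_derivative 1 / (cos x)\<^sup>2) (at x)" if "x \<in> {a..b}" for x
      using that ab cos_gt_zero_pi[of x] by (auto intro!: derivative_eq_intros simp: field_simps)
  qed (use ab in auto)
  also have "tan b - tan a = u - l"
    by (simp add: a_def b_def tan_arctan)
  finally show "emeasure (distr (density lborel (\<lambda>t. indicator {-pi/2<..<pi/2} t * ennreal (1 / (cos t)\<^sup>2))) borel tan) (box l u)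
      = (\<Prod>b\<in>Basis. (u - l) \<bullet> b)" by simp
qed simp

text \<open>The plane is swept by lines through 0, with the angle in a half circle and a signed
  radius. The substitution y = x s costs |x|, s = tan t costs 1 / cos^2 t, and x = r cos t gives
  back cos^2 t, leaving |r|.\<close>

lemma nn_integral_polar_signed:
  fixes f :: "complex \<Rightarrow> ennreal"
  assumes [measurable]: "f \<in> borel_measurable borel"
  shows "(\<integral>\<^sup>+z. f z \<partial>lborel) =
    (\<integral>\<^sup>+t. indicator {-pi/2<..<pi/2} t * (\<integral>\<^sup>+r. ennreal \<bar>r\<bar> * f (r * cis t) \<partial>lborel) \<partial>lborel)"
proof -
  have [measurable]: "(tan :: real \<Rightarrow> real) \<in> borel_measurable borel"
    unfolding tan_def by measurable
  have "(\<integral>\<^sup>+z. f z \<partial>lborel) = (\<integral>\<^sup>+p. f (case p of (x, y) \<Rightarrow> Complex x y) \<partial>(lborel \<Otimes>\<^sub>M lborel))"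
    by (subst lborel_complex_eq, subst nn_integral_distr) (auto simp: split_beta')
  also have "\<dots> = (\<integral>\<^sup>+x. \<integral>\<^sup>+y. f (Complex x y) \<partial>lborel \<partial>lborel)"
    by (subst lborel.nn_integral_fst[symmetric]) auto
  also have "\<dots> = (\<integral>\<^sup>+x. \<integral>\<^sup>+s. ennreal \<bar>x\<bar> * f (Complex x (x * s)) \<partial>lborel \<partial>lborel)"
  proof (rule nn_integral_cong_AE)
    show "AE x in lborel. (\<integral>\<^sup>+y. f (Complex x y) \<partial>lborel) = (\<integral>\<^sup>+s. ennreal \<bar>x\<bar> * f (Complex x (x * s)) \<partial>lborel)"
      using AE_lborel_singleton[of 0]
    proof eventually_elim
      case (elim x)
      then show ?case
        by (subst nn_integral_real_affine[where c=x and t=0]) (auto simp: nn_integral_cmult)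
    qed
  qed
  also have "\<dots> = (\<integral>\<^sup>+s. \<integral>\<^sup>+x. ennreal \<bar>x\<bar> * f (Complex x (x * s)) \<partial>lborel \<partial>lborel)"
    by (rule lborel_pair.Fubini'[symmetric]) auto
  also have "\<dots> = (\<integral>\<^sup>+t. indicator {-pi/2<..<pi/2} t * ennreal (1 / (cos t)\<^sup>2) *
      (\<integral>\<^sup>+x. ennreal \<bar>x\<bar> * f (Complex x (x * tan t)) \<partial>lborel) \<partial>lborel)"
    by (subst lborel_tan_substitution, subst nn_integral_distr) (auto simp: nn_integral_density)
  also have "\<dots> = (\<integral>\<^sup>+t. indicator {-pi/2<..<pi/2} t * (\<integral>\<^sup>+r. ennreal \<bar>r\<bar> * f (r * cis t) \<partial>lborel) \<partial>lborel)"
  proof (rule nn_integral_cong)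
    fix t :: real
    show "indicator {-pi/2<..<pi/2} t * ennreal (1 / (cos t)\<^sup>2) *
        (\<integral>\<^sup>+x. ennreal \<bar>x\<bar> * f (Complex x (x * tan t)) \<partial>lborel) =
      indicator {-pi/2<..<pi/2} t * (\<integral>\<^sup>+r. ennreal \<bar>r\<bar> * f (r * cis t) \<partial>lborel)"
    proof (cases "t \<in> {-pi/2<..<pi/2}")
      case True
      then have c: "cos t > 0" using cos_gt_zero_pi[of t] by auto
      have eq: "Complex (cos t * r) (cos t * r * tan t) = r * cis t" for r
        using c by (simp add: complex_eq_iff tan_def)
      have "(\<integral>\<^sup>+x. ennreal \<bar>x\<bar> * f (Complex x (x * tan t)) \<partial>lborel) =
          ennreal \<bar>cos t\<bar> * (\<integral>\<^sup>+r. ennreal \<bar>cos t * r\<bar> * f (r * cis t) \<partial>lborel)"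
        using c by (subst nn_integral_real_affine[where c="cos t" and t=0]) (auto simp: eq)
      also have "\<dots> = (\<integral>\<^sup>+r. ennreal ((cos t)\<^sup>2) * (ennreal \<bar>r\<bar> * f (r * cis t)) \<partial>lborel)"
        using c by (subst nn_integral_cmult[symmetric])
          (auto simp: abs_mult ennreal_mult power2_eq_square mult_ac)
      also have "\<dots> = ennreal ((cos t)\<^sup>2) * (\<integral>\<^sup>+r. ennreal \<bar>r\<bar> * f (r * cis t) \<partial>lborel)"
        by (subst nn_integral_cmult) auto
      finally have eq2: "(\<integral>\<^sup>+x. ennreal \<bar>x\<bar> * f (Complex x (x * tan t)) \<partial>lborel) =
          ennreal ((cos t)\<^sup>2) * (\<integral>\<^sup>+r. ennreal \<bar>r\<bar> * f (r * cis t) \<partial>lborel)" .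
      have "ennreal (1 / (cos t)\<^sup>2) * ennreal ((cos t)\<^sup>2) = 1"
        using c by (subst ennreal_mult[symmetric]) auto
      then show ?thesis
        using True unfolding eq2 by (simp add: mult.assoc[symmetric])
    qed simp
  qed
  finally show ?thesis .
qed

text \<open>Allows the cut of the angular interval to sit anywhere: later on the negative axis for
  the argument function, or opposite the centre of a sector.\<close>

lemma nn_integral_periodic_shift:
  fixes g :: "real \<Rightarrow> ennreal"
  assumes [measurable]: "g \<in> borel_measurable borel" and T: "T > 0" and per: "\<And>t. g (t + T) = g t"
  shows "(\<integral>\<^sup>+t. indicator {a<..<a+T} t * g t \<partial>lborel) = (\<integral>\<^sup>+t. indicator {b<..<b+T} t * g t \<partial>lborel)"
proof -
  define I where "I a b = (\<integral>\<^sup>+t. indicator {a<..<b} t * g t \<partial>lborel)" for a b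
  have per': "g (t + of_int k * T) = g t" for t and k :: int
  proof (induction k rule: int_induct[where k=0])
    case (step1 i) then show ?case using per[of "t + of_int i * T"] by (simp add: algebra_simps)
  next
    case (step2 i) then show ?case using per[of "t + of_int (i - 1) * T"] by (simp add: algebra_simps)
  qed simp
  have split: "I a c = I a b + I b c" if "a \<le> b" "b \<le> c" for a b c
  proof -
    have "I a c = (\<integral>\<^sup>+t. indicator {a<..<b} t * g t + indicator {b<..<c} t * g t \<partial>lborel)"
      unfolding I_def
    proof (rule nn_integral_cong_AE)
      show "AE t in lborel. indicator {a<..<c} t * g t = indicator {a<..<b} t * g t + indicator {b<..<c} t * g t"
        using AE_lborel_singleton[of b] by eventually_elim (use that in \<open>auto split: split_indicator\<close>)
    qed
    also have "\<dots> = I a b + I b c" unfolding I_def by (rule nn_integral_add) auto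
    finally show ?thesis .
  qed
  have shift: "I (a + of_int k * T) (b + of_int k * T) = I a b" for a b and k :: int
    unfolding I_def
    by (subst nn_integral_real_affine[where c=1 and t="of_int k * T"])
       (auto intro!: nn_integral_cong simp: per' add.commute split: split_indicator)
  have main: "I a (a + T) = I 0 T" for a
  proof -
    define k where "k = \<lfloor>a / T\<rfloor>"
    define a' where "a' = a - of_int k * T"
    have a': "0 \<le> a'" "a' \<le> T"
      using floor_divide_lower[OF T, of a] floor_divide_upper[OF T, of a]
      unfolding a'_def k_def by (simp_all add: distrib_right)
    have "I a (a + T) = I (a' + of_int k * T) ((a' + T) + of_int k * T)" by (simp add: a'_def)
    also have "\<dots> = I a' (a' + T)" by (rule shift)
    also have "\<dots> = I a' T + I T (a' + T)" using a' T by (intro split) auto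
    also have "I T (a' + T) = I 0 a'" using shift[of 0 1 a'] by simp
    also have "I a' T + I 0 a' = I 0 T" using a' by (subst split[of 0 a' T]) (auto simp: add.commute)
    finally show ?thesis .
  qed
  show ?thesis using main[of a] main[of b] by (simp add: I_def)
qed

theorem nn_integral_polar:
  fixes f :: "complex \<Rightarrow> ennreal"
  assumes [measurable]: "f \<in> borel_measurable borel"
  shows "(\<integral>\<^sup>+z. f z \<partial>lborel) =
    (\<integral>\<^sup>+t. indicator {a<..<a+2*pi} t * (\<integral>\<^sup>+r. indicator {0<..} r * ennreal r * f (r * cis t) \<partial>lborel) \<partial>lborel)"
proof -
  define H where "H t = (\<integral>\<^sup>+r. indicator {0<..} r * ennreal r * f (r * cis t) \<partial>lborel)" for t
  have [measurable]: "H \<in> borel_measurable borel" unfolding H_def by measurable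
  have Hper: "H (t + 2 * pi) = H t" for t
    by (simp add: H_def cis.ctr)
  have cis_pi: "cis (t + pi) = - cis t" for t
    by (simp add: cis.ctr complex_eq_iff)
  \<comment> \<open>The negative radii at angle \<open>t\<close> are the positive radii at
    \<open>t + pi\<close>, which completes the half circle to a full one.\<close>
  have signed: "(\<integral>\<^sup>+r. ennreal \<bar>r\<bar> * f (r * cis t) \<partial>lborel) = H t + H (t + pi)" for t
  proof -
    have "(\<integral>\<^sup>+r. ennreal \<bar>r\<bar> * f (r * cis t) \<partial>lborel) =
       (\<integral>\<^sup>+r. indicator {0<..} r * ennreal r * f (r * cis t) + indicator {..<0} r * ennreal (-r) * f (r * cis t) \<partial>lborel)"
      by (intro nn_integral_cong_AE eventually_mono[OF AE_lborel_singleton[of 0]])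
         (auto split: split_indicator)
    also have "\<dots> = H t + (\<integral>\<^sup>+r. indicator {..<0} r * ennreal (-r) * f (r * cis t) \<partial>lborel)"
      unfolding H_def by (rule nn_integral_add) auto
    also have "(\<integral>\<^sup>+r. indicator {..<0} r * ennreal (-r) * f (r * cis t) \<partial>lborel) = H (t + pi)"
      unfolding H_def
      by (subst nn_integral_real_affine[where c="-1" and t=0])
         (auto intro!: nn_integral_cong simp: cis_pi split: split_indicator)
    finally show ?thesis .
  qed
  have "(\<integral>\<^sup>+z. f z \<partial>lborel) = (\<integral>\<^sup>+t. indicator {-pi/2<..<pi/2} t * (H t + H (t + pi)) \<partial>lborel)"
    by (subst nn_integral_polar_signed) (simp_all add: signed)
  also have "\<dots> = (\<integral>\<^sup>+t. indicator {-pi/2<..<pi/2} t * H t \<partial>lborel) +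
     (\<integral>\<^sup>+t. indicator {-pi/2<..<pi/2} t * H (t + pi) \<partial>lborel)"
    by (subst nn_integral_add[symmetric]) (auto simp: distrib_left)
  also have "(\<integral>\<^sup>+t. indicator {-pi/2<..<pi/2} t * H (t + pi) \<partial>lborel) =
     (\<integral>\<^sup>+t. indicator {pi/2<..<3*pi/2} t * H t \<partial>lborel)"
    by (subst (2) nn_integral_real_affine[where c=1 and t=pi])
       (auto intro!: nn_integral_cong simp: add.commute split: split_indicator)
  also have "(\<integral>\<^sup>+t. indicator {-pi/2<..<pi/2} t * H t \<partial>lborel) + \<dots> =
      (\<integral>\<^sup>+t. indicator {-pi/2<..<pi/2} t * H t + indicator {pi/2<..<3*pi/2} t * H t \<partial>lborel)"
    by (rule nn_integral_add[symmetric]) auto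
  also have "\<dots> = (\<integral>\<^sup>+t. indicator {-pi/2<..<-pi/2+2*pi} t * H t \<partial>lborel)"
    by (intro nn_integral_cong_AE eventually_mono[OF AE_lborel_singleton[of "pi/2"]])
       (auto split: split_indicator)
  also have "\<dots> = (\<integral>\<^sup>+t. indicator {a<..<a+2*pi} t * H t \<partial>lborel)"
    by (rule nn_integral_periodic_shift) (auto simp: Hper)
  finally show ?thesis unfolding H_def .
qed

subsection \<open>Radial weights with Borel profile\<close>

text \<open>In polar coordinates every ray meets the exceptional set in a null set of radii.\<close>

lemma radial_vimage_null:
  assumes "AE r in lborel. P (r::real)"
  shows "AE z::complex in lborel. P (norm z)"
proof -
  from AE_E[OF assms] obtain N where N: "{r. \<not> P r} \<subseteq> N" "emeasure lborel N = 0" "N \<in> sets borel"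
    by auto
  then have [measurable]: "N \<in> sets borel" by simp
  have "AE r in lborel. r \<notin> N" using N by (auto intro!: AE_not_in simp: null_sets_def)
  have [measurable]: "{z::complex. norm z \<in> N} \<in> sets borel" by measurable
  have "emeasure lborel {z::complex. norm z \<in> N} = (\<integral>\<^sup>+z. indicator {z::complex. norm z \<in> N} z \<partial>lborel)"
    by (rule nn_integral_indicator[symmetric]) simp
  also have "\<dots> = (\<integral>\<^sup>+z. indicator N (norm (z::complex)) \<partial>lborel)"
    by (rule nn_integral_cong) (simp add: indicator_def)
  also have "\<dots> = (\<integral>\<^sup>+t. indicator {0<..<0+2*pi} t * (\<integral>\<^sup>+r. indicator {0<..} r * ennreal r * indicator N (norm (complex_of_real r * cis t)) \<partial>lborel) \<partial>lborel)"
    by (rule nn_integral_polar) auto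
  also have "\<dots> = (\<integral>\<^sup>+(t::real). 0 \<partial>lborel)"
  proof (rule nn_integral_cong)
    fix t :: real
    have "(\<integral>\<^sup>+r. indicator {0<..} r * ennreal r * indicator N (norm (complex_of_real r * cis t)) \<partial>lborel) = (\<integral>\<^sup>+(r::real). 0 \<partial>lborel)"
      by (intro nn_integral_cong_AE eventually_mono[OF \<open>AE r in lborel. r \<notin> N\<close>])
         (auto simp: norm_mult split: split_indicator)
    then show "indicator {0<..<0+2*pi} t * (\<integral>\<^sup>+r. indicator {0<..} r * ennreal r * indicator N (norm (complex_of_real r * cis t)) \<partial>lborel) = (0::ennreal)"
      by simp
  qed
  finally have "{z::complex. norm z \<in> N} \<in> null_sets lborel" by (auto simp: null_sets_def)
  then show ?thesis by (rule AE_I') (use N in auto)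
qed

text \<open>A weight may be replaced by a Borel function that agrees with it almost everywhere, since every notion of
  the theorem only depends on its area measure, its moments and its tails.\<close>

locale borel_weight =
  fixes w :: "real \<Rightarrow> real"
  assumes w_measurable [measurable]: "w \<in> borel_measurable borel"
    and w_nonneg [simp]: "\<And>r. 0 \<le> w r"
    and w_support: "\<And>r. r \<notin> {0..<1} \<Longrightarrow> w r = 0"
    and w_integrable: "integrable lborel w"
    and tail_pos: "\<And>r. r \<in> {0..<1} \<Longrightarrow> 0 < tail w r"

lemma AE_disc_area: "(AE z in lborel. P z) \<Longrightarrow> AE z in disc_area. P z"
  using AE_completion[of P lborel] unfolding disc_area_def
  by (subst AE_density) (auto simp: AE_restrict_space_iff elim: eventually_mono)

text \<open>The tails are compared for \<open>0 \<le> r\<close> only, because the values of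
  \<open>\<omega>\<close> at negative arguments are arbitrary and enter
  \<open>tail \<omega> r\<close> when \<open>r < 0\<close>.\<close>

lemma borel_weight_version:
  assumes "radial_weight \<omega>"
  obtains w where "borel_weight w" "weighted_area w = weighted_area \<omega>"
    "moment w = moment \<omega>" "\<And>r. 0 \<le> r \<Longrightarrow> tail w r = tail \<omega> r"
proof -
  let ?I = "\<lambda>r. indicator {0..<1} r * \<omega> r"
  have i: "integrable lebesgue ?I" and nn: "\<And>r. r \<in> {0..<1} \<Longrightarrow> 0 \<le> \<omega> r"
    and tp: "\<And>r. r \<in> {0..<1} \<Longrightarrow> 0 < tail \<omega> r"
    using assms unfolding radial_weight_def set_integrable_def by auto
  then have m: "?I \<in> borel_measurable lebesgue" by auto
  obtain g where [measurable]: "g \<in> borel_measurable lborel" and g: "AE r in lborel. ?I r = g r"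
    using completion_ex_borel_measurable_real[OF m] by blast
  \<comment> \<open>Cutting off below 0 and outside \<open>{0..<1}\<close> makes sign and support
    hold at every point instead of almost everywhere.\<close>
  define w where "w r = indicator {0..<1} r * max 0 (g r)" for r
  have [measurable]: "w \<in> borel_measurable borel" unfolding w_def by measurable
  have w: "AE r in lborel. ?I r = w r"
    using g
  proof eventually_elim
    case (elim r)
    then show ?case using nn[of r] by (cases "r \<in> {0..<1}") (auto simp: w_def)
  qed
  have wl: "AE r in lebesgue. ?I r = w r" using w by (rule AE_completion)
  have mw: "w \<in> borel_measurable lebesgue" by (simp add: measurable_completion)
  have il: "integrable lebesgue w"
    using i m mw wl by (subst integrable_cong_AE[where g="?I"]) (auto elim: eventually_mono)
  have ib: "integrable lborel w"
    using il by (subst (asm) integrable_completion) auto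
  have wa: "weighted_area w = weighted_area \<omega>"
  proof -
    have "AE z in disc_area. ennreal (w (norm z)) = ennreal (\<omega> (norm z))"
    proof -
      have "AE z in disc_area. z \<in> unit_disc"
        unfolding disc_area_def by (subst AE_density) (auto intro!: AE_I2 simp: space_restrict_space)
      moreover have "AE z in disc_area. ?I (norm z) = w (norm z)"
        by (intro AE_disc_area radial_vimage_null w)
      ultimately show ?thesis by eventually_elim auto
    qed
    then have "(\<integral>\<^sup>+z. ennreal (w (norm z)) * indicator A z \<partial>disc_area) = (\<integral>\<^sup>+z. ennreal (\<omega> (norm z)) * indicator A z \<partial>disc_area)" for A
      by (intro nn_integral_cong_AE) (auto elim: eventually_mono)
    then show ?thesis unfolding weighted_area_def density_def by presburger
  qed
  have mom: "moment w x = moment \<omega> x" for x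
    unfolding moment_def set_lebesgue_integral_def
  proof (rule integral_cong_AE)
    have [measurable]: "?I \<in> borel_measurable lebesgue" by (rule m)
    have [measurable]: "(\<lambda>r::real. r powr x) \<in> borel_measurable lebesgue" "w \<in> borel_measurable lebesgue"
      by (simp_all add: measurable_completion)
    have "(\<lambda>r. r powr x * ?I r) \<in> borel_measurable lebesgue" by measurable
    also have "(\<lambda>r. r powr x * ?I r) = (\<lambda>r. indicator {0..<1} r *\<^sub>R (r powr x * \<omega> r))" by (auto simp: mult_ac)
    finally show "(\<lambda>r. indicator {0..<1} r *\<^sub>R (r powr x * \<omega> r)) \<in> borel_measurable lebesgue" .
    show "(\<lambda>r. indicator {0..<1} r *\<^sub>R (r powr x * w r)) \<in> borel_measurable lebesgue"
      by (intro borel_measurable_scaleR borel_measurable_times) (auto simp: measurable_completion)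
    show "AE r in lebesgue. indicator {0..<1} r *\<^sub>R (r powr x * w r) = indicator {0..<1} r *\<^sub>R (r powr x * \<omega> r)"
      using wl by eventually_elim (auto split: split_indicator)
  qed
  have tail: "tail w r = tail \<omega> r" if "0 \<le> r" for r
    unfolding tail_def set_lebesgue_integral_def
  proof (rule integral_cong_AE)
    have "(\<lambda>s. indicator {r..<1} s * ?I s) \<in> borel_measurable lebesgue"
      by (intro borel_measurable_times m) (auto simp: measurable_completion)
    also have "(\<lambda>s. indicator {r..<1} s * ?I s) = (\<lambda>s. indicator {r..<1} s *\<^sub>R \<omega> s)"
      using that by (auto split: split_indicator)
    finally show "(\<lambda>s. indicator {r..<1} s *\<^sub>R \<omega> s) \<in> borel_measurable lebesgue" .
    show "(\<lambda>s. indicator {r..<1} s *\<^sub>R w s) \<in> borel_measurable lebesgue"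
      by (intro borel_measurable_scaleR) (auto simp: measurable_completion)
    show "AE s in lebesgue. indicator {r..<1} s *\<^sub>R w s = indicator {r..<1} s *\<^sub>R \<omega> s"
      using wl by eventually_elim (use that in \<open>auto split: split_indicator\<close>)
  qed
  have "borel_weight w"
    by unfold_locales (use tp ib tail in \<open>auto simp: w_def\<close>)
  then show thesis
    by (rule that) (auto simp: wa mom tail)
qed

context borel_weight
begin

abbreviation \<mu> :: "complex measure" where "\<mu> \<equiv> weighted_area w"

lemma tail_eq: "0 \<le> r \<Longrightarrow> tail w r = (LINT s|lborel. indicator {r..} s * w s)"
proof -
  assume "0 \<le> r"
  then have "tail w r = (LINT s|lebesgue. indicator {r..} s * w s)"
    unfolding tail_def set_lebesgue_integral_def
    by (intro Bochner_Integration.integral_cong) (auto simp: w_support split: split_indicator)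
  then show ?thesis by (simp add: integral_completion)
qed

lemma moment_eq: "moment w x = (LINT r|lborel. r powr x * w r)"
proof -
  have "moment w x = (LINT r|lebesgue. r powr x * w r)"
    unfolding moment_def set_lebesgue_integral_def
    by (intro Bochner_Integration.integral_cong) (auto simp: w_support split: split_indicator)
  then show ?thesis by (simp add: integral_completion)
qed

lemma integrable_bounded_mult_w:
  assumes [measurable]: "g \<in> borel_measurable borel" and "\<And>r. r \<in> {0..<1} \<Longrightarrow> \<bar>g r\<bar> \<le> B"
  shows "integrable lborel (\<lambda>r. g r * w r)"
proof (rule Bochner_Integration.integrable_bound)
  show "integrable lborel (\<lambda>r. B * w r)" using w_integrable by simp
  have "\<bar>g r\<bar> * w r \<le> B * w r" for r
    using assms(2)[of r] by (cases "r \<in> {0..<1}") (auto simp: w_support intro: mult_right_mono)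
  then show "AE r in lborel. norm (g r * w r) \<le> norm (B * w r)"
    by (intro AE_I2) (simp add: abs_mult order_trans[OF _ mult_right_mono[OF abs_ge_self]])
qed auto

lemma integrable_moment: "0 \<le> x \<Longrightarrow> integrable lborel (\<lambda>r. r powr x * w r)"
  by (rule integrable_bounded_mult_w[where B=1]) (auto simp: powr_le1)

lemma moment_nonneg: "0 \<le> moment w x"
  unfolding moment_eq by (intro Bochner_Integration.integral_nonneg) auto

lemma moment_antimono: "0 \<le> x \<Longrightarrow> x \<le> y \<Longrightarrow> moment w y \<le> moment w x"
  unfolding moment_eq
proof (rule integral_mono)
  fix r assume xy: "0 \<le> x" "x \<le> y"
  show "r powr y * w r \<le> r powr x * w r"
  proof (cases "r \<in> {0..<1}")
    case True
    then show ?thesis using xy by (cases "r = 0") (auto intro!: mult_right_mono powr_mono')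
  qed (simp add: w_support)
qed (auto intro: integrable_moment)

lemma moment_ge_tail:
  assumes "0 \<le> x" "0 \<le> s" "s < 1"
  shows "s powr x * tail w s \<le> moment w x"
proof -
  have "s powr x * tail w s = (LINT r|lborel. s powr x * (indicator {s..} r * w r))"
    using assms by (simp add: tail_eq)
  also have "\<dots> \<le> moment w x"
    unfolding moment_eq
  proof (rule integral_mono)
    show "integrable lborel (\<lambda>r. s powr x * (indicator {s..} r * w r))"
      by (intro integrable_mult_right integrable_bounded_mult_w[where B=1]) (auto split: split_indicator)
    show "s powr x * (indicator {s..} r * w r) \<le> r powr x * w r" for r
      using assms by (auto split: split_indicator intro!: mult_right_mono powr_mono2)
  qed (use assms in \<open>auto intro: integrable_moment\<close>)
  finally show ?thesis .
qed

lemma moment_pos: "0 \<le> x \<Longrightarrow> 0 < moment w x"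
proof -
  assume "0 \<le> x"
  have "0 < (1/2) powr x * tail w (1/2)" using tail_pos[of "1/2"] by simp
  also have "\<dots> \<le> moment w x" using \<open>0 \<le> x\<close> by (intro moment_ge_tail) auto
  finally show ?thesis .
qed

lemma tail_antimono: "0 \<le> r \<Longrightarrow> r \<le> s \<Longrightarrow> tail w s \<le> tail w r"
  using tail_eq[of r] tail_eq[of s]
  by (auto intro!: integral_mono integrable_bounded_mult_w[where B=1] split: split_indicator)

lemma tail_nonneg: "0 \<le> r \<Longrightarrow> 0 \<le> tail w r"
  by (auto simp: tail_eq intro!: Bochner_Integration.integral_nonneg)

text \<open>Below \<open>s\<close> the extra power is at most \<open>s powr y\<close>; above
  \<open>s\<close> the whole power is at most 1. With doubling this shows that a large moment is
  carried by the tail.\<close>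

lemma moment_split:
  assumes "0 \<le> x" "0 \<le> y" "0 \<le> s" "s \<le> 1"
  shows "moment w (x + y) \<le> s powr y * moment w x + tail w s"
proof -
  have "moment w (x + y) \<le> (LINT r|lborel. s powr y * (r powr x * w r) + indicator {s..} r * w r)"
    unfolding moment_eq
  proof (rule integral_mono)
    show "integrable lborel (\<lambda>r. s powr y * (r powr x * w r) + indicator {s..} r * w r)"
      using assms by (intro Bochner_Integration.integrable_add integrable_mult_right integrable_moment
            integrable_bounded_mult_w[where B=1]) (auto split: split_indicator)
    fix r :: real
    show "r powr (x + y) * w r \<le> s powr y * (r powr x * w r) + indicator {s..} r * w r"
    proof (cases "r \<in> {0..<1}")
      case True
      show ?thesis
      proof (cases "r < s")
        case r: True
        have "r powr y \<le> s powr y" using True r assms by (intro powr_mono2) auto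
        then have "r powr x * w r * r powr y \<le> r powr x * w r * s powr y"
          by (intro mult_left_mono) auto
        then show ?thesis using r by (auto simp: powr_add mult_ac)
      next
        case r: False
        have "r powr (x + y) \<le> 1" using True assms by (intro powr_le1) auto
        then have "r powr (x + y) * w r \<le> 1 * w r" by (intro mult_right_mono) auto
        moreover have "0 \<le> s powr y * (r powr x * w r)" by simp
        ultimately show ?thesis using r by (simp add: add_increasing)
      qed
    qed (auto simp: w_support)
  qed (use assms in \<open>auto intro: integrable_moment\<close>)
  also have "\<dots> = s powr y * moment w x + tail w s"
    using assms unfolding moment_eq tail_eq[OF assms(3)]
    by (subst Bochner_Integration.integral_add)
       (auto intro!: integrable_mult_right integrable_moment integrable_bounded_mult_w[where B=1] split: split_indicator)
  finally show ?thesis .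
qed

lemma nn_integral_tail:
  assumes "0 \<le> s"
  shows "(\<integral>\<^sup>+r. indicator {s..} r * ennreal (w r) \<partial>lborel) = ennreal (tail w s)"
proof -
  have "(\<integral>\<^sup>+r. indicator {s..} r * ennreal (w r) \<partial>lborel) = (\<integral>\<^sup>+r. ennreal (indicator {s..} r * w r) \<partial>lborel)"
    by (auto intro!: nn_integral_cong split: split_indicator)
  also have "\<dots> = ennreal (tail w s)"
    unfolding tail_eq[OF assms]
    by (intro nn_integral_eq_integral integrable_bounded_mult_w[where B=1]) (auto split: split_indicator)
  finally show ?thesis .
qed

text \<open>Fubini for \<open>r\<^sup>x = \<integral>\<^sub>0\<^sup>r x s\<^sup>x\<^sup>-\<^sup>1 ds\<close>.\<close>

lemma moment_eq_nn_integral_tail: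
  assumes "1 \<le> x"
  shows "ennreal (moment w x) = (\<integral>\<^sup>+s. indicator {0..1} s * ennreal (x * s powr (x - 1) * tail w s) \<partial>lborel)"
proof -
  have powr_int: "ennreal (r powr x) = (\<integral>\<^sup>+s. ennreal (x * s powr (x - 1)) * indicator {0..r} s \<partial>lborel)" if "0 \<le> r" for r
  proof -
    have "((\<lambda>s. x * s powr (x - 1)) has_integral r powr x) {0..r}"
      using has_integral_mult_right[OF has_integral_powr_from_0[of "x - 1" r], of x] that assms by simp
    then have "(\<integral>\<^sup>+s. ennreal (x * s powr (x - 1)) * indicator {0..r} s \<partial>lborel) = ennreal (r powr x)"
      using assms by (intro nn_integral_has_integral_lebesgue') auto
    then show ?thesis by simp
  qed
  have "ennreal (moment w x) = (\<integral>\<^sup>+r. ennreal (r powr x * w r) \<partial>lborel)"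
    unfolding moment_eq using assms by (subst nn_integral_eq_integral) (auto intro: integrable_moment)
  also have "\<dots> = (\<integral>\<^sup>+r. \<integral>\<^sup>+s. ennreal (x * s powr (x - 1)) * indicator {0..} s * (indicator {0..} (r - s) * ennreal (w r)) \<partial>lborel \<partial>lborel)"
  proof (rule nn_integral_cong)
    fix r :: real
    show "ennreal (r powr x * w r) = (\<integral>\<^sup>+s. ennreal (x * s powr (x - 1)) * indicator {0..} s * (indicator {0..} (r - s) * ennreal (w r)) \<partial>lborel)"
    proof (cases "r \<in> {0..<1}")
      case True
      have "ennreal (r powr x * w r) = (\<integral>\<^sup>+s. ennreal (x * s powr (x - 1)) * indicator {0..r} s * ennreal (w r) \<partial>lborel)"
        using True by (subst nn_integral_multc) (auto simp: powr_int ennreal_mult)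
      then show ?thesis by (auto intro!: nn_integral_cong split: split_indicator)
    qed (simp add: w_support)
  qed
  also have "\<dots> = (\<integral>\<^sup>+s. \<integral>\<^sup>+r. ennreal (x * s powr (x - 1)) * indicator {0..} s * (indicator {0..} (r - s) * ennreal (w r)) \<partial>lborel \<partial>lborel)"
    by (rule lborel_pair.Fubini'[symmetric]) auto
  also have "\<dots> = (\<integral>\<^sup>+s. indicator {0..1} s * ennreal (x * s powr (x - 1) * tail w s) \<partial>lborel)"
  proof (rule nn_integral_cong)
    fix s :: real
    have "(\<integral>\<^sup>+r. indicator {0..} (r - s) * ennreal (w r) \<partial>lborel) = ennreal (tail w s)" if "0 \<le> s"
      using nn_integral_tail[OF that] by (simp add: indicator_def)
    moreover have "tail w s = 0" if "1 < s"
      using that unfolding tail_def set_lebesgue_integral_def by simp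
    ultimately show "(\<integral>\<^sup>+r. ennreal (x * s powr (x - 1)) * indicator {0..} s * (indicator {0..} (r - s) * ennreal (w r)) \<partial>lborel)
       = indicator {0..1} s * ennreal (x * s powr (x - 1) * tail w s)"
      using assms by (subst nn_integral_cmult) (auto simp: ennreal_mult tail_nonneg split: split_indicator)
  qed
  finally show ?thesis .
qed


section \<open>The weighted area as a product of angle and radius\<close>

lemma sets_weighted_area: "sets \<mu> = sets (lebesgue_on unit_disc)"
  and space_weighted_area: "space \<mu> = unit_disc"
  unfolding weighted_area_def disc_area_def by (simp_all add: space_restrict_space)

lemma measurable_lebesgue_on_disc:
  "f \<in> borel \<rightarrow>\<^sub>M N \<Longrightarrow> f \<in> lebesgue_on unit_disc \<rightarrow>\<^sub>M N"
  by (auto intro!: measurable_restrict_space1 measurable_completion)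

lemma measurable_weighted_area:
  "f \<in> borel \<rightarrow>\<^sub>M N \<Longrightarrow> f \<in> \<mu> \<rightarrow>\<^sub>M N"
  using measurable_lebesgue_on_disc by (simp add: measurable_cong_sets[OF sets_weighted_area refl])

lemma measurable_ident_weighted_area [measurable]: "(\<lambda>z. z) \<in> \<mu> \<rightarrow>\<^sub>M borel"
  by (rule measurable_weighted_area) simp

lemma nn_integral_weighted_area:
  assumes "f \<in> borel_measurable borel"
  shows "(\<integral>\<^sup>+z. f z \<partial>\<mu>) = (\<integral>\<^sup>+z. f z * ennreal (w (norm z) / pi) \<partial>lborel)"
proof -
  have m: "f \<in> borel_measurable (lebesgue_on unit_disc)"
    "(\<lambda>z. ennreal (w (norm z))) \<in> borel_measurable (lebesgue_on unit_disc)"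
    by (auto intro!: measurable_lebesgue_on_disc assms)
  have "(\<integral>\<^sup>+z. f z \<partial>\<mu>) = (\<integral>\<^sup>+z. ennreal (1 / pi) * (ennreal (w (norm z)) * f z) \<partial>lebesgue_on unit_disc)"
    unfolding weighted_area_def disc_area_def
    using m borel_measurable_times_ennreal[OF m(2,1)] by (subst nn_integral_density; simp add: nn_integral_density)
  also have "\<dots> = (\<integral>\<^sup>+z. ennreal (1 / pi) * (ennreal (w (norm z)) * f z) * indicator unit_disc z \<partial>lborel)"
    by (simp add: nn_integral_restrict_space nn_integral_completion)
  also have "\<dots> = (\<integral>\<^sup>+z. f z * ennreal (w (norm z) / pi) \<partial>lborel)"
  proof (rule nn_integral_cong)
    fix z :: complex
    have "ennreal (w (norm z) / pi) = ennreal (1 / pi) * ennreal (w (norm z))"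
      by (simp add: ennreal_mult[symmetric])
    then show "ennreal (1 / pi) * (ennreal (w (norm z)) * f z) * indicator unit_disc z = f z * ennreal (w (norm z) / pi)"
      by (cases "norm z < 1") (auto simp: w_support mult_ac)
  qed
  finally show ?thesis .
qed

lemma nn_integral_weighted_area_polar:
  assumes [measurable]: "f \<in> borel_measurable borel"
  shows "(\<integral>\<^sup>+z. f z \<partial>\<mu>) =
    (\<integral>\<^sup>+t. indicator {a<..<a+2*pi} t * (\<integral>\<^sup>+r. ennreal (r * w r / pi) * f (r * cis t) \<partial>lborel) \<partial>lborel)"
proof -
  have "(\<integral>\<^sup>+z. f z \<partial>\<mu>) =
    (\<integral>\<^sup>+t. indicator {a<..<a+2*pi} t * (\<integral>\<^sup>+r. indicator {0<..} r * ennreal r * (f (r * cis t) * ennreal (w (norm (r * cis t)) / pi)) \<partial>lborel) \<partial>lborel)"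
    unfolding nn_integral_weighted_area[OF assms] by (rule nn_integral_polar) measurable
  also have "\<dots> = (\<integral>\<^sup>+t. indicator {a<..<a+2*pi} t * (\<integral>\<^sup>+r. ennreal (r * w r / pi) * f (r * cis t) \<partial>lborel) \<partial>lborel)"
  proof -
    have "indicator {0<..} r * ennreal r * (f (r * cis t) * ennreal (w (norm (r * cis t)) / pi)) = ennreal (r * w r / pi) * f (r * cis t)" for r t
    proof (cases "r > 0")
      case True
      then have "ennreal (r * w r / pi) = ennreal r * ennreal (w r / pi)"
        by (simp add: ennreal_mult[symmetric])
      then show ?thesis using True by (simp add: norm_mult mult_ac)
    qed (cases "r = 0", auto simp: w_support)
    then show ?thesis by simp
  qed
  finally show ?thesis .
qed

definition angular :: "real \<Rightarrow> real measure" where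
  "angular a = density lborel (indicator {a<..<a+2*pi})"

definition radial :: "real measure" where
  "radial = density lborel (\<lambda>r. ennreal (r * w r / pi))"

lemma sets_angular [measurable_cong, simp]: "sets (angular a) = sets borel"
  and sets_radial [measurable_cong, simp]: "sets radial = sets borel"
  by (simp_all add: angular_def radial_def)

lemma integrable_r_w: "integrable lborel (\<lambda>r. r * w r / pi)"
  using integrable_bounded_mult_w[of "\<lambda>r. r / pi" "1 / pi"] by (simp add: divide_right_mono)

lemma r_w_nonneg: "0 \<le> r * w r / pi"
  by (cases "0 \<le> r") (auto simp: w_support)

lemma finite_measure_angular: "finite_measure (angular a)"
  by (rule finite_measureI) (simp add: angular_def emeasure_density nn_integral_indicator del: ennreal_plus)

lemma finite_measure_radial: "finite_measure radial"
proof (rule finite_measureI)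
  have "emeasure radial (space radial) = (\<integral>\<^sup>+r. ennreal (r * w r / pi) \<partial>lborel)"
    by (simp add: radial_def emeasure_density)
  also have "\<dots> < \<infinity>"
    using integrable_r_w r_w_nonneg by (simp add: nn_integral_eq_integral)
  finally show "emeasure radial (space radial) \<noteq> \<infinity>" by simp
qed

lemma pair_finite_angular_radial: "finite_measure (angular a \<Otimes>\<^sub>M radial)"
  by (intro finite_measure_pair_measure finite_measure_angular finite_measure_radial)

text \<open>Stated for the image of \<open>\<mu>\<close> on the Borel sets, since
  \<open>\<mu>\<close> itself lives on the Lebesgue measurable subsets of the disc.\<close>

lemma weighted_area_polar:
  "distr \<mu> borel (\<lambda>z. z) = distr (angular a \<Otimes>\<^sub>M radial) borel (\<lambda>(t, r). complex_of_real r * cis t)"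
proof (rule measure_eqI)
  interpret R: finite_measure radial by (rule finite_measure_radial)
  fix X :: "complex set" assume "X \<in> sets (distr \<mu> borel (\<lambda>z. z))"
  then have [measurable]: "X \<in> sets borel" by simp
  have "emeasure (distr \<mu> borel (\<lambda>z. z)) X = (\<integral>\<^sup>+z. indicator X z \<partial>distr \<mu> borel (\<lambda>z. z))"
    by simp
  also have "\<dots> = (\<integral>\<^sup>+z. indicator X z \<partial>\<mu>)"
    by (rule nn_integral_distr) auto
  also have "\<dots> = (\<integral>\<^sup>+t. indicator {a<..<a+2*pi} t * (\<integral>\<^sup>+r. ennreal (r * w r / pi) * indicator X (r * cis t) \<partial>lborel) \<partial>lborel)"
    by (rule nn_integral_weighted_area_polar) auto
  also have "\<dots> = (\<integral>\<^sup>+t. \<integral>\<^sup>+r. indicator X (r * cis t) \<partial>radial \<partial>angular a)"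
    unfolding angular_def radial_def by (simp add: nn_integral_density)
  also have "\<dots> = (\<integral>\<^sup>+p. indicator X (case p of (t, r) \<Rightarrow> complex_of_real r * cis t) \<partial>(angular a \<Otimes>\<^sub>M radial))"
    by (subst R.nn_integral_fst[symmetric]) auto
  also have "\<dots> = (\<integral>\<^sup>+z. indicator X z \<partial>distr (angular a \<Otimes>\<^sub>M radial) borel (\<lambda>(t, r). complex_of_real r * cis t))"
    by (rule nn_integral_distr[symmetric]) auto
  finally show "emeasure (distr \<mu> borel (\<lambda>z. z)) X = emeasure (distr (angular a \<Otimes>\<^sub>M radial) borel (\<lambda>(t, r). complex_of_real r * cis t)) X"
    by simp
qed simp

lemma finite_measure_weighted_area: "finite_measure \<mu>"
proof (rule finite_measureI)
  interpret P: finite_measure "angular 0 \<Otimes>\<^sub>M radial" by (rule pair_finite_angular_radial)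
  have "emeasure \<mu> (space \<mu>) = emeasure (distr \<mu> borel (\<lambda>z. z)) UNIV"
    by (subst emeasure_distr) auto
  also have "\<dots> = emeasure (angular 0 \<Otimes>\<^sub>M radial) (space (angular 0 \<Otimes>\<^sub>M radial))"
    unfolding weighted_area_polar[of 0] by (subst emeasure_distr) auto
  finally show "emeasure \<mu> (space \<mu>) \<noteq> \<infinity>" by simp
qed

text \<open>Formula and bounds are required only for angles in the open interval and radii in (0,
  1), where the two factors are concentrated; this lets the argument function jump on the
  cut.\<close>

lemma integral_weighted_area_separated:
  fixes u v :: "real \<Rightarrow> complex" and f :: "complex \<Rightarrow> complex"
  assumes [measurable]: "u \<in> borel_measurable borel" "v \<in> borel_measurable borel" "f \<in> borel_measurable borel"
    and f: "\<And>t r. t \<in> {a<..<a+2*pi} \<Longrightarrow> 0 < r \<Longrightarrow> r < 1 \<Longrightarrow> f (r * cis t) = u t * v r"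
    and u: "\<And>t. t \<in> {a<..<a+2*pi} \<Longrightarrow> norm (u t) \<le> B" and v: "\<And>r. 0 < r \<Longrightarrow> r < 1 \<Longrightarrow> norm (v r) \<le> B'"
  shows "(LINT z|\<mu>. f z) = (LINT t|angular a. u t) * (LINT r|radial. v r)"
proof -
  interpret A: finite_measure "angular a" by (rule finite_measure_angular)
  interpret R: finite_measure radial by (rule finite_measure_radial)
  interpret AR: pair_sigma_finite "angular a" radial ..
  have At: "AE t in angular a. t \<in> {a<..<a+2*pi}"
    unfolding angular_def by (subst AE_density) (auto simp: indicator_def)
  have Rr: "AE r in radial. 0 < r \<and> r < 1"
    unfolding radial_def
    by (subst AE_density) (auto intro!: eventually_mono[OF AE_lborel_singleton[of 0]] simp: ennreal_eq_0_iff not_less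
      intro: ccontr simp: w_support zero_less_mult_iff)
  have Bu: "AE t in angular a. norm (u t) \<le> B"
    using At by eventually_elim (rule u)
  have Bv: "AE r in radial. norm (v r) \<le> B'"
    using Rr by eventually_elim (auto intro: v)
  have "(LINT z|\<mu>. f z) = (LINT z|distr \<mu> borel (\<lambda>z. z). f z)"
    by (rule integral_distr[symmetric]) auto
  also have "\<dots> = (LINT p|(angular a \<Otimes>\<^sub>M radial). f (case p of (t, r) \<Rightarrow> complex_of_real r * cis t))"
    unfolding weighted_area_polar[of a] by (rule integral_distr) auto
  also have "\<dots> = (LINT p|(angular a \<Otimes>\<^sub>M radial). u (fst p) * v (snd p))"
  proof (rule integral_cong_AE)
    have "AE p in angular a \<Otimes>\<^sub>M radial. fst p \<in> {a<..<a+2*pi} \<and> 0 < snd p \<and> snd p < 1"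
    proof (rule AR.AE_pair_measure)
      show "AE x in angular a. AE y in radial. fst (x, y) \<in> {a<..<a+2*pi} \<and> 0 < snd (x, y) \<and> snd (x, y) < 1"
        using At
      proof eventually_elim
        case (elim x)
        show ?case using Rr by eventually_elim (use elim in simp)
      qed
    qed measurable
    then show "AE p in angular a \<Otimes>\<^sub>M radial. f (case p of (t, r) \<Rightarrow> complex_of_real r * cis t) = u (fst p) * v (snd p)"
      apply (rule eventually_mono)
      subgoal for p using f[of "fst p" "snd p"] by (simp add: split_beta)
      done
  qed auto
  also have "\<dots> = (LINT t|angular a. LINT r|radial. u t * v r)"
  proof -
    interpret P: finite_measure "angular a \<Otimes>\<^sub>M radial" by (rule pair_finite_angular_radial)
    have "AE p in angular a \<Otimes>\<^sub>M radial. norm (u (fst p)) \<le> B \<and> norm (v (snd p)) \<le> B'"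
    proof (rule AR.AE_pair_measure)
      show "AE x in angular a. AE y in radial. norm (u (fst (x, y))) \<le> B \<and> norm (v (snd (x, y))) \<le> B'"
        using Bu
      proof eventually_elim
        case (elim x)
        show ?case using Bv by eventually_elim (simp add: elim)
      qed
    qed measurable
    then have "AE p in angular a \<Otimes>\<^sub>M radial. norm (u (fst p) * v (snd p)) \<le> B * B'"
    proof eventually_elim
      case (elim p)
      moreover have "0 \<le> B" using elim norm_ge_zero[of "u (fst p)"] by linarith
      ultimately show ?case unfolding norm_mult by (intro mult_mono) auto
    qed
    then have "integrable (angular a \<Otimes>\<^sub>M radial) (\<lambda>p. u (fst p) * v (snd p))"
      by (rule P.integrable_const_bound) auto
    then show ?thesis by (subst AR.integral_fst'[symmetric]) auto
  qed
  also have "\<dots> = (LINT t|angular a. u t) * (LINT r|radial. v r)"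
    by simp
  finally show ?thesis .
qed

end

subsection \<open>Moments and tails\<close>

context borel_weight
begin

text \<open>Express the moment through tails, apply doubling under the integral and substitute v =
  (1 + s) / 2, which contributes the factor 2.\<close>

lemma tail_doubling_imp_moment_bound:
  assumes C: "\<And>r. r \<in> {0..<1} \<Longrightarrow> tail w r \<le> C * tail w ((1 + r) / 2)" and "0 \<le> C" and x: "1 \<le> x"
  shows "moment w x \<le> 2 * C * moment w (2 * x - 1)"
proof -
  \<comment> \<open>A form of the tail that is visibly Borel measurable on the whole line; it agrees
    with \<open>tail w\<close> on nonnegative arguments.\<close>
  define tl where "tl s = (LINT r|lborel. indicator {0..} (r - s) * w r)" for s :: real
  have [measurable]: "tl \<in> borel_measurable borel"
    unfolding tl_def by (intro lborel.borel_measurable_lebesgue_integral) measurable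
  have tl: "tl s = tail w s" if "0 \<le> s" for s
    unfolding tl_def tail_eq[OF that] by (intro Bochner_Integration.integral_cong) (auto split: split_indicator)
  have tl1: "tail w 1 = 0" by (simp add: tail_def set_lebesgue_integral_def)
  have "ennreal (moment w x) = (\<integral>\<^sup>+s. indicator {0..1} s * ennreal (x * s powr (x - 1) * tail w s) \<partial>lborel)"
    by (rule moment_eq_nn_integral_tail) fact
  also have "\<dots> \<le> (\<integral>\<^sup>+s. indicator {0..1} s * ennreal (x * s powr (x - 1) * (C * tl ((1 + s) / 2))) \<partial>lborel)"
  proof (rule nn_integral_mono)
    fix s :: real
    show "indicator {0..1} s * ennreal (x * s powr (x - 1) * tail w s) \<le>
       indicator {0..1} s * ennreal (x * s powr (x - 1) * (C * tl ((1 + s) / 2)))"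
    proof (cases "s \<in> {0..1}")
      case True
      then have "tail w s \<le> C * tail w ((1 + s) / 2)"
        using C[of s] by (cases "s = 1") (auto simp: tl1)
      then show ?thesis using True x
        by (auto simp: tl intro!: ennreal_leI mult_left_mono)
    qed simp
  qed
  also have "\<dots> = ennreal 2 * (\<integral>\<^sup>+v. indicator {0..1} (2 * v - 1) * ennreal (x * (2 * v - 1) powr (x - 1) * (C * tl v)) \<partial>lborel)"
    by (subst nn_integral_real_affine[where c=2 and t="-1"]) (auto simp: algebra_simps)
  also have "\<dots> \<le> ennreal 2 * (\<integral>\<^sup>+v. ennreal C * (indicator {0..1} v * ennreal ((2 * x - 1) * v powr ((2 * x - 1) - 1) * tl v)) \<partial>lborel)"
  proof (intro mult_left_mono nn_integral_mono)
    fix v :: real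
    show "indicator {0..1} (2 * v - 1) * ennreal (x * (2 * v - 1) powr (x - 1) * (C * tl v)) \<le>
       ennreal C * (indicator {0..1} v * ennreal ((2 * x - 1) * v powr ((2 * x - 1) - 1) * tl v))"
    proof (cases "2 * v - 1 \<in> {0..1}")
      case True
      then have v: "1/2 \<le> v" "v \<le> 1" by auto
      txt \<open>This inequality turns the shift of the tail into a doubling of the exponent.\<close>
      have "2 * v - 1 \<le> v\<^sup>2" using zero_le_power2[of "v - 1"] by (simp add: power2_eq_square algebra_simps)
      then have "(2 * v - 1) powr (x - 1) \<le> (v\<^sup>2) powr (x - 1)"
        using x v by (intro powr_mono2) auto
      also have "(v\<^sup>2) powr (x - 1) = v powr ((2 * x - 1) - 1)"
        using v by (simp add: powr_powr flip: powr_numeral)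
      finally have "x * (2 * v - 1) powr (x - 1) \<le> (2 * x - 1) * v powr ((2 * x - 1) - 1)"
        using x by (intro mult_mono) auto
      then have "x * (2 * v - 1) powr (x - 1) * (C * tl v) \<le> (2 * x - 1) * v powr ((2 * x - 1) - 1) * (C * tl v)"
        using v \<open>0 \<le> C\<close> by (intro mult_right_mono) (auto simp: tl tail_nonneg)
      then show ?thesis
        using True v \<open>0 \<le> C\<close> x by (auto simp: ennreal_mult[symmetric] tl tail_nonneg mult_ac intro!: ennreal_leI)
    qed simp
  qed simp
  also have "\<dots> = ennreal 2 * (ennreal C * (\<integral>\<^sup>+v. indicator {0..1} v * ennreal ((2 * x - 1) * v powr ((2 * x - 1) - 1) * tail w v) \<partial>lborel))"
  proof -
    have eq: "indicator {0..1} v * ennreal ((2 * x - 1) * v powr ((2 * x - 1) - 1) * tl v) =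
        indicator {0..1} v * ennreal ((2 * x - 1) * v powr ((2 * x - 1) - 1) * tail w v)" for v :: real
      by (cases "0 \<le> v") (auto simp: tl)
    show ?thesis unfolding eq[symmetric] by (rule nn_integral_cmult[THEN arg_cong]) measurable
  qed
  also have "(\<integral>\<^sup>+v. indicator {0..1} v * ennreal ((2 * x - 1) * v powr ((2 * x - 1) - 1) * tail w v) \<partial>lborel) = ennreal (moment w (2 * x - 1))"
    using x by (intro moment_eq_nn_integral_tail[symmetric]) auto
  also have "ennreal 2 * (ennreal C * ennreal (moment w (2 * x - 1))) = ennreal (2 * C * moment w (2 * x - 1))"
    using \<open>0 \<le> C\<close> by (simp add: ennreal_mult[symmetric] moment_nonneg mult_ac del: ennreal_numeral)
  finally show ?thesis
    using \<open>0 \<le> C\<close> by (simp add: moment_nonneg)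
qed

text \<open>One application reaches only \<open>2 * x - 1\<close>. Two reach
  \<open>4 * x - 3\<close>, which is at least \<open>2 * x\<close> for \<open>x \<ge> 3/2\<close>;
  smaller \<open>x\<close> are handled by the quotient of the moments at 1 and 3.\<close>

lemma doubling_of_D_hat:
  assumes "w \<in> class_D_hat"
  obtains C where "1 \<le> C" "\<And>x. 1 \<le> x \<Longrightarrow> moment w x \<le> C * moment w (2 * x)"
proof -
  obtain C where C: "C > 1" "\<And>r. r \<in> {0..<1} \<Longrightarrow> tail w r \<le> C * tail w ((1 + r) / 2)"
    using assms unfolding class_D_hat_def by blast
  have step: "moment w x \<le> 2 * C * moment w (2 * x - 1)" if "1 \<le> x" for x
    using that C by (intro tail_doubling_imp_moment_bound) auto
  define K where "K = max 1 (max (2 * C * (2 * C)) (moment w 1 / moment w 3))"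
  have "moment w x \<le> K * moment w (2 * x)" if x: "1 \<le> x" for x
  proof (cases "x \<le> 3/2")
    case True
    have "moment w x \<le> moment w 1" using x by (intro moment_antimono) auto
    also have "\<dots> = moment w 1 / moment w 3 * moment w 3" using moment_pos[of 3] by simp
    also have "\<dots> \<le> K * moment w (2 * x)"
      using True x by (intro mult_mono moment_antimono) (auto simp: K_def moment_nonneg)
    finally show ?thesis .
  next
    case False
    have "moment w x \<le> 2 * C * moment w (2 * x - 1)" by (rule step) fact
    also have "\<dots> \<le> 2 * C * (2 * C * moment w (2 * (2 * x - 1) - 1))"
      using x C by (intro mult_left_mono step) auto
    also have "\<dots> \<le> 2 * C * (2 * C * moment w (2 * x))"
      using False C by (intro mult_left_mono moment_antimono) auto
    also have "\<dots> \<le> K * moment w (2 * x)"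
      by (auto simp: K_def mult.assoc[symmetric] moment_nonneg intro!: mult_right_mono)
    finally show ?thesis .
  qed
  then show thesis by (intro that[of K]) (auto simp: K_def)
qed

lemma moment_iterate:
  assumes "\<And>x. 1 \<le> x \<Longrightarrow> moment w x \<le> C * moment w (2 * x)" "0 \<le> C" "1 \<le> x"
  shows "moment w x \<le> C ^ m * moment w (2 ^ m * x)"
proof (induction m)
  case (Suc m)
  have "1 * 1 \<le> 2 ^ m * x" using assms(3) by (intro mult_mono) auto
  then have "C ^ m * moment w (2 ^ m * x) \<le> C ^ m * (C * moment w (2 * (2 ^ m * x)))"
    using assms by (intro mult_left_mono) auto
  then show ?case using Suc by (simp add: mult_ac)
qed simp

text \<open>For \<open>x > 2\<close> the power \<open>r powr x\<close> is at least
  \<open>exp (-2)\<close> on the range of the tail; for \<open>x \<le> 2\<close> monotonicity gives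
  the bound.\<close>

lemma tail_le_moment:
  obtains K where "1 \<le> K" "\<And>x. 1 \<le> x \<Longrightarrow> tail w (1 - 1 / x) \<le> K * moment w x"
proof -
  define K where "K = max (exp 2) (tail w 0 / moment w 2)"
  have K1: "1 \<le> K" by (simp add: K_def le_max_iff_disj)
  have "tail w (1 - 1 / x) \<le> K * moment w x" if x: "1 \<le> x" for x
  proof (cases "x \<le> 2")
    case True
    have "tail w (1 - 1 / x) \<le> tail w 0" using x by (intro tail_antimono) auto
    also have "\<dots> = tail w 0 / moment w 2 * moment w 2" using moment_pos[of 2] by simp
    also have "\<dots> \<le> K * moment w x"
      using True x K1 by (intro mult_mono moment_antimono) (auto simp: moment_nonneg, auto simp: K_def)
    finally show ?thesis .
  next
    case False
    then have x2: "x > 2" by simp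
    have "ln (1 + 1 / (x - 1)) \<le> 1 / (x - 1)" using x2 by (intro ln_add_one_self_le_self) auto
    moreover have "1 + 1 / (x - 1) = inverse (1 - 1 / x)" using x2 by (simp add: field_simps)
    ultimately have "- ln (1 - 1 / x) \<le> 1 / (x - 1)" using x2 by (simp add: ln_inverse)
    then have "x * (- ln (1 - 1 / x)) \<le> x * (1 / (x - 1))" using x2 by (intro mult_left_mono) auto
    also have "\<dots> \<le> 2" using x2 by (simp add: field_simps)
    finally have "exp (-2) \<le> (1 - 1 / x) powr x" using x2 by (simp add: powr_def)
    then have "exp (-2) * tail w (1 - 1 / x) \<le> (1 - 1 / x) powr x * tail w (1 - 1 / x)"
      using x2 by (intro mult_right_mono tail_nonneg) auto
    also have "\<dots> \<le> moment w x" using x2 by (intro moment_ge_tail) auto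
    finally have "tail w (1 - 1 / x) \<le> exp 2 * moment w x" by (simp add: exp_minus field_simps)
    also have "\<dots> \<le> K * moment w x" by (intro mult_right_mono) (auto simp: K_def moment_nonneg)
    finally show ?thesis .
  qed
  then show thesis by (intro that[of K] K1)
qed

text \<open>At exponent x = L y the radii below 1 - 1/y contribute at most \<open>exp (- L)\<close>
  times the moment at x, hence at most half of the moment at 2x by the choice of \<open>L\<close>
  and doubling. So the tail carries the other half, and doubling leads back from 2x to
  \<open>y\<close>.\<close>

lemma moment_le_tail:
  assumes C: "\<And>x. 1 \<le> x \<Longrightarrow> moment w x \<le> C * moment w (2 * x)" and C1: "1 \<le> C"
  obtains K where "1 \<le> K" "\<And>x. 1 \<le> x \<Longrightarrow> moment w x \<le> K * tail w (1 - 1 / x)"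
proof -
  define L where "L = ln (2 * C) + 1"
  have L1: "1 \<le> L" using C1 by (simp add: L_def)
  obtain m where m: "L \<le> 2 ^ m" using real_arch_pow[of 2 L] by (auto intro: less_imp_le)
  define K where "K = 2 * C ^ Suc m"
  have "1 \<le> C ^ Suc m" using C1 by (rule one_le_power)
  then have K1: "1 \<le> K" by (simp add: K_def)
  have "moment w y \<le> K * tail w (1 - 1 / y)" if y: "1 \<le> y" for y
  proof -
    define x where "x = L * y"
    have x1: "1 \<le> x" using mult_mono[of 1 L 1 y] L1 y by (simp add: x_def)
    let ?s = "1 - 1 / y"
    have s: "0 \<le> ?s" "?s \<le> 1" using y by auto
    have "?s powr x \<le> exp (- L)"
    proof (cases "y = 1")
      case True then show ?thesis by simp
    next
      case False
      then have y1: "1 < y" using y by simp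
      have "ln ?s \<le> - (1 / y)" using ln_le_minus_one[of ?s] y1 by simp
      then have "x * ln ?s \<le> x * (- (1 / y))" using x1 by (intro mult_left_mono) auto
      also have "\<dots> = - L" using y by (simp add: x_def)
      finally show ?thesis using y1 by (simp add: powr_def)
    qed
    also have "exp (- L) \<le> 1 / (2 * C)"
    proof -
      have "exp (- L) = exp (- ln (2 * C)) * exp (-1)" by (simp add: L_def exp_add[symmetric])
      also have "\<dots> \<le> 1 / (2 * C) * 1" using C1 by (intro mult_mono) (auto simp: exp_minus field_simps)
      finally show ?thesis by simp
    qed
    finally have "?s powr x * moment w x \<le> 1 / (2 * C) * moment w x" by (intro mult_right_mono moment_nonneg)
    also have "\<dots> \<le> 1 / (2 * C) * (C * moment w (2 * x))" using C1 x1 by (intro mult_left_mono C) auto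
    finally have "?s powr x * moment w x \<le> moment w (2 * x) / 2" using C1 by simp
    moreover have "moment w (2 * x) \<le> ?s powr x * moment w x + tail w ?s"
      using moment_split[of x x ?s] x1 s by simp
    ultimately have 2: "moment w (2 * x) \<le> 2 * tail w ?s" by simp
    have "moment w y \<le> C ^ Suc m * moment w (2 ^ Suc m * y)" using C C1 y by (intro moment_iterate) auto
    also have "\<dots> \<le> C ^ Suc m * moment w (2 * x)"
      using C1 x1 y m by (intro mult_left_mono moment_antimono) (auto simp: x_def)
    also have "\<dots> \<le> C ^ Suc m * (2 * tail w ?s)"
      using C1 2 by (intro mult_left_mono) auto
    finally show ?thesis by (simp add: K_def mult_ac)
  qed
  then show thesis by (intro that[of K] K1)
qed

text \<open>Under x = 1 / (1 - r) the tail at \<open>r\<close> is comparable to the moment at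
  \<open>x\<close>, and passing from \<open>r\<close> to \<open>(1 + r) / 2\<close> doubles
  \<open>x\<close>.\<close>

lemma D_hat_of_doubling:
  assumes "radial_weight w"
    and C: "\<And>x. 1 \<le> x \<Longrightarrow> moment w x \<le> C * moment w (2 * x)" and C1: "1 \<le> C"
  shows "w \<in> class_D_hat"
proof -
  obtain K where K: "1 \<le> K" "\<And>x. 1 \<le> x \<Longrightarrow> tail w (1 - 1 / x) \<le> K * moment w x"
    using tail_le_moment by blast
  obtain K' where K': "1 \<le> K'" "\<And>x. 1 \<le> x \<Longrightarrow> moment w x \<le> K' * tail w (1 - 1 / x)"
    using moment_le_tail[OF C C1] by blast
  \<comment> \<open>The summand 1 ensures the strict inequality \<open>1 < B\<close> demanded by the
    class.\<close>
  define B where "B = K * (C * K') + 1"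
  have "tail w r \<le> B * tail w ((1 + r) / 2)" if r: "r \<in> {0..<1}" for r
  proof -
    define x where "x = 1 / (1 - r)"
    have x: "1 \<le> x" "1 - 1 / x = r" "1 - 1 / (2 * x) = (1 + r) / 2"
      using r by (auto simp: x_def field_simps)
    have "tail w r \<le> K * moment w x" using K(2)[OF x(1)] x by simp
    also have "\<dots> \<le> K * (C * moment w (2 * x))" using K x C by (intro mult_left_mono) auto
    also have "\<dots> \<le> K * (C * (K' * tail w (1 - 1 / (2 * x))))"
      using K C1 x K'(2)[of "2 * x"] by (intro mult_left_mono) auto
    also have "\<dots> \<le> B * tail w ((1 + r) / 2)"
      unfolding x(3) B_def using r tail_nonneg[of "(1 + r) / 2"] by (simp add: algebra_simps)
    finally show ?thesis .
  qed
  moreover have "1 < B" using K(1) K'(1) C1 by (simp add: B_def)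
  ultimately show ?thesis using assms(1) unfolding class_D_hat_def by blast
qed

text \<open>Doubling is iterated about log2 (y / x) times, and \<open>C \<le> 2 ^ g\<close> turns
  the product of the constants into a power of y / x. A positive natural exponent is convenient
  later, where one factor is split off the power.\<close>

lemma moment_power_law:
  assumes C: "\<And>x. 1 \<le> x \<Longrightarrow> moment w x \<le> C * moment w (2 * x)" and C1: "1 \<le> C"
  obtains A g where "1 \<le> A" "1 \<le> g" "\<And>x y. 1 \<le> x \<Longrightarrow> x \<le> y \<Longrightarrow> moment w x \<le> A * (y / x) ^ g * moment w y"
proof -
  obtain g where g: "C \<le> 2 ^ g" using real_arch_pow[of 2 C] by (auto intro: less_imp_le)
  have g': "C \<le> 2 ^ Suc g" using g by (rule order_trans) simp
  have "moment w x \<le> 2 ^ Suc g * (y / x) ^ Suc g * moment w y" if xy: "1 \<le> x" "x \<le> y" for x y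
  proof -
    define m where "m = nat \<lceil>log 2 (y / x)\<rceil>"
    have l0: "0 \<le> log 2 (y / x)" using xy by simp
    then have m: "log 2 (y / x) \<le> real m" "real m \<le> log 2 (y / x) + 1"
      unfolding m_def by linarith+
    have "y / x \<le> 2 powr real m"
      using m(1) xy by (subst (asm) log_le_iff) auto
    then have 1: "y \<le> 2 ^ m * x" using xy by (simp add: field_simps powr_realpow)
    have "(2::real) ^ m = 2 powr real m" by (simp add: powr_realpow)
    also have "\<dots> \<le> 2 powr (log 2 (y / x) + 1)" using m(2) by (intro powr_mono) auto
    also have "\<dots> = 2 * (y / x)" using xy by (simp add: powr_add)
    finally have 2: "2 ^ m \<le> 2 * (y / x)" .
    have "moment w x \<le> C ^ m * moment w (2 ^ m * x)" using C C1 xy by (intro moment_iterate) auto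
    also have "\<dots> \<le> C ^ m * moment w y" using 1 C1 xy by (intro mult_left_mono moment_antimono) auto
    also have "\<dots> \<le> (2 ^ Suc g) ^ m * moment w y"
      using g' C1 by (intro mult_right_mono power_mono moment_nonneg) auto
    also have "(2 ^ Suc g) ^ m = ((2::real) ^ m) ^ Suc g" by (simp only: power_mult[symmetric] mult.commute)
    also have "((2::real) ^ m) ^ Suc g * moment w y \<le> (2 * (y / x)) ^ Suc g * moment w y"
      using 2 by (intro mult_right_mono power_mono moment_nonneg) auto
    finally show ?thesis by (simp only: power_mult_distrib)
  qed
  then show thesis by (intro that[of "2 ^ Suc g" "Suc g"] one_le_power) auto
qed

text \<open>The defining inequality of \<open>class_M\<close> is iterated floor (log K (y / x))
  times; the incomplete last step costs the constant \<open>C\<close>.\<close>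

lemma moment_decay:
  assumes "w \<in> class_M"
  obtains A e where "1 \<le> A" "0 < e" "e \<le> 1/2" "\<And>x y. 1 \<le> x \<Longrightarrow> x \<le> y \<Longrightarrow> moment w y \<le> A * (x / y) powr e * moment w x"
proof -
  obtain C K where CK: "1 < C" "1 < K" "\<And>x. 1 \<le> x \<Longrightarrow> C * moment w (K * x) \<le> moment w x"
    using assms unfolding class_M_def by auto
  \<comment> \<open>ln C / ln K is the natural exponent; the cap 1/2 keeps the later exponents in
    the range where the Forelli-Rudin integrals have simple constants.\<close>
  define e where "e = min (1/2) (ln C / ln K)"
  have e: "0 < e" "e \<le> 1/2" "e \<le> ln C / ln K"
    using CK unfolding e_def by (simp, intro min.cobounded1, intro min.cobounded2)
  have it: "C ^ m * moment w (K ^ m * x) \<le> moment w x" if x: "1 \<le> x" for x m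
  proof (induction m)
    case (Suc m)
    have "1 * 1 \<le> K ^ m * x" using x CK by (intro mult_mono) auto
    then have "C ^ m * (C * moment w (K * (K ^ m * x))) \<le> C ^ m * moment w (K ^ m * x)"
      using CK by (intro mult_left_mono) auto
    then show ?case using Suc by (simp add: mult_ac)
  qed simp
  have "moment w y \<le> C * (x / y) powr e * moment w x" if xy: "1 \<le> x" "x \<le> y" for x y
  proof -
    define m where "m = nat \<lfloor>log K (y / x)\<rfloor>"
    have l0: "0 \<le> log K (y / x)" using xy CK by (simp add: zero_le_log_cancel_iff)
    then have m: "real m \<le> log K (y / x)" "log K (y / x) \<le> real m + 1"
      unfolding m_def by linarith+
    have "K ^ m = K powr real m" using CK by (simp add: powr_realpow)
    also have "\<dots> \<le> K powr (log K (y / x))" using m(1) CK by (intro powr_mono) auto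
    also have "\<dots> = y / x" using xy CK by simp
    finally have 1: "K ^ m * x \<le> y" using xy by (simp add: field_simps)
    have 0: "0 \<le> K ^ m * x" using CK xy by simp
    have "C ^ m * moment w y \<le> C ^ m * moment w (K ^ m * x)"
      using 1 CK 0 by (intro mult_left_mono moment_antimono) auto
    also have "\<dots> \<le> moment w x" by (rule it) fact
    finally have 2: "C ^ m * moment w y \<le> moment w x" .
    have "(y / x) powr e = exp (e * ln (y / x))" using xy by (simp add: powr_def)
    also have "\<dots> \<le> exp (ln C / ln K * ln (y / x))" using mult_right_mono[OF e(3), of "ln (y / x)"] xy by simp
    also have "\<dots> = C powr log K (y / x)" using CK by (simp add: powr_def log_def mult_ac)
    also have "\<dots> \<le> C powr (real m + 1)" using m(2) CK by (intro powr_mono) auto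
    also have "\<dots> = C * C ^ m" using CK by (simp add: powr_add powr_realpow)
    finally have 3: "(y / x) powr e \<le> C * C ^ m" .
    have "(y / x) powr e * moment w y \<le> C * C ^ m * moment w y" using 3 by (intro mult_right_mono moment_nonneg)
    also have "\<dots> \<le> C * moment w x" using 2 CK by simp
    finally have "(y / x) powr e * moment w y \<le> C * moment w x" .
    then show ?thesis using xy by (simp add: powr_divide field_simps)
  qed
  then show thesis using CK e by (intro that[of C e]) auto
qed

end

subsection \<open>The projection as a power series\<close>

context borel_weight
begin

definition dcoef :: "nat \<Rightarrow> real" where
  "dcoef n = 1 / (2 * moment w (2 * real n + 1))"

lemma dcoef_pos: "0 < dcoef n"
  using moment_pos[of "2 * real n + 1"] by (simp add: dcoef_def)

lemma summable_dcoef: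
  assumes "0 \<le> x" "x < 1"
  shows "summable (\<lambda>n. dcoef n * x ^ n)"
proof -
  \<comment> \<open>Any \<open>s\<close> with x < s^2 < 1 would do: the moment at 2n + 1 is at least
    a constant times s^(2n), so the series is dominated by a geometric one of ratio x / s^2.\<close>
  define s where "s = sqrt ((1 + x) / 2)"
  have s2: "s\<^sup>2 = (1 + x) / 2" using assms by (simp add: s_def)
  have s: "0 < s" "s < 1" "x < s\<^sup>2" using assms s2 by (auto simp: s_def)
  show ?thesis
  proof (rule summable_comparison_test')
    show "summable (\<lambda>n. 1 / (2 * (s * tail w s)) * (x / s\<^sup>2) ^ n)"
      using s assms by (intro summable_mult summable_geometric) auto
    fix n :: nat
    have tp: "0 < tail w s" using s by (intro tail_pos) auto
    have "s powr (2 * real n + 1) * tail w s \<le> moment w (2 * real n + 1)"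
      using s by (intro moment_ge_tail) auto
    also have "s powr (2 * real n + 1) = (s\<^sup>2) ^ n * s"
      using s powr_realpow[of s "2 * n + 1"] by (simp add: power_mult add.commute)
    finally have le: "(s\<^sup>2) ^ n * s * tail w s \<le> moment w (2 * real n + 1)" .
    have "dcoef n * x ^ n \<le> 1 / (2 * ((s\<^sup>2) ^ n * s * tail w s)) * x ^ n"
      unfolding dcoef_def using le s tp assms moment_pos[of "2 * real n + 1"]
      by (intro mult_right_mono divide_left_mono) auto
    also have "\<dots> = 1 / (2 * (s * tail w s)) * (x / s\<^sup>2) ^ n"
      by (simp add: power_divide)
    finally show "norm (dcoef n * x ^ n) \<le> 1 / (2 * (s * tail w s)) * (x / s\<^sup>2) ^ n"
      using dcoef_pos[of n] assms by simp
  qed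
qed

lemma summable_dcoef_bounded:
  fixes c :: "nat \<Rightarrow> complex"
  assumes "\<And>n. norm (c n) \<le> B * dcoef n" "norm z < 1"
  shows "summable (\<lambda>n. norm (c n * z ^ n))"
proof (rule summable_comparison_test')
  show "summable (\<lambda>n. B * (dcoef n * norm z ^ n))"
    using assms by (intro summable_mult summable_dcoef) auto
  show "norm (norm (c n * z ^ n)) \<le> B * (dcoef n * norm z ^ n)" for n
    using assms(1)[of n] by (simp add: norm_mult norm_power mult.assoc[symmetric] mult_right_mono)
qed

lemma power_series_deriv:
  fixes c :: "nat \<Rightarrow> complex"
  assumes c: "\<And>n. norm (c n) \<le> B * dcoef n" and z: "norm z < 1"
  shows "((\<lambda>z. \<Sum>n. c n * z ^ n) has_field_derivative (\<Sum>n. diffs c n * z ^ n)) (at z)"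
  using z by (intro termdiffs_strong'[where K=1] summable_norm_cancel[OF summable_dcoef_bounded[OF c]])

lemma summable_diffs_dcoef:
  fixes c :: "nat \<Rightarrow> complex"
  assumes c: "\<And>n. norm (c n) \<le> B * dcoef n" and z: "norm z < 1"
  shows "summable (\<lambda>n. norm (diffs c n * z ^ n))"
proof -
  have "summable (\<lambda>n. diffs (\<lambda>n. norm (c n)) n * norm z ^ n)"
  proof (rule termdiff_converges[where K=1])
    fix x :: real assume "norm x < 1"
    then show "summable (\<lambda>n. norm (c n) * x ^ n)"
      using summable_norm_cancel[of "\<lambda>n. norm (c n) * x ^ n"] summable_dcoef_bounded[OF c, of "complex_of_real x"]
      by (simp add: norm_mult norm_power abs_mult power_abs)
  qed (use z in auto)
  moreover have "norm (diffs c n * z ^ n) = diffs (\<lambda>n. norm (c n)) n * norm z ^ n" for n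
    by (simp add: diffs_def norm_mult norm_power del: of_nat_Suc)
  ultimately show ?thesis by simp
qed

text \<open>On the disc the powers of \<open>cnj \<zeta>\<close> are bounded by 1, so absolute
  summability of the coefficients and integrability of \<open>f\<close> justify termwise
  integration.\<close>

lemma integral_power_series:
  fixes f :: "complex \<Rightarrow> complex"
  assumes f: "integrable \<mu> f" and c: "summable (\<lambda>n. norm (c n))"
  shows "(LINT \<zeta>|\<mu>. f \<zeta> * (\<Sum>n. c n * cnj \<zeta> ^ n)) = (\<Sum>n. c n * (LINT \<zeta>|\<mu>. f \<zeta> * cnj \<zeta> ^ n))"
    and "integrable \<mu> (\<lambda>\<zeta>. f \<zeta> * (\<Sum>n. c n * cnj \<zeta> ^ n))"
proof -
  have [measurable]: "f \<in> borel_measurable \<mu>" using f by auto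
  have [measurable]: "(\<lambda>\<zeta>. cnj \<zeta>) \<in> borel_measurable \<mu>"
    by (intro measurable_weighted_area) (auto intro: borel_measurable_continuous_onI continuous_intros)
  have lt: "norm (cnj \<zeta> ^ n) \<le> 1" if "\<zeta> \<in> space \<mu>" for \<zeta> n
    using that by (auto simp: space_weighted_area norm_power intro: power_le_one)
  have bound: "norm (f \<zeta> * (c n * cnj \<zeta> ^ n)) \<le> norm (c n) * norm (f \<zeta>)" if "\<zeta> \<in> space \<mu>" for \<zeta> n
  proof -
    have "norm (c n) * norm (f \<zeta>) * norm (cnj \<zeta> ^ n) \<le> norm (c n) * norm (f \<zeta>) * 1"
      using that by (intro mult_left_mono lt) auto
    then show ?thesis by (simp add: norm_mult mult_ac)
  qed
  have i: "integrable \<mu> (\<lambda>\<zeta>. f \<zeta> * (c n * cnj \<zeta> ^ n))" for n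
  proof (rule Bochner_Integration.integrable_bound)
    show "integrable \<mu> (\<lambda>\<zeta>. norm (c n) * norm (f \<zeta>))" using f by auto
    show "AE \<zeta> in \<mu>. norm (f \<zeta> * (c n * cnj \<zeta> ^ n)) \<le> norm (norm (c n) * norm (f \<zeta>))"
      using bound by (intro AE_I2) (simp del: norm_mult)
  qed auto
  have s1: "summable (\<lambda>n. norm (f \<zeta> * (c n * cnj \<zeta> ^ n)))" if "\<zeta> \<in> space \<mu>" for \<zeta>
    using bound[OF that] by (intro summable_comparison_test'[OF summable_mult2[OF c, of "norm (f \<zeta>)"]]) auto
  have s2: "summable (\<lambda>n. LINT \<zeta>|\<mu>. norm (f \<zeta> * (c n * cnj \<zeta> ^ n)))"
  proof (rule summable_comparison_test')
    show "summable (\<lambda>n. norm (c n) * (LINT \<zeta>|\<mu>. norm (f \<zeta>)))" using c by (rule summable_mult2)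
    fix n
    have "(LINT \<zeta>|\<mu>. norm (f \<zeta> * (c n * cnj \<zeta> ^ n))) \<le> (LINT \<zeta>|\<mu>. norm (c n) * norm (f \<zeta>))"
      using i f bound by (intro integral_mono) auto
    then show "norm (LINT \<zeta>|\<mu>. norm (f \<zeta> * (c n * cnj \<zeta> ^ n))) \<le> norm (c n) * (LINT \<zeta>|\<mu>. norm (f \<zeta>))"
      by simp
  qed
  have eq: "f \<zeta> * (\<Sum>n. c n * cnj \<zeta> ^ n) = (\<Sum>n. f \<zeta> * (c n * cnj \<zeta> ^ n))" if "\<zeta> \<in> space \<mu>" for \<zeta>
  proof (rule suminf_mult[symmetric])
    have "norm (c n * cnj \<zeta> ^ n) \<le> norm (c n)" for n
      using mult_left_mono[OF lt[OF that, of n], of "norm (c n)"] by (simp add: norm_mult)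
    then show "summable (\<lambda>n. c n * cnj \<zeta> ^ n)"
      by (intro summable_norm_cancel[OF summable_comparison_test'[OF c]]) auto
  qed
  have "(LINT \<zeta>|\<mu>. f \<zeta> * (\<Sum>n. c n * cnj \<zeta> ^ n)) = (LINT \<zeta>|\<mu>. (\<Sum>n. f \<zeta> * (c n * cnj \<zeta> ^ n)))"
    by (intro Bochner_Integration.integral_cong refl eq)
  also have "\<dots> = (\<Sum>n. LINT \<zeta>|\<mu>. f \<zeta> * (c n * cnj \<zeta> ^ n))"
    using s1 s2 by (intro integral_suminf i AE_I2) auto
  also have "\<dots> = (\<Sum>n. c n * (LINT \<zeta>|\<mu>. f \<zeta> * cnj \<zeta> ^ n))"
  proof (rule arg_cong[where f=suminf], rule ext)
    fix n
    have "(\<lambda>\<zeta>. f \<zeta> * (c n * cnj \<zeta> ^ n)) = (\<lambda>\<zeta>. c n * (f \<zeta> * cnj \<zeta> ^ n))" by (simp add: mult_ac)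
    then show "(LINT \<zeta>|\<mu>. f \<zeta> * (c n * cnj \<zeta> ^ n)) = c n * (LINT \<zeta>|\<mu>. f \<zeta> * cnj \<zeta> ^ n)"
      by simp
  qed
  finally show "(LINT \<zeta>|\<mu>. f \<zeta> * (\<Sum>n. c n * cnj \<zeta> ^ n)) = (\<Sum>n. c n * (LINT \<zeta>|\<mu>. f \<zeta> * cnj \<zeta> ^ n))" .
  have "integrable \<mu> (\<lambda>\<zeta>. \<Sum>n. f \<zeta> * (c n * cnj \<zeta> ^ n))"
    using s1 s2 by (intro integrable_suminf i AE_I2) auto
  then show "integrable \<mu> (\<lambda>\<zeta>. f \<zeta> * (\<Sum>n. c n * cnj \<zeta> ^ n))"
    by (subst Bochner_Integration.integrable_cong[OF refl eq]) auto
qed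

definition fcoef :: "(complex \<Rightarrow> complex) \<Rightarrow> nat \<Rightarrow> complex" where
  "fcoef f n = of_real (dcoef n) * (LINT \<zeta>|\<mu>. f \<zeta> * cnj \<zeta> ^ n)"

lemma fcoef_bound:
  assumes f: "integrable \<mu> f"
  shows "norm (fcoef f n) \<le> (LINT \<zeta>|\<mu>. norm (f \<zeta>)) * dcoef n"
proof -
  have "norm (LINT \<zeta>|\<mu>. f \<zeta> * cnj \<zeta> ^ n) \<le> (LINT \<zeta>|\<mu>. norm (f \<zeta> * cnj \<zeta> ^ n))"
    by (rule integral_norm_bound)
  also have "\<dots> \<le> (LINT \<zeta>|\<mu>. norm (f \<zeta>))"
  proof (rule integral_mono')
    fix \<zeta> assume "\<zeta> \<in> space \<mu>"
    then have "norm (f \<zeta>) * norm (cnj \<zeta> ^ n) \<le> norm (f \<zeta>) * 1"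
      by (intro mult_left_mono) (auto simp: space_weighted_area norm_power intro: power_le_one)
    then show "norm (f \<zeta> * cnj \<zeta> ^ n) \<le> norm (f \<zeta>)" by (simp add: norm_mult)
  qed (use f in auto)
  finally show ?thesis
    using dcoef_pos[of n] by (simp add: fcoef_def norm_mult mult.commute mult_left_mono)
qed

lemma bergman_projection_eq:
  assumes f: "integrable \<mu> f" and z: "norm z < 1"
  shows "bergman_projection w f z = (\<Sum>n. fcoef f n * z ^ n)"
proof -
  have d: "norm (complex_of_real (dcoef n)) \<le> 1 * dcoef n" for n
    using dcoef_pos[of n] by simp
  define c where "c n = of_real (dcoef n) * z ^ n" for n
  have sc: "summable (\<lambda>n. norm (c n))"
    unfolding c_def using z by (intro summable_dcoef_bounded[OF d])
  have ker: "cnj (bergman_kernel w z \<zeta>) = (\<Sum>n. c n * cnj \<zeta> ^ n)" if "\<zeta> \<in> unit_disc" for \<zeta>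
  proof -
    have "norm (cnj z * \<zeta>) < 1"
      using z that mult_strict_mono[of "norm z" 1 "norm \<zeta>" 1] by (simp add: norm_mult)
    then have "summable (\<lambda>n. of_real (dcoef n) * (cnj z * \<zeta>) ^ n)"
      by (intro summable_norm_cancel[OF summable_dcoef_bounded[OF d]])
    then have "(\<lambda>n. of_real (dcoef n) * (cnj z * \<zeta>) ^ n) sums bergman_kernel w z \<zeta>"
      by (simp add: bergman_kernel_def dcoef_def summable_sums)
    then have "(\<lambda>n. cnj (of_real (dcoef n) * (cnj z * \<zeta>) ^ n)) sums cnj (bergman_kernel w z \<zeta>)"
      by (rule sums_cnj[THEN iffD2])
    then show ?thesis by (simp add: sums_iff c_def power_mult_distrib mult_ac)
  qed
  have "bergman_projection w f z = (LINT \<zeta>|\<mu>. f \<zeta> * (\<Sum>n. c n * cnj \<zeta> ^ n))"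
    unfolding bergman_projection_def
    by (intro Bochner_Integration.integral_cong refl) (simp add: space_weighted_area ker)
  also have "\<dots> = (\<Sum>n. c n * (LINT \<zeta>|\<mu>. f \<zeta> * cnj \<zeta> ^ n))"
    by (rule integral_power_series(1)[OF f sc])
  finally show ?thesis by (simp add: c_def fcoef_def mult_ac)
qed

lemma bergman_projection_has_derivative:
  assumes f: "integrable \<mu> f" and z: "norm z < 1"
  shows "(bergman_projection w f has_field_derivative (\<Sum>n. diffs (fcoef f) n * z ^ n)) (at z)"
proof -
  have "((\<lambda>z. \<Sum>n. fcoef f n * z ^ n) has_field_derivative (\<Sum>n. diffs (fcoef f) n * z ^ n)) (at z)"
    using fcoef_bound[OF f] z by (rule power_series_deriv)
  then show ?thesis
    by (rule has_field_derivative_transform_within_open[where S="ball 0 1"])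
       (use z f in \<open>auto simp: bergman_projection_eq\<close>)
qed

lemma bergman_projection_holomorphic:
  assumes "integrable \<mu> f"
  shows "bergman_projection w f holomorphic_on unit_disc"
  using bergman_projection_has_derivative[OF assms]
  unfolding holomorphic_on_open[OF open_ball] by (metis mem_ball_0)

lemma deriv_bergman_projection:
  assumes "integrable \<mu> f" "norm z < 1"
  shows "deriv (bergman_projection w f) z = (\<Sum>n. diffs (fcoef f) n * z ^ n)"
  using bergman_projection_has_derivative[OF assms] by (rule DERIV_imp_deriv)

text \<open>Derivative of the one-variable function with coefficients \<open>dcoef\<close>, whose
  value at \<open>z * cnj \<zeta>\<close> is the conjugated kernel. The chain rule in
  \<open>z\<close> adds a factor \<open>cnj \<zeta>\<close>.\<close>

definition kernel_deriv :: "complex \<Rightarrow> complex" where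
  "kernel_deriv a = (\<Sum>n. of_real (diffs dcoef n) * a ^ n)"

text \<open>Differentiation pairs the coefficient of index n + 1 with the moment against
  \<open>cnj \<zeta> ^ (n + 1)\<close>. One factor \<open>cnj \<zeta>\<close> is moved to
  \<open>f\<close>, and the series formula applies to the product.\<close>

lemma deriv_bergman_projection_integral:
  assumes f: "integrable \<mu> f" and z: "norm z < 1"
  shows "deriv (bergman_projection w f) z = (LINT \<zeta>|\<mu>. f \<zeta> * (cnj \<zeta> * kernel_deriv (z * cnj \<zeta>)))"
    and "integrable \<mu> (\<lambda>\<zeta>. f \<zeta> * (cnj \<zeta> * kernel_deriv (z * cnj \<zeta>)))"
proof -
  have [measurable]: "f \<in> borel_measurable \<mu>" using f by auto
  have [measurable]: "(\<lambda>\<zeta>. cnj \<zeta>) \<in> borel_measurable \<mu>"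
    by (intro measurable_weighted_area) (auto intro: borel_measurable_continuous_onI continuous_intros)
  have i: "integrable \<mu> (\<lambda>\<zeta>. f \<zeta> * cnj \<zeta>)"
  proof (rule Bochner_Integration.integrable_bound[OF f])
    show "AE \<zeta> in \<mu>. norm (f \<zeta> * cnj \<zeta>) \<le> norm (f \<zeta>)"
      by (intro AE_I2) (auto simp: space_weighted_area norm_mult intro: mult_left_le)
  qed auto
  define c where "c n = of_real (diffs dcoef n) * z ^ n" for n
  have d: "norm (complex_of_real (dcoef n)) \<le> 1 * dcoef n" for n
    using dcoef_pos[of n] by simp
  have dd: "diffs (\<lambda>n. complex_of_real (dcoef n)) n = of_real (diffs dcoef n)" for n
    by (simp add: diffs_def)
  have sc: "summable (\<lambda>n. norm (c n))"
    using summable_diffs_dcoef[OF d z] by (simp add: dd c_def)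
  have eq: "f \<zeta> * (cnj \<zeta> * kernel_deriv (z * cnj \<zeta>)) = f \<zeta> * cnj \<zeta> * (\<Sum>n. c n * cnj \<zeta> ^ n)" for \<zeta>
    by (simp add: kernel_deriv_def c_def power_mult_distrib mult_ac)
  show "integrable \<mu> (\<lambda>\<zeta>. f \<zeta> * (cnj \<zeta> * kernel_deriv (z * cnj \<zeta>)))"
    unfolding eq by (rule integral_power_series(2)[OF i sc])
  have "(LINT \<zeta>|\<mu>. f \<zeta> * (cnj \<zeta> * kernel_deriv (z * cnj \<zeta>))) = (\<Sum>n. c n * (LINT \<zeta>|\<mu>. f \<zeta> * cnj \<zeta> * cnj \<zeta> ^ n))"
    unfolding eq by (rule integral_power_series(1)[OF i sc])
  also have "\<dots> = (\<Sum>n. diffs (fcoef f) n * z ^ n)"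
    by (simp add: c_def diffs_def fcoef_def mult_ac)
  finally show "deriv (bergman_projection w f) z = (LINT \<zeta>|\<mu>. f \<zeta> * (cnj \<zeta> * kernel_deriv (z * cnj \<zeta>)))"
    using deriv_bergman_projection[OF f z] by simp
qed

section \<open>Integrals of monomials over radius and angle\<close>

lemma integral_radial_power: "(LINT r|radial. complex_of_real (r ^ n)) = of_real (moment w (real n + 1) / pi)"
proof -
  have "(LINT r|radial. complex_of_real (r ^ n)) = of_real (LINT r|radial. r ^ n)"
    by (rule integral_complex_of_real)
  also have "(LINT r|radial. r ^ n) = (LINT r|lborel. r * w r / pi * r ^ n)"
    unfolding radial_def using r_w_nonneg by (subst integral_density) auto
  also have "\<dots> = (LINT r|lborel. (r powr (real n + 1) * w r) / pi)"
  proof (rule Bochner_Integration.integral_cong[OF refl])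
    fix r :: real
    show "r * w r / pi * r ^ n = r powr (real n + 1) * w r / pi"
      by (cases "0 < r"; cases "r = 0") (auto simp: powr_add powr_realpow w_support)
  qed
  also have "\<dots> = moment w (real n + 1) / pi" unfolding moment_eq by simp
  finally show ?thesis .
qed

lemma integral_angular_FTC:
  fixes u U :: "real \<Rightarrow> complex"
  assumes "continuous_on UNIV u" and U: "\<And>t. (U has_vector_derivative u t) (at t)"
  shows "(LINT t|angular a. u t) = U (a + 2 * pi) - U a"
proof -
  have [measurable]: "u \<in> borel_measurable borel" using assms(1) by (rule borel_measurable_continuous_onI)
  have "(LINT t|angular a. u t) = (LINT t|lborel. indicator {a<..<a+2*pi} t *\<^sub>R u t)"
    unfolding angular_def ennreal_indicator[symmetric] by (subst integral_density) auto
  also have "\<dots> = (LINT t|lborel. indicator {a..a+2*pi} t *\<^sub>R u t)"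
    by (intro integral_cong_AE eventually_mono[OF eventually_conj[OF AE_lborel_singleton[of a] AE_lborel_singleton[of "a+2*pi"]]])
       (auto split: split_indicator)
  also have "\<dots> = integral {a..a+2*pi} u"
    using set_borel_integral_eq_integral(2)[OF borel_integrable_compact[of "{a..a+2*pi}" u, folded set_integrable_def]] assms(1)
    by (auto simp: set_lebesgue_integral_def intro: continuous_on_subset)
  also have "\<dots> = U (a + 2 * pi) - U a"
    by (intro integral_unique fundamental_theorem_of_calculus)
       (auto intro: has_vector_derivative_at_within U)
  finally show ?thesis .
qed

text \<open>With c = -n, the choice \<alpha> = 0, \<beta> = i/n gives a primitive of
  \<open>cis (- n * t)\<close>, and \<alpha> = i/n, \<beta> = 1/n^2 gives one of
  \<open>t * cis (- n * t)\<close>.\<close>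

lemma has_vector_derivative_linear_cis:
  "((\<lambda>t. (\<alpha> * of_real t + \<beta>) * cis (c * t)) has_vector_derivative
     (\<alpha> + \<i> * c * (\<alpha> * of_real t + \<beta>)) * cis (c * t)) (at t)"
proof -
  have "((\<lambda>z. (\<alpha> * z + \<beta>) * exp (\<i> * (of_real c * z))) has_field_derivative
     (\<alpha> + \<i> * c * (\<alpha> * of_real t + \<beta>)) * exp (\<i> * (of_real c * of_real t))) (at (of_real t))"
    by (auto intro!: derivative_eq_intros simp: algebra_simps)
  from has_vector_derivative_real_field[OF this] show ?thesis
    by (simp add: cis_conv_exp)
qed

lemma integral_cnj_power:
  assumes "n \<noteq> 0"
  shows "(LINT z|\<mu>. cnj z ^ n) = 0"
proof -
  have n: "complex_of_real (real n) \<noteq> 0" using assms by simp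
  have "(LINT z|\<mu>. cnj z ^ n) = (LINT t|angular 0. cis (- real n * t)) * (LINT r|radial. complex_of_real (r ^ n))"
  proof (rule integral_weighted_area_separated)
    show "cnj (of_real r * cis t) ^ n = cis (- real n * t) * of_real (r ^ n)" for r t
      by (simp add: power_mult_distrib cis_cnj Complex.DeMoivre mult_ac)
    show "norm (complex_of_real (r ^ n)) \<le> 1" if "0 < r" "r < 1" for r :: real
      using that by (simp add: norm_power power_le_one)
    show "(\<lambda>z::complex. cnj z ^ n) \<in> borel_measurable borel"
      by (intro borel_measurable_continuous_onI continuous_intros)
  qed auto
  also have "(LINT t|angular 0. cis (- real n * t)) = \<i> / n * cis (- real n * (0 + 2 * pi)) - \<i> / n * cis (- real n * 0)"
  proof (rule integral_angular_FTC)
    show "continuous_on UNIV (\<lambda>t. cis (- real n * t))" by (intro continuous_intros)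
    show "((\<lambda>t. \<i> / n * cis (- real n * t)) has_vector_derivative cis (- real n * t)) (at t)" for t
      using has_vector_derivative_linear_cis[of 0 "\<i> / n" "- real n" t] n by simp
  qed
  also have "cis (- real n * (0 + 2 * pi)) = 1"
    using cos_2npi[of n] sin_2npi[of n] by (simp add: complex_eq_iff mult_ac)
  finally show ?thesis by simp
qed


subsection \<open>Boundedness on essentially bounded functions forces doubling\<close>

text \<open>The argument function, in a form that is visibly Borel measurable: \<open>tan (\<theta>/2) = sin \<theta> / (1 + cos \<theta>)\<close>.\<close>

definition arg_test :: "complex \<Rightarrow> complex" where
  "arg_test z = of_real (2 * arctan (Im z / (norm z + Re z)))"

lemma borel_measurable_arg_test [measurable]: "arg_test \<in> borel_measurable borel"
  unfolding arg_test_def by measurable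

lemma norm_arg_test: "norm (arg_test z) \<le> pi"
  using arctan_bounded[of "Im z / (norm z + Re z)"] unfolding arg_test_def norm_of_real by linarith

lemma arg_test_polar:
  assumes "-pi < t" "t < pi" "0 < r"
  shows "arg_test (complex_of_real r * cis t) = of_real t"
proof -
  have c: "cos (t / 2) > 0" using assms by (intro cos_gt_zero_pi) auto
  have "Im (r * cis t) / (norm (r * cis t) + Re (r * cis t)) = (r * sin t) / (r * (1 + cos t))"
    using assms by (simp add: norm_mult algebra_simps)
  also have "\<dots> = sin t / (cos t + 1)" using assms by (simp add: add.commute)
  also have "\<dots> = tan (t / 2)" using tan_half[of "t / 2"] by simp
  finally show ?thesis using assms unfolding arg_test_def by (simp add: arctan_tan)
qed

text \<open>The value is the boundary term from the jump of the argument across the negative axis.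
  Its factor 1/n cancels the n produced by differentiation, and the sign (-1)^n is compensated by
  evaluating at a negative real point.\<close>

lemma integral_arg_test:
  assumes "n \<noteq> 0"
  shows "(LINT z|\<mu>. arg_test z * cnj z ^ n) = 2 * \<i> * (-1) ^ n * moment w (real n + 1) / n"
proof -
  have n: "complex_of_real (real n) \<noteq> 0" using assms by simp
  have "(LINT z|\<mu>. arg_test z * cnj z ^ n) = (LINT t|angular (-pi). of_real t * cis (- real n * t)) * (LINT r|radial. complex_of_real (r ^ n))"
  proof (rule integral_weighted_area_separated)
    show "arg_test (of_real r * cis t) * cnj (of_real r * cis t) ^ n = of_real t * cis (- real n * t) * of_real (r ^ n)"
      if "t \<in> {-pi<..<-pi+2*pi}" "0 < r" "r < 1" for r t
      using that arg_test_polar[of t r]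
      by (simp add: power_mult_distrib cis_cnj Complex.DeMoivre mult_ac)
    show "norm (complex_of_real (r ^ n)) \<le> 1" if "0 < r" "r < 1" for r :: real
      using that by (simp add: norm_power power_le_one)
    show "(\<lambda>z. arg_test z * cnj z ^ n) \<in> borel_measurable borel"
      by (intro borel_measurable_times borel_measurable_arg_test borel_measurable_continuous_onI continuous_intros)
    show "norm (complex_of_real t * cis (- real n * t)) \<le> pi" if "t \<in> {-pi<..<-pi+2*pi}" for t
      using that by (auto simp: norm_mult)
  qed auto
  also have "(LINT t|angular (-pi). of_real t * cis (- real n * t)) =
     (\<i> * of_real (-pi + 2 * pi) / n + 1 / (of_nat n)\<^sup>2) * cis (- real n * (-pi + 2 * pi)) -
     (\<i> * of_real (-pi) / n + 1 / (of_nat n)\<^sup>2) * cis (- real n * (-pi))"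
  proof (rule integral_angular_FTC)
    show "continuous_on UNIV (\<lambda>t. of_real t * cis (- real n * t))" by (intro continuous_intros)
    show "((\<lambda>t. (\<i> * of_real t / n + 1 / (of_nat n)\<^sup>2) * cis (- real n * t)) has_vector_derivative of_real t * cis (- real n * t)) (at t)" for t
      using has_vector_derivative_linear_cis[of "\<i> / n" "1 / (of_nat n)\<^sup>2" "- real n" t] n
      by (simp add: field_simps power2_eq_square)
  qed
  also have "\<dots> = 2 * pi * \<i> * (-1) ^ n / n"
  proof -
    have "cis (- real n * (-pi + 2 * pi)) = (-1) ^ n" "cis (- real n * (-pi)) = (-1) ^ n"
      by (simp_all add: complex_eq_iff mult.commute[of "real n"])
    then show ?thesis by (simp add: algebra_simps)
  qed
  finally show ?thesis unfolding integral_radial_power using n by (simp add: mult_ac)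
qed

lemma integrable_arg_test: "integrable \<mu> arg_test"
proof -
  interpret finite_measure "\<mu>" by (rule finite_measure_weighted_area)
  show ?thesis
    by (rule integrable_const_bound[where B=pi]) (auto simp: norm_arg_test intro: measurable_weighted_area)
qed

lemma arg_test_Linf: "arg_test \<in> Linf" "Linf_norm arg_test \<le> ennreal pi"
proof -
  have m: "arg_test \<in> borel_measurable disc_area"
    using measurable_lebesgue_on_disc[OF borel_measurable_arg_test] unfolding disc_area_def by simp
  then show "Linf_norm arg_test \<le> ennreal pi"
    unfolding Linf_norm_def by (intro esssup_I AE_I2) (auto simp: norm_arg_test intro!: ennreal_leI)
  then show "arg_test \<in> Linf"
    using m unfolding Linf_def by (auto simp: le_less_trans)
qed

lemma deriv_projection_arg_test:
  assumes "0 \<le> r" "r < 1"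
  shows "deriv (bergman_projection w arg_test) (- of_real r) =
    - \<i> * of_real (\<Sum>n. moment w (real n + 2) / moment w (2 * real n + 3) * r ^ n)"
    and "summable (\<lambda>n. moment w (real n + 2) / moment w (2 * real n + 3) * r ^ n)"
proof -
  let ?q = "\<lambda>n. moment w (real n + 2) / moment w (2 * real n + 3) * r ^ n"
  have eq: "diffs (fcoef arg_test) n * (- of_real r) ^ n = - \<i> * of_real (?q n)" for n
  proof -
    have "diffs (fcoef arg_test) n = of_nat (Suc n) * (of_real (dcoef (Suc n)) *
       (2 * \<i> * (-1) ^ Suc n * moment w (real (Suc n) + 1) / of_nat (Suc n)))"
      unfolding diffs_def fcoef_def by (subst integral_arg_test) auto
    also have "\<dots> = - \<i> * (-1) ^ n * of_real (2 * dcoef (Suc n) * moment w (real (Suc n) + 1))"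
      by (simp add: field_simps del: of_nat_Suc)
    also have "2 * dcoef (Suc n) * moment w (real (Suc n) + 1) = moment w (real n + 2) / moment w (2 * real n + 3)"
      by (simp add: dcoef_def algebra_simps)
    finally have "diffs (fcoef arg_test) n * (- of_real r) ^ n = - \<i> * ((-1) ^ n * (- of_real r) ^ n) * of_real (moment w (real n + 2) / moment w (2 * real n + 3))"
      by (simp add: mult_ac)
    also have "(-1) ^ n * (- complex_of_real r) ^ n = of_real (r ^ n)"
      by (simp flip: power_mult_distrib)
    finally show ?thesis by simp
  qed
  have "summable (\<lambda>n. norm (diffs (fcoef arg_test) n * (- complex_of_real r) ^ n))"
    using fcoef_bound[OF integrable_arg_test] by (rule summable_diffs_dcoef) (use assms in auto)
  moreover have "norm (- \<i> * complex_of_real (?q n)) = ?q n" for n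
    using assms moment_nonneg[of "real n + 2"] moment_nonneg[of "2 * real n + 3"] by (simp add: norm_mult norm_divide norm_power)
  ultimately show s: "summable ?q" unfolding eq by simp
  have "deriv (bergman_projection w arg_test) (- of_real r) = (\<Sum>n. diffs (fcoef arg_test) n * (- of_real r) ^ n)"
    using assms by (intro deriv_bergman_projection integrable_arg_test) auto
  also have "\<dots> = - \<i> * of_real (\<Sum>n. ?q n)"
    unfolding eq by (rule sums_unique[symmetric] sums_mult sums_of_real summable_sums s)+
  finally show "deriv (bergman_projection w arg_test) (- of_real r) = - \<i> * of_real (\<Sum>n. ?q n)" .
qed

text \<open>The terms with 4k <= n < 5k are k in number and each is at least a constant times m(5k +
  2) / m(8k + 3), while the whole sum is O(k) for 1 - r of order 1/k. Hence this quotient is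
  bounded, and 8/5 exceeds 1 by enough to reach doubling in two steps.\<close>

theorem D_hat_of_bounded_Linf:
  assumes bd: "bounded_into_bloch (bergman_projection w) Linf Linf_norm" and rw: "radial_weight w"
  shows "w \<in> class_D_hat"
proof -
  obtain C where C: "C > 0" "\<And>f. f \<in> Linf \<Longrightarrow> bloch_seminorm (bergman_projection w f) \<le> ennreal C * Linf_norm f"
    using bd unfolding bounded_into_bloch_def by blast
  let ?q = "\<lambda>n. moment w (real n + 2) / moment w (2 * real n + 3)"
  have q0: "0 \<le> ?q n" for n by (simp add: moment_nonneg)
  have main: "(\<Sum>n. ?q n * r ^ n) \<le> C * pi / (1 - r)" if r: "0 \<le> r" "r < 1" for r
  proof -
    have "ennreal (norm (deriv (bergman_projection w arg_test) (- of_real r)) * (1 - (norm (- complex_of_real r))\<^sup>2))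
        \<le> bloch_seminorm (bergman_projection w arg_test)"
      unfolding bloch_seminorm_def by (rule SUP_upper) (use r in auto)
    also have "\<dots> \<le> ennreal C * Linf_norm arg_test" by (rule C(2)[OF arg_test_Linf(1)])
    also have "\<dots> \<le> ennreal C * ennreal pi" by (intro mult_left_mono arg_test_Linf) auto
    also have "\<dots> = ennreal (C * pi)" using C(1) by (simp add: ennreal_mult)
    finally have "norm (deriv (bergman_projection w arg_test) (- of_real r)) * (1 - (norm (- complex_of_real r))\<^sup>2) \<le> C * pi"
      using C(1) by (subst (asm) ennreal_le_iff) auto
    moreover have "norm (deriv (bergman_projection w arg_test) (- of_real r)) = (\<Sum>n. ?q n * r ^ n)"
    proof -
      have "0 \<le> (\<Sum>n. ?q n * r ^ n)"
        using r by (intro suminf_nonneg deriv_projection_arg_test(2)) (auto simp: moment_nonneg)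
      then show ?thesis
        unfolding deriv_projection_arg_test(1)[OF r] norm_mult norm_minus_cancel norm_ii norm_of_real by simp
    qed
    moreover have "1 - (norm (- complex_of_real r))\<^sup>2 = 1 - r\<^sup>2" using r by simp
    ultimately have "(\<Sum>n. ?q n * r ^ n) * (1 - r\<^sup>2) \<le> C * pi" by simp
    moreover have "(\<Sum>n. ?q n * r ^ n) * (1 - r) \<le> (\<Sum>n. ?q n * r ^ n) * (1 - r\<^sup>2)"
    proof (intro mult_left_mono suminf_nonneg deriv_projection_arg_test(2)[OF r])
      show "1 - r \<le> 1 - r\<^sup>2" using r by (simp add: power2_eq_square mult_left_le)
    qed (use r in \<open>auto simp: moment_nonneg\<close>)
    ultimately show ?thesis using r by (simp add: field_simps)
  qed
  \<comment> \<open>16 undoes the lower bound 1/16 for the powers of \<open>r\<close>, and 4 comes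
    from 1 / (1 - r) = 4k.\<close>
  define B where "B = 64 * C * pi"
  have step: "moment w (5 * real k + 2) \<le> B * moment w (8 * real k + 3)" if k: "1 \<le> k" for k :: nat
  proof -
    \<comment> \<open>Bernoulli gives r^(2k) >= 1/2; squaring twice gives r^(8k) >= 1/16, which
      covers all n < 5k.\<close>
    define r where "r = 1 - 1 / (4 * real k)"
    have r: "0 \<le> r" "r < 1" using k by (auto simp: r_def)
    let ?Q = "moment w (5 * real k + 2) / moment w (8 * real k + 3)"
    have rr: "1/16 \<le> r ^ (8 * k)"
    proof -
      have "1/4 \<le> r ^ (4 * k)"
      proof -
        have "1/2 \<le> r ^ (2 * k)"
          using Bernoulli_inequality[of "- (1 / (4 * real k))" "2 * k"] k by (simp add: r_def field_simps)
        then have "(1/2) ^ 2 \<le> (r ^ (2 * k)) ^ 2" by (intro power_mono) auto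
        then show ?thesis by (simp add: power2_eq_square flip: power_add)
      qed
      then have "(1/4) ^ 2 \<le> (r ^ (4 * k)) ^ 2" by (intro power_mono) auto
      then show ?thesis by (simp add: power2_eq_square flip: power_add)
    qed
    have "real k * (?Q * (1/16)) = (\<Sum>n\<in>{4*k..<5*k}. ?Q * (1/16))" by simp
    also have "\<dots> \<le> (\<Sum>n\<in>{4*k..<5*k}. ?q n * r ^ n)"
    proof (rule sum_mono)
      fix n assume n: "n \<in> {4*k..<5*k}"
      have "?Q \<le> ?q n"
        using n by (intro frac_le moment_antimono moment_pos moment_nonneg) auto
      moreover have "1/16 \<le> r ^ n"
        using n r by (intro order_trans[OF rr] power_decreasing) auto
      ultimately show "?Q * (1/16) \<le> ?q n * r ^ n"
        by (intro mult_mono q0) auto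
    qed
    also have "\<dots> \<le> (\<Sum>n. ?q n * r ^ n)"
      using r by (intro sum_le_suminf deriv_projection_arg_test(2)) (auto simp: moment_nonneg)
    also have "\<dots> \<le> C * pi / (1 - r)" using r by (rule main)
    also have "\<dots> = C * pi * (4 * real k)" by (simp add: r_def)
    finally have le: "real k * (?Q * (1/16)) \<le> C * pi * (4 * real k)" .
    have "q \<le> B" if "real k * (q * (1/16)) \<le> C * pi * (4 * real k)" for q
    proof -
      have "real k * q \<le> real k * B" using that by (simp add: B_def mult_ac)
      then show ?thesis using k by simp
    qed
    from this[OF le] have "?Q \<le> B" .
    then show ?thesis using moment_pos[of "8 * real k + 3"] by (simp add: field_simps)
  qed
  have B0: "0 \<le> B" using C by (simp add: B_def)
  \<comment> \<open>With k = floor ((x - 2) / 5) the argument 8k + 3 is at least 1.6 x - 8.2, and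
    this is at least 1.5 x exactly from x = 82 on.\<close>
  have step2: "moment w x \<le> B * moment w (3/2 * x)" if x: "82 \<le> x" for x
  proof -
    define k where "k = nat \<lfloor>(x - 2) / 5\<rfloor>"
    have k: "real k \<le> (x - 2) / 5" "(x - 2) / 5 < real k + 1" "1 \<le> k"
    proof -
      have "real k = of_int \<lfloor>(x - 2) / 5\<rfloor>" using x by (simp add: k_def)
      then show "real k \<le> (x - 2) / 5" "(x - 2) / 5 < real k + 1"
        using floor_correct[of "(x - 2) / 5"] by simp_all
      then show "1 \<le> k" using x by simp
    qed
    have "moment w x \<le> moment w (5 * real k + 2)" using k by (intro moment_antimono) auto
    also have "\<dots> \<le> B * moment w (8 * real k + 3)" using k by (intro step)
    also have "\<dots> \<le> B * moment w (3/2 * x)"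
      using k x B0 by (intro mult_left_mono moment_antimono) auto
    finally show ?thesis .
  qed
  \<comment> \<open>Two steps of ratio 3/2 give 9/4 >= 2; for x <= 82 the doubled argument is at
    most 164.\<close>
  define K where "K = max 1 (max (B * B) (moment w 1 / moment w 164))"
  have "moment w x \<le> K * moment w (2 * x)" if x: "1 \<le> x" for x
  proof (cases "x \<le> 82")
    case True
    have "moment w x \<le> moment w 1" using x by (intro moment_antimono) auto
    also have "\<dots> = moment w 1 / moment w 164 * moment w 164" using moment_pos[of 164] by simp
    also have "\<dots> \<le> K * moment w (2 * x)"
      using True x by (intro mult_mono moment_antimono) (auto simp: K_def moment_nonneg)
    finally show ?thesis .
  next
    case False
    have "moment w x \<le> B * moment w (3/2 * x)" using False by (intro step2) auto
    also have "\<dots> \<le> B * (B * moment w (3/2 * (3/2 * x)))" using False B0 by (intro mult_left_mono step2) auto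
    also have "\<dots> \<le> B * (B * moment w (2 * x))" using False B0 by (intro mult_left_mono moment_antimono) auto
    also have "\<dots> \<le> K * moment w (2 * x)"
      by (auto simp: K_def mult.assoc[symmetric] moment_nonneg intro!: mult_right_mono)
    finally show ?thesis .
  qed
  then show ?thesis using rw by (intro D_hat_of_doubling[of K]) (auto simp: K_def)
qed

end

subsection \<open>The derivative of the kernel\<close>

lemma power_mult_one_minus_le:
  fixes r :: real
  assumes "0 \<le> r" "r \<le> 1"
  shows "r ^ n * (1 - r) \<le> 1 / (real n + 1)"
proof -
  have "(real n + 1) * r ^ n * (1 - r) = (\<Sum>i<Suc n. r ^ n) * (1 - r)" by (simp add: algebra_simps)
  also have "\<dots> \<le> (\<Sum>i<Suc n. r ^ i) * (1 - r)"
    using assms by (intro mult_right_mono sum_mono power_decreasing) auto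
  also have "\<dots> = 1 - r ^ Suc n" using one_diff_power_eq[of r "Suc n"] by (simp add: mult.commute)
  also have "\<dots> \<le> 1" using assms by simp
  finally show ?thesis by (simp add: field_simps)
qed

text \<open>Half of the exponent is spent on each factor 1 - r.\<close>

lemma power_mult_one_minus_sq_le:
  fixes r :: real
  assumes "0 \<le> r" "r \<le> 1"
  shows "r ^ n * (1 - r)\<^sup>2 \<le> 4 / (real n + 1)\<^sup>2"
proof -
  define m where "m = n div 2"
  have "r ^ n * (1 - r)\<^sup>2 \<le> r ^ (2 * m) * (1 - r)\<^sup>2"
    using assms by (intro mult_right_mono power_decreasing) (auto simp: m_def)
  also have "\<dots> = (r ^ m * (1 - r))\<^sup>2" by (simp add: power_mult_distrib power_mult[symmetric] mult.commute)
  also have "\<dots> \<le> (1 / (real m + 1))\<^sup>2"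
    using assms by (intro power_mono power_mult_one_minus_le) auto
  also have "\<dots> \<le> (2 / (real n + 1))\<^sup>2"
  proof (rule power_mono)
    have "n + 1 \<le> 2 * (m + 1)" unfolding m_def by simp
    then have "real (n + 1) \<le> real (2 * (m + 1))" by (simp only: of_nat_le_iff)
    then have "real n + 1 \<le> 2 * (real m + 1)" by simp
    then show "1 / (real m + 1) \<le> 2 / (real n + 1)" by (simp add: field_simps)
  qed auto
  finally show ?thesis by (simp add: power_divide)
qed

lemma abs_power_mult_le_one:
  fixes r :: real
  assumes "r \<in> {0..<1}"
  shows "\<bar>r ^ k * (1 - r\<^sup>2) ^ j\<bar> \<le> 1"
proof -
  have "0 \<le> r\<^sup>2" "r\<^sup>2 \<le> 1" using assms by (auto intro: power_le_one)
  then have "0 \<le> (1 - r\<^sup>2) ^ j" "(1 - r\<^sup>2) ^ j \<le> 1" by (auto intro: power_le_one)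
  moreover have "0 \<le> r ^ k" "r ^ k \<le> 1" using assms by (auto intro: power_le_one)
  ultimately show ?thesis unfolding abs_mult by (intro mult_le_one) auto
qed

text \<open>By the mean value theorem; it turns the terms (n + 1)^(e - 1) into increments of a
  sequence, so that their sum telescopes.\<close>

lemma powr_diff_ge:
  fixes e :: real
  assumes "0 < e" "e \<le> 1"
  shows "e * (real n + 1) powr (e - 1) \<le> (real n + 1) powr e - real n powr e"
proof (cases "n = 0")
  case True
  then show ?thesis using assms by simp
next
  case False
  then have n: "0 < real n" by simp
  have "((\<lambda>x. x powr e) has_real_derivative e * x powr (e - 1)) (at x)" if "real n \<le> x" for x
    using that n by (intro has_real_derivative_powr) auto
  then have "\<exists>z>real n. z < real n + 1 \<and> (real n + 1) powr e - real n powr e = (real n + 1 - real n) * (e * z powr (e - 1))"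
    by (intro MVT2) auto
  then obtain z where z: "real n < z" "z < real n + 1" "(real n + 1) powr e - real n powr e = e * z powr (e - 1)"
    by auto
  have "(real n + 1) powr (e - 1) \<le> z powr (e - 1)"
    using z n assms by (intro powr_mono2') auto
  then show ?thesis using z assms by simp
qed

lemma power_le_exp_half:
  fixes u :: real
  assumes "0 \<le> u"
  shows "u ^ k \<le> (fact k * 2 ^ k) * exp (u / 2)"
proof -
  have "(u / 2) ^ k / fact k \<le> exp (u / 2)"
  proof -
    have s: "(\<lambda>n. (u / 2) ^ n /\<^sub>R fact n) sums exp (u / 2)" by (rule exp_converges)
    have "(\<Sum>n\<in>{k}. (u / 2) ^ n /\<^sub>R fact n) \<le> exp (u / 2)"
      unfolding sums_unique[OF s] using s assms by (intro sum_le_suminf) (auto simp: sums_iff)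
    moreover have "(u / 2) ^ k /\<^sub>R fact k = (u / 2) ^ k / fact k"
      by (simp only: real_scaleR_def divide_inverse mult.commute)
    ultimately show ?thesis by (simp only: sum.insert finite.emptyI sum.empty empty_iff not_False_eq_True add_0_right)
  qed
  then show ?thesis by (simp add: field_simps power_divide)
qed

text \<open>The quantitative content of the two classes with one common constant:
  \<open>power_law\<close> and \<open>moment_le\<close> come from doubling, \<open>decay\<close>
  from \<open>class_M\<close>, and \<open>tail_le\<close> holds for each weight. All estimates below
  depend on the weight only through these.\<close>

locale regular_weight = borel_weight +
  fixes A e :: real and g :: nat
  assumes A1: "1 \<le> A" and e0: "0 < e" and e_half: "e \<le> 1/2" and g1: "1 \<le> g"
    and power_law: "\<And>x y. 1 \<le> x \<Longrightarrow> x \<le> y \<Longrightarrow> moment w x \<le> A * (y / x) ^ g * moment w y"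
    and decay: "\<And>x y. 1 \<le> x \<Longrightarrow> x \<le> y \<Longrightarrow> moment w y \<le> A * (x / y) powr e * moment w x"
    and tail_le: "\<And>x. 1 \<le> x \<Longrightarrow> tail w (1 - 1 / x) \<le> A * moment w x"
    and moment_le: "\<And>x. 1 \<le> x \<Longrightarrow> moment w x \<le> A * tail w (1 - 1 / x)"
begin

text \<open>5 is the largest ratio of exponents to be compared: (2n + 5) / (2n + 1) at n =
  0.\<close>

definition D where "D = A * 5 ^ g"

lemma D_ge_1: "1 \<le> D"
proof -
  have "1 * 1 \<le> A * 5 ^ g" using A1 by (intro mult_mono one_le_power) auto
  then show ?thesis by (simp add: D_def)
qed

lemma moment_le_D:
  assumes "1 \<le> x" "x \<le> y" "y \<le> 5 * x"
  shows "moment w x \<le> D * moment w y"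
proof -
  have "moment w x \<le> A * (y / x) ^ g * moment w y" by (rule power_law) fact+
  also have "\<dots> \<le> A * 5 ^ g * moment w y"
    using assms A1 by (intro mult_right_mono mult_left_mono power_mono moment_nonneg) (auto simp: field_simps)
  finally show ?thesis by (simp add: D_def)
qed

section \<open>Discrete differences of the kernel coefficients\<close>

definition mc :: "nat \<Rightarrow> real" where "mc n = moment w (2 * real n + 1)"

lemma mc_pos: "0 < mc n" unfolding mc_def by (rule moment_pos) simp

lemma dcoef_mc: "dcoef n = 1 / (2 * mc n)" by (simp add: dcoef_def mc_def)

lemma moment_nat: "k \<noteq> 0 \<Longrightarrow> moment w (real k) = (LINT r|lborel. r ^ k * w r)"
  unfolding moment_eq
proof (rule Bochner_Integration.integral_cong[OF refl])
  fix r :: real assume "k \<noteq> 0"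
  then show "r powr real k * w r = r ^ k * w r"
    by (cases "0 < r"; cases "r = 0") (auto simp: powr_realpow w_support)
qed

lemma mc_eq: "mc n = (LINT r|lborel. r ^ (2 * n + 1) * w r)"
  using moment_nat[of "2 * n + 1"] by (simp add: mc_def add.commute)

lemma integrable_power: "integrable lborel (\<lambda>r. r ^ k * w r)"
  by (rule integrable_bounded_mult_w[where B=1]) (auto simp: power_le_one)

definition pw :: "nat \<Rightarrow> real \<Rightarrow> real" where "pw k r = r ^ k * w r"

lemma integrable_pw: "integrable lborel (pw k)"
  unfolding pw_def by (rule integrable_power)

lemma mc_pw: "mc n = (LINT r|lborel. pw (2 * n + 1) r)"
  unfolding pw_def by (rule mc_eq)

lemma mc_Suc_le: "mc n \<le> D * mc (Suc n)" "mc n \<le> D * mc (Suc (Suc n))" "mc (Suc n) \<le> mc n"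
  unfolding mc_def by (rule moment_le_D moment_antimono; simp)+

lemma moment_Suc_le_mc: "moment w (real n + 1) \<le> D * mc n"
  unfolding mc_def by (rule moment_le_D) auto

text \<open>In r^(2n+1) half of the exponent pays for the powers of 1 - r, each worth 1/n. The
  remaining r^(n+1) has a moment still comparable to \<open>mc n\<close> by doubling.\<close>

lemma integral_power_bound:
  assumes "\<And>r. r \<in> {0..<1} \<Longrightarrow> q r \<le> c * r ^ (n + 1)" and i: "integrable lborel (\<lambda>r. q r * w r)" and "0 \<le> c"
  shows "(LINT r|lborel. q r * w r) \<le> c * D * mc n"
proof -
  have "(LINT r|lborel. q r * w r) \<le> (LINT r|lborel. c * (r ^ (n + 1) * w r))"
  proof (rule integral_mono[OF i])
    show "integrable lborel (\<lambda>r. c * (r ^ (n + 1) * w r))" by (intro integrable_mult_right integrable_power)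
    show "q r * w r \<le> c * (r ^ (n + 1) * w r)" for r
      using mult_right_mono[OF assms(1)[of r], of "w r"] by (cases "r \<in> {0..<1}") (auto simp: w_support mult_ac)
  qed
  also have "\<dots> = c * moment w (real n + 1)" using moment_nat[of "n + 1"] by (simp add: add.commute)
  also have "\<dots> \<le> c * (D * mc n)" using \<open>0 \<le> c\<close> by (intro mult_left_mono moment_Suc_le_mc)
  finally show ?thesis by (simp add: mult_ac)
qed

lemma mc_diff: "0 \<le> mc n - mc (Suc n)" "mc n - mc (Suc n) \<le> 2 / (real n + 1) * D * mc n"
proof -
  have eq: "mc n - mc (Suc n) = (LINT r|lborel. (r ^ (2 * n + 1) * (1 - r\<^sup>2)) * w r)"
  proof -
    have "(LINT r|lborel. (r ^ (2 * n + 1) * (1 - r\<^sup>2)) * w r) = (LINT r|lborel. pw (2 * n + 1) r - pw (2 * Suc n + 1) r)"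
      unfolding pw_def by (intro Bochner_Integration.integral_cong) (auto simp: algebra_simps power2_eq_square)
    also have "\<dots> = mc n - mc (Suc n)" unfolding mc_pw by (simp only: Bochner_Integration.integral_diff integrable_pw)
    finally show ?thesis by simp
  qed
  show "0 \<le> mc n - mc (Suc n)" using mc_Suc_le by simp
  show "mc n - mc (Suc n) \<le> 2 / (real n + 1) * D * mc n"
    unfolding eq
  proof (rule integral_power_bound)
    fix r :: real assume r: "r \<in> {0..<1}"
    have "r ^ (2 * n + 1) * (1 - r\<^sup>2) = r ^ (n + 1) * (r ^ n * (1 - r)) * (1 + r)"
    proof -
      have "r ^ (2 * n + 1) = r ^ (n + 1) * r ^ n" by (simp flip: power_add add: mult_2)
      moreover have "1 - r\<^sup>2 = (1 - r) * (1 + r)" by algebra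
      ultimately show ?thesis by (simp only: mult_ac)
    qed
    also have "\<dots> \<le> r ^ (n + 1) * (1 / (real n + 1)) * 2"
      using r by (intro mult_mono power_mult_one_minus_le) auto
    finally show "r ^ (2 * n + 1) * (1 - r\<^sup>2) \<le> 2 / (real n + 1) * r ^ (n + 1)" by (simp add: mult_ac)
  next
    show "integrable lborel (\<lambda>r. r ^ (2 * n + 1) * (1 - r\<^sup>2) * w r)"
      by (rule integrable_bounded_mult_w[where B=1]) (use abs_power_mult_le_one[of _ "2 * n + 1" 1] in auto)
  qed simp
qed

lemma mc_diff2:
  "0 \<le> mc n - 2 * mc (Suc n) + mc (Suc (Suc n))"
  "mc n - 2 * mc (Suc n) + mc (Suc (Suc n)) \<le> 16 / (real n + 1)\<^sup>2 * D * mc n"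
proof -
  have eq: "mc n - 2 * mc (Suc n) + mc (Suc (Suc n)) = (LINT r|lborel. (r ^ (2 * n + 1) * (1 - r\<^sup>2)\<^sup>2) * w r)"
  proof -
    have "(LINT r|lborel. (r ^ (2 * n + 1) * (1 - r\<^sup>2)\<^sup>2) * w r) =
      (LINT r|lborel. (pw (2 * n + 1) r - 2 * pw (2 * Suc n + 1) r) + pw (2 * Suc (Suc n) + 1) r)"
      unfolding pw_def by (intro Bochner_Integration.integral_cong) (auto simp: algebra_simps power2_eq_square)
    also have "\<dots> = mc n - 2 * mc (Suc n) + mc (Suc (Suc n))"
      unfolding mc_pw by (simp only: Bochner_Integration.integral_diff Bochner_Integration.integral_add integrable_pw
        Bochner_Integration.integrable_diff integrable_mult_right integral_mult_right_zero)
    finally show ?thesis by simp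
  qed
  show "0 \<le> mc n - 2 * mc (Suc n) + mc (Suc (Suc n))"
    unfolding eq
  proof (rule Bochner_Integration.integral_nonneg)
    show "0 \<le> r ^ (2 * n + 1) * (1 - r\<^sup>2)\<^sup>2 * w r" for r by (cases "0 \<le> r") (auto simp: w_support)
  qed
  show "mc n - 2 * mc (Suc n) + mc (Suc (Suc n)) \<le> 16 / (real n + 1)\<^sup>2 * D * mc n"
    unfolding eq
  proof (rule integral_power_bound)
    fix r :: real assume r: "r \<in> {0..<1}"
    have "r ^ (2 * n + 1) * (1 - r\<^sup>2)\<^sup>2 = r ^ (n + 1) * (r ^ n * (1 - r)\<^sup>2) * (1 + r)\<^sup>2"
    proof -
      have "r ^ (2 * n + 1) = r ^ (n + 1) * r ^ n" by (simp flip: power_add add: mult_2)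
      moreover have "(1 - r\<^sup>2)\<^sup>2 = (1 - r)\<^sup>2 * (1 + r)\<^sup>2" by algebra
      ultimately show ?thesis by (simp only: mult_ac)
    qed
    also have "\<dots> \<le> r ^ (n + 1) * (4 / (real n + 1)\<^sup>2) * 2\<^sup>2"
      using r by (intro mult_mono power_mult_one_minus_sq_le power_mono) auto
    finally show "r ^ (2 * n + 1) * (1 - r\<^sup>2)\<^sup>2 \<le> 16 / (real n + 1)\<^sup>2 * r ^ (n + 1)" by (simp add: mult_ac)
  next
    show "integrable lborel (\<lambda>r. r ^ (2 * n + 1) * (1 - r\<^sup>2)\<^sup>2 * w r)"
      by (rule integrable_bounded_mult_w[where B=1]) (use abs_power_mult_le_one[of _ "2 * n + 1" 2] in auto)
  qed simp
qed

lemma dcoef_diff: "\<bar>dcoef (Suc n) - dcoef n\<bar> \<le> 2 * D\<^sup>2 / (real n + 1) * dcoef n"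
proof -
  have p: "0 < mc n" "0 < mc (Suc n)" by (rule mc_pos)+
  have "dcoef (Suc n) - dcoef n = (mc n - mc (Suc n)) / (2 * mc n * mc (Suc n))"
    using p by (simp add: dcoef_mc field_simps)
  then have "\<bar>dcoef (Suc n) - dcoef n\<bar> = (mc n - mc (Suc n)) / (2 * mc n * mc (Suc n))"
    using p mc_diff(1)[of n] by simp
  also have "\<dots> \<le> (2 / (real n + 1) * D * mc n) / (2 * mc n * mc (Suc n))"
    using p by (intro divide_right_mono mc_diff) auto
  also have "\<dots> = D / (real n + 1) * (1 / mc (Suc n))" using p by simp
  also have "\<dots> \<le> D / (real n + 1) * (D / mc n)"
    using p mc_Suc_le(1)[of n] D_ge_1 by (intro mult_left_mono) (auto simp: field_simps)
  also have "\<dots> = 2 * D\<^sup>2 / (real n + 1) * dcoef n" by (simp add: dcoef_mc power2_eq_square)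
  finally show ?thesis .
qed

lemma dcoef_diff2:
  "\<bar>dcoef (Suc (Suc n)) - 2 * dcoef (Suc n) + dcoef n\<bar> \<le> (16 * D\<^sup>2 + 8 * D ^ 3) / (real n + 1)\<^sup>2 * dcoef n"
proof -
  define c0 c1 c2 where "c0 = mc n" and "c1 = mc (Suc n)" and "c2 = mc (Suc (Suc n))"
  define N where "N = real n + 1"
  have N: "1 \<le> N" by (simp add: N_def)
  have p: "0 < c0" "0 < c1" "0 < c2" unfolding c0_def c1_def c2_def by (rule mc_pos)+
  define s where "s = c0 - 2 * c1 + c2"
  have s: "0 \<le> s" "s \<le> 16 / N\<^sup>2 * D * c0" using mc_diff2[of n] by (simp_all add: s_def c0_def c1_def c2_def N_def)
  have P: "0 \<le> c0 - c1" "c0 - c1 \<le> 2 / N * D * c0" using mc_diff[of n] by (simp_all add: c0_def c1_def N_def)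
  have Q: "0 \<le> c1 - c2" using mc_diff[of "Suc n"] by (simp add: c1_def c2_def)
  have "c1 - c2 \<le> 2 / (real (Suc n) + 1) * D * c1" using mc_diff[of "Suc n"] by (simp add: c1_def c2_def)
  also have "\<dots> \<le> 2 / N * D * c1" using D_ge_1 p by (intro mult_right_mono divide_left_mono) (auto simp: N_def)
  finally have Q2: "c1 - c2 \<le> 2 / N * D * c1" .
  have i: "1 / c2 \<le> D / c0" using mc_Suc_le(2)[of n] p by (simp add: c0_def c2_def field_simps)
  \<comment> \<open>Discrete quotient rule for 1/c: the second difference of c plus twice a product
    of first differences, all of order 1/n^2 relative to c.\<close>
  have "dcoef (Suc (Suc n)) - 2 * dcoef (Suc n) + dcoef n = (- (c1 * s) + 2 * (c0 - c1) * (c1 - c2)) / (2 * c0 * c1 * c2)"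
    unfolding dcoef_mc c0_def[symmetric] c1_def[symmetric] c2_def[symmetric] s_def using p
    by (simp add: field_simps power2_eq_square)
  also have "\<bar>\<dots>\<bar> = \<bar>- (c1 * s) + 2 * (c0 - c1) * (c1 - c2)\<bar> / (2 * c0 * c1 * c2)"
    using p by (simp add: abs_divide)
  also have "\<dots> \<le> (c1 * s + 2 * (c0 - c1) * (c1 - c2)) / (2 * c0 * c1 * c2)"
    using p s P Q by (intro divide_right_mono order_trans[OF abs_triangle_ineq]) (auto simp: abs_mult)
  also have "\<dots> \<le> (c1 * (16 / N\<^sup>2 * D * c0) + 2 * (2 / N * D * c0) * (2 / N * D * c1)) / (2 * c0 * c1 * c2)"
    using p s P Q Q2 D_ge_1 N by (intro divide_right_mono add_mono mult_mono mult_left_mono) auto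
  also have "\<dots> = (8 * D + 4 * D\<^sup>2) / N\<^sup>2 * (1 / c2)"
    using p N by (simp add: field_simps power2_eq_square)
  also have "\<dots> \<le> (8 * D + 4 * D\<^sup>2) / N\<^sup>2 * (D / c0)"
    using i D_ge_1 N by (intro mult_left_mono) auto
  also have "\<dots> = (16 * D\<^sup>2 + 8 * D ^ 3) / N\<^sup>2 * dcoef n"
  proof -
    have "16 * D\<^sup>2 + 8 * D ^ 3 = 2 * ((8 * D + 4 * D\<^sup>2) * D)" by (simp add: power2_eq_square power3_eq_cube algebra_simps)
    then show ?thesis by (simp add: dcoef_mc c0_def[symmetric])
  qed
  finally show ?thesis by (simp add: N_def)
qed

definition ecoef :: "nat \<Rightarrow> real" where "ecoef n = real n * dcoef n"

text \<open>A convenient upper bound for the constant 16 D^2 + 12 D^3 of the product rule that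
  follows.\<close>

definition K where "K = 20 * D\<^sup>2 + 8 * D ^ 3 + 8 * D ^ 3"

text \<open>Discrete product rule: the second difference of n d_n is n times that of d_n plus twice
  a first difference, so two powers of 1/n are gained over n d_n.\<close>

lemma ecoef_diff2:
  "\<bar>ecoef (Suc (Suc n)) - 2 * ecoef (Suc n) + ecoef n\<bar> \<le> K / (real n + 1) * dcoef n"
proof -
  define N where "N = real n + 1"
  have N: "1 \<le> N" by (simp add: N_def)
  have "ecoef (Suc (Suc n)) - 2 * ecoef (Suc n) + ecoef n =
     real n * (dcoef (Suc (Suc n)) - 2 * dcoef (Suc n) + dcoef n) + 2 * (dcoef (Suc (Suc n)) - dcoef (Suc n))"
    by (simp add: ecoef_def algebra_simps)
  also have "\<bar>\<dots>\<bar> \<le> \<bar>real n * (dcoef (Suc (Suc n)) - 2 * dcoef (Suc n) + dcoef n)\<bar> + \<bar>2 * (dcoef (Suc (Suc n)) - dcoef (Suc n))\<bar>"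
    by (rule abs_triangle_ineq)
  also have "\<dots> \<le> N * ((16 * D\<^sup>2 + 8 * D ^ 3) / N\<^sup>2 * dcoef n) + 2 * (2 * D\<^sup>2 / N * (D * dcoef n))"
  proof (rule add_mono)
    show "\<bar>real n * (dcoef (Suc (Suc n)) - 2 * dcoef (Suc n) + dcoef n)\<bar> \<le> N * ((16 * D\<^sup>2 + 8 * D ^ 3) / N\<^sup>2 * dcoef n)"
      unfolding abs_mult using dcoef_diff2[of n] by (intro mult_mono) (auto simp: N_def)
    have "\<bar>dcoef (Suc (Suc n)) - dcoef (Suc n)\<bar> \<le> 2 * D\<^sup>2 / (real (Suc n) + 1) * dcoef (Suc n)" by (rule dcoef_diff)
    also have "\<dots> \<le> 2 * D\<^sup>2 / N * (D * dcoef n)"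
    proof (intro mult_mono)
      show "dcoef (Suc n) \<le> D * dcoef n"
        using mc_Suc_le(1)[of n] mc_pos[of n] mc_pos[of "Suc n"] by (simp add: dcoef_mc field_simps)
      show "2 * D\<^sup>2 / (real (Suc n) + 1) \<le> 2 * D\<^sup>2 / N" by (intro divide_left_mono) (auto simp: N_def)
    qed (use N dcoef_pos[of "Suc n"] in auto)
    finally show "\<bar>2 * (dcoef (Suc (Suc n)) - dcoef (Suc n))\<bar> \<le> 2 * (2 * D\<^sup>2 / N * (D * dcoef n))" by simp
  qed
  also have "\<dots> = (16 * D\<^sup>2 + 8 * D ^ 3 + 4 * D ^ 3) / N * dcoef n"
    using N by (simp add: field_simps power2_eq_square power3_eq_cube)
  also have "\<dots> \<le> K / N * dcoef n"
    unfolding K_def using N D_ge_1 dcoef_pos[of n] by (intro mult_right_mono divide_right_mono) auto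
  finally show ?thesis by (simp add: N_def)
qed

text \<open>What remains of the differentiated kernel series once its coefficients are replaced by
  the bounds for their second differences.\<close>

definition kernel_majorant :: "real \<Rightarrow> real" where "kernel_majorant t = (\<Sum>n. dcoef n / (real n + 1) * t ^ n)"

lemma summable_kernel_majorant: "0 \<le> t \<Longrightarrow> t < 1 \<Longrightarrow> summable (\<lambda>n. dcoef n / (real n + 1) * t ^ n)"
proof (rule summable_comparison_test'[OF summable_dcoef])
  fix n :: nat assume t: "0 \<le> t" "t < 1"
  have "dcoef n / (real n + 1) \<le> dcoef n" using dcoef_pos[of n] by (simp add: field_simps)
  then show "norm (dcoef n / (real n + 1) * t ^ n) \<le> dcoef n * t ^ n"
    using t dcoef_pos[of n] mult_right_mono[of "dcoef n / (real n + 1)" "dcoef n" "t ^ n"] by simp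
qed

text \<open>Summation by parts twice: \<open>(1 - a)\<^sup>2\<close> times the series has the second differences of \<open>n d\<^sub>n\<close> as coefficients.\<close>

lemma kernel_deriv_bound_majorant:
  assumes a: "norm a < 1"
  shows "(norm (1 - a))\<^sup>2 * norm (kernel_deriv a) \<le> dcoef 1 + K * kernel_majorant (norm a)"
proof -
  have d: "norm (complex_of_real (dcoef n)) \<le> 1 * dcoef n" for n
    using dcoef_pos[of n] by simp
  define E where "E n = complex_of_real (ecoef n)" for n
  have dd: "diffs (\<lambda>n. complex_of_real (dcoef n)) n = E (Suc n)" for n
    by (simp add: diffs_def E_def ecoef_def)
  have E0: "E 0 = 0" "E 1 = of_real (dcoef 1)" by (simp_all add: E_def ecoef_def)
  have s1: "summable (\<lambda>n. E (Suc n) * a ^ n)"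
    using summable_norm_cancel[OF summable_diffs_dcoef[OF d a]] by (simp add: dd)
  define F where "F = (\<Sum>n. E (Suc n) * a ^ n)"
  have F: "kernel_deriv a = F"
    unfolding kernel_deriv_def F_def dd[symmetric] by (simp add: diffs_def)
  have s0: "(\<lambda>n. E n * a ^ n) sums (a * F)"
  proof -
    have "(\<lambda>n. a * (E (Suc n) * a ^ n)) sums (a * F)" unfolding F_def by (intro sums_mult summable_sums s1)
    then have "(\<lambda>n. E (Suc n) * a ^ Suc n) sums (a * F)" by (simp add: mult_ac)
    then show ?thesis by (subst (asm) sums_Suc_iff) (simp add: E0)
  qed
  have s2: "(\<lambda>n. a * (E (Suc (Suc n)) * a ^ n)) sums (F - E 1)"
  proof -
    have "(\<lambda>n. E (Suc (Suc n)) * a ^ Suc n) sums (F - E 1)"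
      by (subst sums_Suc_iff) (use s1 in \<open>simp add: F_def summable_sums\<close>)
    then show ?thesis by (simp add: mult_ac)
  qed
  \<comment> \<open>The coefficient of a^(n+1) in (1 - a)^2 F is the second difference at n, thanks
    to \<open>E 0 = 0\<close>; only the constant term \<open>E 1\<close> is left over.\<close>
  have "(\<lambda>n. a * (E (Suc (Suc n)) * a ^ n) - 2 * a * (E (Suc n) * a ^ n) + a * (E n * a ^ n)) sums ((F - E 1) - 2 * a * F + a * (a * F))"
    unfolding F_def by (intro sums_add sums_diff sums_mult s0[unfolded F_def] s2[unfolded F_def] summable_sums s1)
  also have "(F - E 1) - 2 * a * F + a * (a * F) = (1 - a)\<^sup>2 * F - E 1"
    by (simp add: power2_eq_square algebra_simps)
  finally have sum: "(\<lambda>n. (E (Suc (Suc n)) - 2 * E (Suc n) + E n) * a ^ Suc n) sums ((1 - a)\<^sup>2 * F - E 1)"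
    by (simp add: algebra_simps)
  have K0: "0 \<le> K" using D_ge_1 by (simp add: K_def)
  have sm: "summable (\<lambda>n. K * (dcoef n / (real n + 1) * norm a ^ n))" using a by (intro summable_mult summable_kernel_majorant) auto
  have bound: "norm ((E (Suc (Suc n)) - 2 * E (Suc n) + E n) * a ^ Suc n) \<le> K * (dcoef n / (real n + 1) * norm a ^ n)" for n
  proof -
    have "E (Suc (Suc n)) - 2 * E (Suc n) + E n = of_real (ecoef (Suc (Suc n)) - 2 * ecoef (Suc n) + ecoef n)"
      by (simp add: E_def)
    then have "norm ((E (Suc (Suc n)) - 2 * E (Suc n) + E n) * a ^ Suc n) = \<bar>ecoef (Suc (Suc n)) - 2 * ecoef (Suc n) + ecoef n\<bar> * norm a ^ Suc n"
      by (simp add: norm_mult norm_power del: of_real_add of_real_diff)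
    also have "\<dots> \<le> (K / (real n + 1) * dcoef n) * norm a ^ n"
      using a K0 dcoef_pos[of n] by (intro mult_mono ecoef_diff2 power_decreasing) auto
    finally show ?thesis by simp
  qed
  have "norm ((1 - a)\<^sup>2 * F - E 1) \<le> (\<Sum>n. norm ((E (Suc (Suc n)) - 2 * E (Suc n) + E n) * a ^ Suc n))"
    unfolding sums_unique[OF sum] by (rule summable_norm) (rule summable_comparison_test'[OF sm, of 0], use bound in simp)
  also have "\<dots> \<le> (\<Sum>n. K * (dcoef n / (real n + 1) * norm a ^ n))"
    by (rule suminf_le[OF bound _ sm]) (rule summable_comparison_test'[OF sm, of 0], use bound in simp)
  also have "\<dots> = K * kernel_majorant (norm a)"
    unfolding kernel_majorant_def using a by (intro suminf_mult summable_kernel_majorant) auto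
  finally have "norm ((1 - a)\<^sup>2 * F - E 1) \<le> K * kernel_majorant (norm a)" .
  moreover have "norm ((1 - a)\<^sup>2 * F) \<le> norm (E 1) + norm ((1 - a)\<^sup>2 * F - E 1)"
    using norm_triangle_sub[of "(1 - a)\<^sup>2 * F" "E 1"] by simp
  moreover have "norm (E 1) = dcoef 1" using dcoef_pos[of 1] E0 by simp
  ultimately show ?thesis by (simp add: F norm_mult norm_power)
qed

text \<open>Comparable to \<open>tail w (1 - t)\<close> for 0 < t <= 1 by \<open>tail_le\<close> and
  \<open>moment_le\<close>; in this form both growth laws become statements about the distance to
  the boundary.\<close>

definition h :: "real \<Rightarrow> real" where "h t = moment w (1 / t)"

lemma h_pos: "0 < t \<Longrightarrow> 0 < h t" unfolding h_def by (intro moment_pos) auto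

lemma h_mono: "0 < s \<Longrightarrow> s \<le> t \<Longrightarrow> h s \<le> h t"
  unfolding h_def by (intro moment_antimono) (auto simp: field_simps)

lemma h_power_law: "0 < s \<Longrightarrow> s \<le> t \<Longrightarrow> t \<le> 1 \<Longrightarrow> h t \<le> A * (t / s) ^ g * h s"
  using power_law[of "1 / t" "1 / s"] unfolding h_def by (simp add: field_simps)

lemma h_decay: "0 < s \<Longrightarrow> s \<le> t \<Longrightarrow> t \<le> 1 \<Longrightarrow> h s \<le> A * (s / t) powr e * h t"
  using decay[of "1 / t" "1 / s"] unfolding h_def by (simp add: field_simps)

text \<open>For n < 1/x the trivial bound of \<open>dcoef n\<close> by a multiple of 1 / h x would
  leave a harmonic sum, that is, a logarithm. The decay supplies the additional factor ((n + 1)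
  x)^e, whose sum against 1 / (n + 1) is bounded.\<close>

lemma kernel_majorant_bound:
  obtains B where "0 < B" "\<And>x. 0 < x \<Longrightarrow> x \<le> 1 \<Longrightarrow> kernel_majorant (1 - x) \<le> B / h x"
proof -
  define M :: real where "M = fact (g - 1) * 2 ^ (g - 1)"
  define B1 where "B1 = A * 2 ^ g * exp 1 * M"
  define B where "B = max B1 (D * A / e)"
  have B0: "0 < B" unfolding B_def using D_ge_1 A1 e0 by (simp add: less_max_iff_disj)
  have main: "kernel_majorant (1 - x) \<le> 3 * B / h x" if x: "0 < x" "x \<le> 1" for x
  proof -
    \<comment> \<open>With u = x (n + 1) the power (1 - x)^n is at most e exp (-u). Half of this
      decay absorbs u^(g-1); the other half is q^(n+1).\<close>
    define q where "q = exp (- (x / 2))"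
    have q: "0 < q" "q \<le> 1" using x by (auto simp: q_def)
    txt \<open>The summands are dominated by the increments of the bounded sequence \<open>\<psi>\<close>: for \<open>n < 1/x\<close> the decay of
      the moments gives the increments of \<open>\<phi>\<close>, beyond that the power law loses against a geometric sequence.\<close>
    define \<phi> where "\<phi> n = min 1 ((real n * x) powr e)" for n
    have \<phi>_mono: "\<phi> n \<le> \<phi> (Suc n)" for n
      unfolding \<phi>_def using x e0 by (intro min.mono powr_mono2) (auto simp: algebra_simps)
    have hx: "0 < h x" using x by (rule_tac h_pos)
    \<comment> \<open>Both parts increase, so the increments of \<psi> dominate those of \<phi> as
      well as \<open>x * q ^ Suc n\<close>. Since \<psi> runs from -2 to at most 1, every partial
      sum of increments is at most 3.\<close>
    define \<psi> where "\<psi> n = \<phi> n - 2 * q ^ n" for n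
    have q_step: "x * q ^ Suc n \<le> 2 * q ^ n - 2 * q ^ Suc n" for n
    proof -
      have "1 + x / 2 \<le> exp (x / 2)" by (rule exp_ge_add_one_self)
      then have "x * q \<le> 2 * (1 - q)" unfolding q_def by (simp add: exp_minus field_simps)
      then have "q ^ n * (x * q) \<le> q ^ n * (2 * (1 - q))" using q by (intro mult_left_mono) auto
      then show ?thesis by (simp add: algebra_simps)
    qed
    have summand: "dcoef n / (real n + 1) * (1 - x) ^ n \<le> B / h x * (\<psi> (Suc n) - \<psi> n)" for n
    proof (cases "1 \<le> (real n + 1) * x")
      case True
      define u where "u = x * (real n + 1)"
      have u: "0 \<le> u" "1 \<le> u" using True x by (auto simp: u_def mult.commute)
      have "moment w (1 / x) \<le> A * ((2 * real n + 1) / (1 / x)) ^ g * moment w (2 * real n + 1)"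
        using x True by (intro power_law) (auto simp: field_simps)
      also have "(2 * real n + 1) / (1 / x) \<le> 2 * u" using x by (simp add: u_def algebra_simps)
      then have "A * ((2 * real n + 1) / (1 / x)) ^ g * moment w (2 * real n + 1) \<le> A * (2 * u) ^ g * moment w (2 * real n + 1)"
        using x A1 by (intro mult_right_mono mult_left_mono power_mono moment_nonneg) auto
      finally have "h x \<le> A * (2 * u) ^ g * moment w (2 * real n + 1)" by (simp add: h_def)
      then have d: "dcoef n \<le> A * (2 * u) ^ g / h x"
        using hx moment_pos[of "2 * real n + 1"] by (simp add: dcoef_def field_simps)
      have "(1 - x) ^ n \<le> exp (- x) ^ n"
        using x exp_ge_add_one_self[of "- x"] by (intro power_mono) auto
      also have "\<dots> = exp (- u + x)" by (simp add: u_def algebra_simps flip: exp_of_nat_mult)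
      also have "\<dots> \<le> exp (- u + 1)" using x by simp
      also have "exp (- u + 1) = exp (- u) * exp 1" by (rule exp_add)
      finally have t: "(1 - x) ^ n \<le> exp (- u) * exp 1" .
      have "dcoef n / (real n + 1) * (1 - x) ^ n \<le> (A * (2 * u) ^ g / h x) / (real n + 1) * (exp (- u) * exp 1)"
        using d t x u A1 hx by (intro mult_mono divide_right_mono) auto
      also have "(2 * u) ^ g = 2 ^ g * (u * u ^ (g - 1))"
        using g1 by (cases g) (auto simp: power_mult_distrib)
      also have "(A * (2 ^ g * (u * u ^ (g - 1))) / h x) / (real n + 1) * (exp (- u) * exp 1) = (A * 2 ^ g * exp 1) / h x * x * (u ^ (g - 1) * exp (- u))"
      proof -
        have xu: "u / (real n + 1) = x" by (simp add: u_def)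
        have "(A * (2 ^ g * (u * u ^ (g - 1))) / h x) / (real n + 1) * (exp (- u) * exp 1) = (A * 2 ^ g * exp 1) / h x * (u / (real n + 1)) * (u ^ (g - 1) * exp (- u))"
          by (simp add: mult_ac)
        then show ?thesis unfolding xu .
      qed
      also have "\<dots> \<le> (A * 2 ^ g * exp 1) / h x * x * (M * exp (u / 2) * exp (- u))"
        using x A1 hx u power_le_exp_half[of u "g - 1"] by (intro mult_left_mono mult_right_mono) (auto simp: M_def)
      also have "M * exp (u / 2) * exp (- u) = M * exp (- u / 2)"
        by (simp add: exp_add[symmetric] mult.assoc)
      also have "exp (- u / 2) = q ^ Suc n"
        unfolding q_def exp_of_nat_mult[symmetric] by (rule arg_cong[where f=exp]) (simp add: u_def field_simps)
      finally have "dcoef n / (real n + 1) * (1 - x) ^ n \<le> B1 / h x * (x * q ^ Suc n)"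
        by (simp add: B1_def mult_ac)
      also have "\<dots> \<le> B / h x * (x * q ^ Suc n)"
        using hx x q by (intro mult_right_mono divide_right_mono) (auto simp: B_def)
      also have "\<dots> \<le> B / h x * (\<psi> (Suc n) - \<psi> n)"
        using q_step[of n] \<phi>_mono[of n] B0 hx by (intro mult_left_mono) (auto simp: \<psi>_def)
      finally show ?thesis .
    next
      case False
      then have ux: "(real n + 1) * x < 1" by simp
      have "h x \<le> A * ((real n + 1) / (1 / x)) powr e * moment w (real n + 1)"
        unfolding h_def using x ux by (intro decay) (auto simp: field_simps)
      also have "\<dots> \<le> A * ((real n + 1) * x) powr e * (D * moment w (2 * real n + 1))"
        using A1 moment_le_D[of "real n + 1" "2 * real n + 1"] by (simp add: mult_left_mono)
      finally have d: "dcoef n \<le> D * A * ((real n + 1) * x) powr e / h x"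
        using hx moment_pos[of "2 * real n + 1"] by (simp add: dcoef_def field_simps)
      have "dcoef n / (real n + 1) * (1 - x) ^ n \<le> (D * A * ((real n + 1) * x) powr e / h x) / (real n + 1) * 1"
        using d x A1 D_ge_1 hx by (intro mult_mono divide_right_mono power_le_one) auto
      also have "\<dots> = D * A / h x * x powr e * (real n + 1) powr (e - 1)"
      proof -
        have "((real n + 1) * x) powr e = (real n + 1) powr e * x powr e" by (rule powr_mult)
        moreover have "(real n + 1) powr (e - 1) = (real n + 1) powr e / (real n + 1)" by (simp add: powr_diff)
        ultimately show ?thesis by (simp only: mult_ac times_divide_eq_left times_divide_eq_right divide_divide_eq_left mult_1_right mult_1_left)
      qed
      also have "\<dots> \<le> D * A / h x * x powr e * (((real n + 1) powr e - real n powr e) / e)"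
        using powr_diff_ge[of e n] e0 e_half D_ge_1 A1 hx by (intro mult_left_mono) (auto simp: field_simps)
      also have "\<dots> = D * A / e / h x * (\<phi> (Suc n) - \<phi> n)"
      proof -
        have "((real n + 1) * x) powr e \<le> 1" using ux x e0 by (intro powr_le1) auto
        moreover have "(real n * x) powr e \<le> ((real n + 1) * x) powr e" using x e0 by (intro powr_mono2) (auto simp: algebra_simps)
        ultimately have "\<phi> (Suc n) - \<phi> n = ((real n + 1) * x) powr e - (real n * x) powr e"
          unfolding \<phi>_def by (simp add: add.commute)
        also have "\<dots> = x powr e * ((real n + 1) powr e - real n powr e)"
        proof -
          have "((real n + 1) * x) powr e = (real n + 1) powr e * x powr e" "(real n * x) powr e = real n powr e * x powr e"
            by (rule powr_mult)+
          then show ?thesis by (simp only: right_diff_distrib mult.commute)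
        qed
        finally show ?thesis by (simp add: mult_ac)
      qed
      also have "\<dots> \<le> B / h x * (\<phi> (Suc n) - \<phi> n)"
        using hx \<phi>_mono[of n] by (intro mult_right_mono divide_right_mono) (auto simp: B_def)
      also have "\<dots> \<le> B / h x * (\<psi> (Suc n) - \<psi> n)"
        using q power_decreasing[of n "Suc n" q] B0 hx by (intro mult_left_mono) (auto simp: \<psi>_def)
      finally show ?thesis .
    qed
    have "(\<Sum>n<N. dcoef n / (real n + 1) * (1 - x) ^ n) \<le> 3 * B / h x" for N
    proof -
      have "(\<Sum>n<N. dcoef n / (real n + 1) * (1 - x) ^ n) \<le> (\<Sum>n<N. B / h x * (\<psi> (Suc n) - \<psi> n))"
        by (intro sum_mono summand)
      also have "\<dots> = B / h x * (\<psi> N - \<psi> 0)"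
        unfolding sum_distrib_left[symmetric] sum_lessThan_telescope by (rule refl)
      also have "\<dots> \<le> B / h x * 3"
      proof (rule mult_left_mono)
        have "\<phi> N \<le> 1" "\<phi> 0 = 0" "0 \<le> q ^ N" using e0 q by (simp_all add: \<phi>_def)
        then show "\<psi> N - \<psi> 0 \<le> 3" by (simp add: \<psi>_def)
      qed (use B0 hx in simp)
      finally show ?thesis by (simp add: mult.commute)
    qed
    then show ?thesis unfolding kernel_majorant_def
      using x by (intro suminf_le_const summable_kernel_majorant) auto
  qed
  show thesis by (rule that[of "3 * B"]) (use main B0 in auto)
qed

theorem kernel_deriv_bound:
  obtains B where "0 < B" "\<And>a. norm a < 1 \<Longrightarrow> norm (kernel_deriv a) \<le> B / (h (1 - norm a) * (norm (1 - a))\<^sup>2)"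
proof -
  obtain B where B: "0 < B" "\<And>x. 0 < x \<Longrightarrow> x \<le> 1 \<Longrightarrow> kernel_majorant (1 - x) \<le> B / h x"
    using kernel_majorant_bound by blast
  \<comment> \<open>The boundary term \<open>dcoef 1\<close> is absorbed because h (1 - |a|) never
    exceeds h 1.\<close>
  define C where "C = dcoef 1 * h 1 + K * B"
  have K0: "0 \<le> K" using D_ge_1 by (simp add: K_def)
  have C0: "0 < C" using dcoef_pos[of 1] h_pos[of 1] K0 B by (simp add: C_def add_pos_nonneg)
  have "norm (kernel_deriv a) \<le> C / (h (1 - norm a) * (norm (1 - a))\<^sup>2)" if a: "norm a < 1" for a
  proof -
    have x: "0 < 1 - norm a" "1 - norm a \<le> 1" using a by auto
    have hx: "0 < h (1 - norm a)" "h (1 - norm a) \<le> h 1" using x by (auto intro: h_pos h_mono)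
    have na: "0 < norm (1 - a)" using a by auto
    have "(norm (1 - a))\<^sup>2 * norm (kernel_deriv a) \<le> dcoef 1 + K * kernel_majorant (norm a)" by (rule kernel_deriv_bound_majorant) fact
    also have "\<dots> \<le> dcoef 1 * h 1 / h (1 - norm a) + K * (B / h (1 - norm a))"
    proof (intro add_mono mult_left_mono K0)
      show "dcoef 1 \<le> dcoef 1 * h 1 / h (1 - norm a)" using hx dcoef_pos[of 1] by (simp add: field_simps)
      show "kernel_majorant (norm a) \<le> B / h (1 - norm a)" using B(2)[OF x] by simp
    qed
    also have "\<dots> = C / h (1 - norm a)" by (simp add: C_def add_divide_distrib)
    finally show ?thesis using na hx by (simp add: field_simps)
  qed
  then show thesis using C0 by (intro that[of C])
qed

end

subsection \<open>Hyperbolic geometry of the disc\<close>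

lemma disc_denominator_nonzero:
  assumes "norm z < 1" "norm \<zeta> < 1"
  shows "1 - cnj z * \<zeta> \<noteq> 0"
proof
  assume "1 - cnj z * \<zeta> = 0"
  then have "norm (cnj z * \<zeta>) = 1" by (metis eq_iff_diff_eq_0 norm_one)
  moreover have "norm z * norm \<zeta> < 1"
    using assms mult_strict_mono[of "norm z" 1 "norm \<zeta>" 1] by simp
  ultimately show False by (simp add: norm_mult)
qed

lemma norm_sq_one_minus_cnj_mult:
  "(norm (1 - cnj z * \<zeta>))\<^sup>2 - (norm (z - \<zeta>))\<^sup>2 = (1 - (norm z)\<^sup>2) * (1 - (norm \<zeta>)\<^sup>2)"
  unfolding cmod_power2 by (simp add: power2_eq_square algebra_simps)

lemma one_minus_norm_disc_aut_sq:
  assumes "norm z < 1" "norm \<zeta> < 1"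
  shows "1 - (norm (disc_aut z \<zeta>))\<^sup>2 = (1 - (norm z)\<^sup>2) * (1 - (norm \<zeta>)\<^sup>2) / (norm (1 - cnj z * \<zeta>))\<^sup>2"
  using disc_denominator_nonzero[OF assms] norm_sq_one_minus_cnj_mult[of z \<zeta>]
  by (simp add: disc_aut_def norm_divide power_divide field_simps)

lemma norm_disc_aut_less_1:
  assumes "norm z < 1" "norm \<zeta> < 1"
  shows "norm (disc_aut z \<zeta>) < 1"
proof -
  have "0 < (1 - (norm z)\<^sup>2) * (1 - (norm \<zeta>)\<^sup>2)"
    using assms by (intro mult_pos_pos) (auto simp: abs_square_less_1)
  then have "0 < 1 - (norm (disc_aut z \<zeta>))\<^sup>2"
    unfolding one_minus_norm_disc_aut_sq[OF assms]
    using disc_denominator_nonzero[OF assms] by (intro divide_pos_pos) auto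
  then show ?thesis by (simp add: abs_square_less_1)
qed

lemma norm_disc_aut_commute: "norm (disc_aut z \<zeta>) = norm (disc_aut \<zeta> z)"
proof -
  have "norm (1 - cnj z * \<zeta>) = norm (cnj (1 - cnj z * \<zeta>))" by (rule complex_mod_cnj[symmetric])
  also have "\<dots> = norm (1 - cnj \<zeta> * z)" by (simp add: mult.commute)
  finally show ?thesis by (simp add: disc_aut_def norm_divide norm_minus_commute)
qed

lemma disc_aut_involution:
  assumes "norm z < 1" "norm \<zeta> < 1"
  shows "disc_aut z (disc_aut z \<zeta>) = \<zeta>"
proof -
  have 1: "1 - cnj z * \<zeta> \<noteq> 0" using assms by (rule disc_denominator_nonzero)
  have 2: "1 - cnj z * z \<noteq> 0" using assms by (intro disc_denominator_nonzero)
  have "z - disc_aut z \<zeta> = \<zeta> * (1 - cnj z * z) / (1 - cnj z * \<zeta>)"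
    using 1 by (simp add: disc_aut_def field_simps)
  moreover have "1 - cnj z * disc_aut z \<zeta> = (1 - cnj z * z) / (1 - cnj z * \<zeta>)"
    using 1 by (simp add: disc_aut_def field_simps)
  ultimately show ?thesis using 1 2 by (simp add: disc_aut_def[of z "disc_aut z \<zeta>"])
qed

lemma norm_disc_aut_disc_aut:
  assumes z: "norm z < 1" and a: "norm a < 1" and b: "norm b < 1"
  shows "norm (disc_aut (disc_aut z a) (disc_aut z b)) = norm (disc_aut a b)"
proof -
  have 1: "1 - cnj z * a \<noteq> 0" "1 - cnj z * b \<noteq> 0" "1 - z * cnj a \<noteq> 0"
    using disc_denominator_nonzero[OF z a] disc_denominator_nonzero[OF z b] disc_denominator_nonzero[OF a z]
    by (auto simp: mult.commute)
  have 2: "1 - cnj z * z \<noteq> 0" using z by (intro disc_denominator_nonzero)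
  have "disc_aut z a - disc_aut z b = (b - a) * (1 - cnj z * z) / ((1 - cnj z * a) * (1 - cnj z * b))"
    using 1 by (simp add: disc_aut_def field_simps)
  moreover have "1 - cnj (disc_aut z a) * disc_aut z b = (1 - cnj z * z) * (1 - cnj a * b) / ((1 - z * cnj a) * (1 - cnj z * b))"
  proof -
    have gen: "1 - (p / q) * (p' / q') = (q * q' - p * p') / (q * q')" if "q \<noteq> 0" "q' \<noteq> 0" for p p' q q' :: complex
      using that by (simp add: field_simps)
    have "1 - cnj (disc_aut z a) * disc_aut z b =
       ((1 - z * cnj a) * (1 - cnj z * b) - (cnj z - cnj a) * (z - b)) / ((1 - z * cnj a) * (1 - cnj z * b))"
      using gen[OF 1(3) 1(2)] by (simp add: disc_aut_def)
    moreover have "(1 - z * cnj a) * (1 - cnj z * b) - (cnj z - cnj a) * (z - b) = (1 - cnj z * z) * (1 - cnj a * b)"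
      by (simp add: algebra_simps)
    ultimately show ?thesis by simp
  qed
  ultimately have "norm (disc_aut (disc_aut z a) (disc_aut z b)) =
     norm (b - a) * norm (1 - cnj z * z) / (norm (1 - cnj z * a) * norm (1 - cnj z * b)) /
     (norm (1 - cnj z * z) * norm (1 - cnj a * b) / (norm (1 - z * cnj a) * norm (1 - cnj z * b)))"
    by (simp add: disc_aut_def[of "disc_aut z a"] norm_divide norm_mult)
  moreover have "norm (1 - z * cnj a) = norm (1 - cnj z * a)"
  proof -
    have "norm (1 - z * cnj a) = norm (cnj (1 - z * cnj a))" by (rule complex_mod_cnj[symmetric])
    then show ?thesis by simp
  qed
  ultimately show ?thesis
    using 1 2 by (simp add: disc_aut_def[of a b] norm_divide norm_minus_commute)
qed

lemma tanh_artanh_real: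
  fixes x :: real
  assumes "\<bar>x\<bar> < 1"
  shows "tanh (artanh x) = x"
proof -
  have p: "0 < 1 + x" "0 < 1 - x" using assms by auto
  have "- 2 * artanh x = ln ((1 - x) / (1 + x))" using p by (simp add: artanh_def ln_div)
  then have E: "exp (- 2 * artanh x) = (1 - x) / (1 + x)" using p by simp
  show ?thesis unfolding tanh_real_altdef E using p by (simp add: field_simps)
qed

lemma hyp_dist_eq_artanh: "hyp_dist z \<zeta> = artanh (norm (disc_aut z \<zeta>))"
  by (simp add: hyp_dist_def artanh_def)

lemma tanh_hyp_dist:
  assumes "norm z < 1" "norm \<zeta> < 1"
  shows "tanh (hyp_dist z \<zeta>) = norm (disc_aut z \<zeta>)"
  unfolding hyp_dist_eq_artanh using norm_disc_aut_less_1[OF assms] by (intro tanh_artanh_real) auto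

lemma hyp_dist_nonneg:
  assumes "norm z < 1" "norm \<zeta> < 1"
  shows "0 \<le> hyp_dist z \<zeta>"
  using tanh_hyp_dist[OF assms] norm_ge_zero[of "disc_aut z \<zeta>"] tanh_real_nonneg_iff[of "hyp_dist z \<zeta>"] by simp

lemma hyp_ball_eq:
  assumes "norm z < 1"
  shows "hyp_ball z r = {\<zeta>. norm \<zeta> < 1 \<and> norm (disc_aut z \<zeta>) < tanh r}"
  unfolding hyp_ball_def using tanh_hyp_dist[OF assms] tanh_real_less_iff by (auto, metis+)

lemma hyp_ball_borel: "norm z < 1 \<Longrightarrow> hyp_ball z r \<in> sets borel"
  by (subst hyp_ball_eq) (auto simp: disc_aut_def)

lemma hyp_ball_subset: "hyp_ball z r \<subseteq> unit_disc"
  by (auto simp: hyp_ball_def)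

lemma hyp_ball_mono: "r \<le> s \<Longrightarrow> hyp_ball z r \<subseteq> hyp_ball z s"
  by (auto simp: hyp_ball_def)

lemma norm_one_minus_cnj_mult_le:
  assumes z: "norm z < 1"
  shows "norm (1 - cnj z * \<zeta>) \<le> 2 * (1 - norm z) + norm (\<zeta> - z)"
proof -
  have "1 - cnj z * \<zeta> = of_real (1 - (norm z)\<^sup>2) - cnj z * (\<zeta> - z)"
    unfolding of_real_diff of_real_1 complex_norm_square by (simp add: algebra_simps)
  then have "norm (1 - cnj z * \<zeta>) \<le> norm (complex_of_real (1 - (norm z)\<^sup>2)) + norm (cnj z * (\<zeta> - z))"
    by (metis norm_triangle_ineq4)
  also have "norm (complex_of_real (1 - (norm z)\<^sup>2)) = (1 + norm z) * (1 - norm z)"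
  proof -
    have "0 \<le> 1 - (norm z)\<^sup>2" using z by (simp add: abs_square_le_1)
    then show ?thesis unfolding norm_of_real by (simp add: power2_eq_square algebra_simps)
  qed
  also have "\<dots> \<le> 2 * (1 - norm z)" using z by (intro mult_right_mono) auto
  also have "norm (cnj z * (\<zeta> - z)) \<le> norm (\<zeta> - z)"
    using z by (simp add: norm_mult mult_left_le_one_le)
  finally show ?thesis by simp
qed

text \<open>The distance is at most s |1 - cnj z \<zeta>|, and this modulus is at most 2 (1 - |z|)
  plus the distance; for s < 1 the latter is absorbed.\<close>

lemma dist_le_of_norm_disc_aut:
  assumes z: "norm z < 1" and \<zeta>: "norm \<zeta> < 1" and s: "norm (disc_aut z \<zeta>) \<le> s" "s < 1"
  shows "norm (\<zeta> - z) \<le> 2 * s / (1 - s) * (1 - norm z)"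
proof -
  let ?d = "norm (\<zeta> - z)" and ?q = "norm (1 - cnj z * \<zeta>)"
  have q0: "0 < ?q" using disc_denominator_nonzero[OF z \<zeta>] by simp
  have d: "?d \<le> s * ?q"
    using s(1) q0 by (simp add: disc_aut_def norm_divide norm_minus_commute field_simps)
  have "?q \<le> 2 * (1 - norm z) + s * ?q" using norm_one_minus_cnj_mult_le[OF z, of \<zeta>] d by linarith
  then have "(1 - s) * ?q \<le> 2 * (1 - norm z)" by (simp add: algebra_simps)
  then have q: "?q \<le> 2 / (1 - s) * (1 - norm z)" using s by (simp add: field_simps)
  have "0 \<le> s" using s(1) norm_ge_zero by (rule order_trans[rotated])
  then have "s * ?q \<le> s * (2 / (1 - s) * (1 - norm z))" using q by (intro mult_left_mono)
  then have "?d \<le> s * (2 / (1 - s) * (1 - norm z))" using d by (rule order_trans[rotated])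
  also have "\<dots> = 2 * s / (1 - s) * (1 - norm z)"
    by (simp only: times_divide_eq_left times_divide_eq_right mult_ac)
  finally show ?thesis .
qed

text \<open>Converse comparison, through the formula for 1 - |disc_aut|^2: the numerator is at least
  (1 - |z|)^2 / b and the denominator at most ((2 + a) (1 - |z|))^2.\<close>

lemma norm_disc_aut_sq_le:
  assumes z: "norm z < 1" and \<zeta>: "norm \<zeta> < 1"
    and a: "norm (\<zeta> - z) \<le> a * (1 - norm z)" "0 \<le> a" and b: "1 - norm z \<le> b * (1 - norm \<zeta>)" "0 < b"
  shows "(norm (disc_aut z \<zeta>))\<^sup>2 \<le> 1 - 1 / (b * (2 + a)\<^sup>2)"
proof -
  let ?q = "norm (1 - cnj z * \<zeta>)" and ?t = "1 - norm z"
  have t: "0 < ?t" using z by simp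
  have q0: "0 < ?q" using disc_denominator_nonzero[OF z \<zeta>] by simp
  have q: "?q \<le> (2 + a) * ?t" using norm_one_minus_cnj_mult_le[OF z, of \<zeta>] a by (simp add: algebra_simps)
  have u: "1 - norm x \<le> 1 - (norm x)\<^sup>2" if "norm x < 1" for x :: complex
    using that by (simp add: power2_eq_square mult_left_le)
  have gen: "1 / (b * c\<^sup>2) = t * (t / b) / (c * t)\<^sup>2" if "t \<noteq> 0" for t c :: real
    using that by (simp add: power_mult_distrib power2_eq_square)
  have "1 / (b * (2 + a)\<^sup>2) = ?t * (?t / b) / ((2 + a) * ?t)\<^sup>2"
    using t by (intro gen) auto
  also have "\<dots> \<le> ?t * (1 - norm \<zeta>) / ((2 + a) * ?t)\<^sup>2"
    using t b by (intro divide_right_mono mult_left_mono) (auto simp: field_simps)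
  also have "\<dots> \<le> (1 - (norm z)\<^sup>2) * (1 - (norm \<zeta>)\<^sup>2) / ?q\<^sup>2"
    using z \<zeta> q q0 u[of z] u[of \<zeta>] by (intro frac_le mult_mono power_mono) (auto simp: abs_square_le_1)
  also have "\<dots> = 1 - (norm (disc_aut z \<zeta>))\<^sup>2" using one_minus_norm_disc_aut_sq[OF z \<zeta>] by simp
  finally show ?thesis by simp
qed

lemma one_minus_cnj_mult_ge:
  assumes "norm z < 1" "norm u < 1"
  shows "1 - norm z \<le> norm (1 - cnj z * u)" "1 - norm u \<le> norm (1 - cnj z * u)"
proof -
  have "1 - norm z * norm u \<le> norm (1 - cnj z * u)"
    using norm_triangle_ineq2[of 1 "cnj z * u"] by (simp add: norm_mult)
  moreover have "norm z * norm u \<le> norm z" "norm z * norm u \<le> norm u"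
    using assms by (auto intro: mult_left_le mult_left_le_one_le)
  ultimately show "1 - norm z \<le> norm (1 - cnj z * u)" "1 - norm u \<le> norm (1 - cnj z * u)" by linarith+
qed

text \<open>The hyperbolic distance is half a logarithm of a quantity at most 4 X, with X the
  quotient in the statement, and ln X is at most X^\<epsilon> / \<epsilon>.\<close>

lemma one_plus_hyp_dist_le:
  assumes \<epsilon>: "0 < \<epsilon>"
  obtains C where "0 < C"
    "\<And>z u. norm z < 1 \<Longrightarrow> norm u < 1 \<Longrightarrow>
      1 + hyp_dist z u \<le> C * ((norm (1 - cnj z * u))\<^sup>2 / ((1 - norm z) * (1 - norm u))) powr \<epsilon>"
proof -
  define C where "C = 1 + ln 4 / 2 + 1 / (2 * \<epsilon>)"
  have "1 + hyp_dist z u \<le> C * ((norm (1 - cnj z * u))\<^sup>2 / ((1 - norm z) * (1 - norm u))) powr \<epsilon>"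
    if z: "norm z < 1" and u: "norm u < 1" for z u
  proof -
    define X where "X = (norm (1 - cnj z * u))\<^sup>2 / ((1 - norm z) * (1 - norm u))"
    have "(1 - norm z) * (1 - norm u) \<le> (norm (1 - cnj z * u))\<^sup>2"
      unfolding power2_eq_square using one_minus_cnj_mult_ge[OF z u] z u by (intro mult_mono) auto
    then have X1: "1 \<le> X" using z u by (simp add: X_def)
    define s where "s = norm (disc_aut z u)"
    have s: "0 \<le> s" "s < 1" using norm_disc_aut_less_1[OF z u] by (auto simp: s_def)
    have le: "1 - norm x \<le> 1 - (norm x)\<^sup>2" if "norm x < 1" for x :: complex
      using that by (simp add: power2_eq_square mult_left_le)
    have "1 / X = (1 - norm z) * (1 - norm u) / (norm (1 - cnj z * u))\<^sup>2" by (simp add: X_def)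
    also have "\<dots> \<le> 1 - s\<^sup>2"
      unfolding s_def one_minus_norm_disc_aut_sq[OF z u] using le[OF z] le[OF u] z u
      by (intro divide_right_mono mult_mono) auto
    finally have "1 / X \<le> (1 - s) * (1 + s)" by (simp add: power2_eq_square algebra_simps)
    also have "\<dots> \<le> (1 - s) * 2" using s by (intro mult_left_mono) auto
    finally have "1 / (1 - s) \<le> 2 * X" using X1 s by (simp add: field_simps)
    moreover have "(1 + s) / (1 - s) \<le> 2 * (1 / (1 - s))" using s divide_right_mono[of "1 + s" 2 "1 - s"] by simp
    ultimately have "(1 + s) / (1 - s) \<le> 4 * X" by simp
    then have "ln ((1 + s) / (1 - s)) \<le> ln (4 * X)" using s X1 by (subst ln_le_cancel_iff) auto
    also have "\<dots> = ln 4 + ln X" using X1 by (simp add: ln_mult)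
    also have "ln X \<le> X powr \<epsilon> / \<epsilon>"
    proof -
      have "\<epsilon> * ln X \<le> X powr \<epsilon>" using X1 ln_le_minus_one[of "X powr \<epsilon>"] by (simp add: ln_powr)
      then show ?thesis using \<epsilon> by (simp add: field_simps)
    qed
    finally have "hyp_dist z u \<le> (ln 4 + X powr \<epsilon> / \<epsilon>) / 2" by (simp add: hyp_dist_def s_def)
    moreover have "1 \<le> X powr \<epsilon>" using X1 \<epsilon> by (intro ge_one_powr_ge_zero) auto
    then have "(1 + ln 4 / 2) * 1 \<le> (1 + ln 4 / 2) * X powr \<epsilon>" by (intro mult_left_mono) auto
    ultimately show ?thesis unfolding X_def[symmetric] C_def by (simp add: algebra_simps)
  qed
  moreover have "0 < C" unfolding C_def using \<epsilon> by (intro add_pos_pos add_pos_nonneg) auto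
  ultimately show thesis using that by blast
qed

text \<open>The involution \<open>disc_aut z\<close> moves \<open>z\<close> to 0, where geodesics
  are radii. The point of modulus \<open>tanh a\<close> in the direction of the image of
  \<open>u\<close> is moved back, and the subtraction formula for tanh gives the remaining
  distance.\<close>

lemma hyp_dist_intermediate:
  assumes z: "norm z < 1" and u: "norm u < 1" and ab: "0 < a" "0 < b" and d: "hyp_dist z u \<le> a + b"
  obtains v where "norm v < 1" "hyp_dist z v \<le> a" "hyp_dist v u \<le> b"
proof (cases "hyp_dist z u \<le> a")
  case True
  moreover have "hyp_dist u u \<le> b" using ab by (simp add: hyp_dist_def disc_aut_def)
  ultimately show thesis using that[OF u] by blast
next
  case False
  define B where "B = hyp_dist z u"
  have B: "a < B" "B \<le> a + b" using False d by (auto simp: B_def)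
  define w where "w = disc_aut z u"
  have w: "norm w = tanh B" using tanh_hyp_dist[OF z u] by (simp add: w_def B_def)
  have w1: "norm w < 1" unfolding w_def by (rule norm_disc_aut_less_1[OF z u])
  have tB: "0 < tanh B" using B ab by simp
  define x where "x = tanh a / tanh B"
  have x: "0 \<le> x" "x < 1" using B ab tB by (auto simp: x_def)
  have "norm (of_real x * w) = x * tanh B" using x by (simp add: norm_mult w)
  then have xw: "norm (of_real x * w) = tanh a" using tB by (simp add: x_def)
  then have xw1: "norm (of_real x * w) < 1" using tanh_real_lt_1[of a] by simp
  define v where "v = disc_aut z (of_real x * w)"
  have v1: "norm v < 1" unfolding v_def by (rule norm_disc_aut_less_1[OF z xw1])
  have "hyp_dist z v = artanh (tanh a)"
    unfolding hyp_dist_eq_artanh v_def disc_aut_involution[OF z xw1] xw ..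
  then have 1: "hyp_dist z v = a" by (simp add: artanh_tanh_real)
  have "norm (disc_aut v u) = norm (disc_aut v (disc_aut z w))"
    unfolding w_def disc_aut_involution[OF z u] ..
  also have "\<dots> = norm (disc_aut (of_real x * w) w)"
    unfolding v_def by (rule norm_disc_aut_disc_aut[OF z xw1 w1])
  also have "\<dots> = norm (of_real (x - 1) * w) / norm (complex_of_real (1 - x * (norm w)\<^sup>2))"
  proof -
    have "1 - cnj (of_real x * w) * w = complex_of_real (1 - x * (norm w)\<^sup>2)"
      unfolding of_real_diff of_real_mult complex_norm_square by simp
    moreover have "of_real x * w - w = of_real (x - 1) * w" by (simp add: algebra_simps)
    ultimately show ?thesis by (simp only: disc_aut_def norm_divide)
  qed
  also have "\<dots> = (1 - x) * tanh B / (1 - x * (tanh B)\<^sup>2)"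
  proof -
    have "x * (tanh B)\<^sup>2 \<le> 1 * 1" using x w w1 tB by (intro mult_mono power_le_one) auto
    then show ?thesis using x tB unfolding norm_mult norm_of_real w by simp
  qed
  also have "\<dots> = (tanh B - tanh a) / (1 - tanh B * tanh a)"
  proof -
    have "x * (tanh B)\<^sup>2 = tanh B * tanh a" "(1 - x) * tanh B = tanh B - tanh a"
      using tB by (simp_all add: x_def power2_eq_square left_diff_distrib)
    then show ?thesis by (simp only:)
  qed
  also have "\<dots> = tanh (B + (- a))"
    by (subst tanh_add) auto
  finally have "hyp_dist v u = B - a" unfolding hyp_dist_eq_artanh by (simp add: artanh_tanh_real)
  then show thesis using that[OF v1] 1 B by simp
qed

subsection \<open>Mass of hyperbolic discs\<close>

lemma half_le_sin:
  assumes "0 \<le> x" "x \<le> pi / 2"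
  shows "x / 2 \<le> sin x"
proof -
  have aux: "y * cos y \<le> sin y" if "0 \<le> y" "y \<le> pi" for y
  proof -
    have "sin 0 - 0 * cos 0 \<le> sin y - y * cos y"
    proof (rule DERIV_nonneg_imp_nondecreasing[OF that(1)])
      fix t assume t: "0 \<le> t" "t \<le> y"
      have "((\<lambda>t. sin t - t * cos t) has_real_derivative t * sin t) (at t)"
        by (auto intro!: derivative_eq_intros)
      moreover have "0 \<le> t * sin t" using t that by (intro mult_nonneg_nonneg sin_ge_zero) auto
      ultimately show "\<exists>d. ((\<lambda>t. sin t - t * cos t) has_real_derivative d) (at t) \<and> 0 \<le> d" by blast
    qed
    then show ?thesis by simp
  qed
  have c: "0 \<le> cos (x / 2)" using assms by (intro cos_ge_zero) auto
  have "(1 + cos x) / 2 = (cos (x / 2))\<^sup>2" using cos_double_cos[of "x / 2"] by simp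
  moreover have "0 \<le> cos x" using assms by (intro cos_ge_zero) auto
  ultimately have c2: "1 / 2 \<le> (cos (x / 2))\<^sup>2" by simp
  have "x / 2 \<le> x * (cos (x / 2))\<^sup>2" using mult_left_mono[OF c2 assms(1)] by simp
  also have "\<dots> = 2 * (x / 2 * cos (x / 2)) * cos (x / 2)" by (simp add: power2_eq_square)
  also have "\<dots> \<le> 2 * sin (x / 2) * cos (x / 2)"
    using assms c by (intro mult_right_mono mult_left_mono aux) auto
  also have "\<dots> = sin x" using sin_double[of "x / 2"] by simp
  finally show ?thesis .
qed

lemma norm_cis_minus_1_le: "norm (cis t - 1) \<le> \<bar>t\<bar>"
proof -
  have "(norm (cis t - 1))\<^sup>2 = 2 - 2 * cos t"
    using sin_cos_squared_add[of t] unfolding cmod_power2 by (simp add: power2_eq_square algebra_simps)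
  also have "\<dots> = (2 * sin (t / 2))\<^sup>2" using cos_double_sin[of "t / 2"] by (simp add: power_mult_distrib)
  also have "\<dots> \<le> t\<^sup>2"
  proof -
    have "\<bar>2 * sin (t / 2)\<bar> \<le> \<bar>t\<bar>" using abs_sin_x_le_abs_x[of "t / 2"] by simp
    then show ?thesis by (simp only: abs_le_square_iff)
  qed
  also have "\<dots> = \<bar>t\<bar>\<^sup>2" by simp
  finally show ?thesis by (rule power2_le_imp_le) simp
qed

lemma norm_one_minus_cis_sq:
  assumes "\<bar>t\<bar> \<le> pi" "0 \<le> s"
  shows "(1 - s)\<^sup>2 + s * t\<^sup>2 / 4 \<le> (norm (1 - of_real s * cis t))\<^sup>2"
proof -
  have "(norm (1 - of_real s * cis t))\<^sup>2 = (1 - s)\<^sup>2 + s * (2 - 2 * cos t)"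
  proof -
    have "(norm (1 - of_real s * cis t))\<^sup>2 = (1 - s * cos t)\<^sup>2 + (s * sin t)\<^sup>2"
      unfolding cmod_power2 by simp
    also have "\<dots> = 1 - 2 * s * cos t + s\<^sup>2 * ((sin t)\<^sup>2 + (cos t)\<^sup>2)"
      by algebra
    also have "\<dots> = (1 - s)\<^sup>2 + s * (2 - 2 * cos t)"
      unfolding sin_cos_squared_add by (simp add: power2_eq_square algebra_simps)
    finally show ?thesis .
  qed
  moreover have "2 - 2 * cos t = (2 * sin (\<bar>t\<bar> / 2))\<^sup>2"
    using cos_double_sin[of "\<bar>t\<bar> / 2"] by (simp add: power_mult_distrib)
  moreover have "(\<bar>t\<bar> / 2)\<^sup>2 \<le> (2 * sin (\<bar>t\<bar> / 2))\<^sup>2"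
    using half_le_sin[of "\<bar>t\<bar> / 2"] assms by (intro power_mono) auto
  then have "s * (t\<^sup>2 / 4) \<le> s * (2 * sin (\<bar>t\<bar> / 2))\<^sup>2"
    using assms by (intro mult_left_mono) (auto simp: power_divide)
  ultimately show ?thesis by simp
qed

lemma polar_form:
  obtains a where "z = complex_of_real (norm z) * cis a"
  using rcis_cmod_Arg[of z] unfolding rcis_def by metis

section \<open>Mass of polar sectors\<close>

context borel_weight
begin

lemma sets_weighted_area_Borel:
  assumes "S \<in> sets borel" "S \<subseteq> unit_disc"
  shows "S \<in> sets \<mu>"
proof -
  have "id \<in> \<mu> \<rightarrow>\<^sub>M borel" by (rule measurable_weighted_area) simp
  then have "id -` S \<inter> space \<mu> \<in> sets \<mu>" using assms(1) by (rule measurable_sets)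
  then show ?thesis using assms by (simp add: space_weighted_area Int_absorb2)
qed

lemma emeasure_weighted_area_Borel:
  assumes "S \<in> sets borel" "S \<subseteq> unit_disc"
  shows "emeasure \<mu> S =
    (\<integral>\<^sup>+t. indicator {a<..<a+2*pi} t * (\<integral>\<^sup>+r. ennreal (r * w r / pi) * indicator S (r * cis t) \<partial>lborel) \<partial>lborel)"
proof -
  have "S \<in> sets \<mu>" using assms by (rule sets_weighted_area_Borel)
  then have "emeasure \<mu> S = (\<integral>\<^sup>+z. indicator S z \<partial>\<mu>)" by simp
  also have "\<dots> = (\<integral>\<^sup>+t. indicator {a<..<a+2*pi} t * (\<integral>\<^sup>+r. ennreal (r * w r / pi) * indicator S (r * cis t) \<partial>lborel) \<partial>lborel)"
    using assms(1) by (intro nn_integral_weighted_area_polar) auto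
  finally show ?thesis .
qed

lemma measure_sector_le:
  assumes S: "S \<in> sets borel" "S \<subseteq> unit_disc" and s: "0 \<le> s" and c: "0 \<le> c"
    and sub: "\<And>r t. \<bar>t - a\<bar> \<le> pi \<Longrightarrow> 0 < r \<Longrightarrow> r < 1 \<Longrightarrow> complex_of_real r * cis t \<in> S \<Longrightarrow> s \<le> r \<and> \<bar>t - a\<bar> \<le> c"
  shows "measure \<mu> S \<le> c * tail w s"
proof -
  interpret finite_measure "\<mu>" by (rule finite_measure_weighted_area)
  \<comment> \<open>The angular interval is centred at \<open>a\<close>, so the condition on
    \<open>S\<close> applies to every angle in it.\<close>
  have "emeasure \<mu> S =
    (\<integral>\<^sup>+t. indicator {a-pi<..<a-pi+2*pi} t * (\<integral>\<^sup>+r. ennreal (r * w r / pi) * indicator S (r * cis t) \<partial>lborel) \<partial>lborel)"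
    by (rule emeasure_weighted_area_Borel) fact+
  also have "\<dots> \<le> (\<integral>\<^sup>+t. indicator {a-c..a+c} t * (\<integral>\<^sup>+r. ennreal (1 / pi) * (indicator {s..} r * ennreal (w r)) \<partial>lborel) \<partial>lborel)"
  proof (rule nn_integral_mono)
    fix t :: real
    show "indicator {a-pi<..<a-pi+2*pi} t * (\<integral>\<^sup>+r. ennreal (r * w r / pi) * indicator S (r * cis t) \<partial>lborel)
      \<le> indicator {a-c..a+c} t * (\<integral>\<^sup>+r. ennreal (1 / pi) * (indicator {s..} r * ennreal (w r)) \<partial>lborel)"
    proof (cases "t \<in> {a-pi<..<a-pi+2*pi}")
      case True
      then have t: "\<bar>t - a\<bar> \<le> pi" by auto
      have "(\<integral>\<^sup>+r. ennreal (r * w r / pi) * indicator S (r * cis t) \<partial>lborel) \<le>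
        (\<integral>\<^sup>+r. indicator {a-c..a+c} t * (ennreal (1 / pi) * (indicator {s..} r * ennreal (w r))) \<partial>lborel)"
      proof (rule nn_integral_mono)
        fix r :: real
        show "ennreal (r * w r / pi) * indicator S (r * cis t) \<le> indicator {a-c..a+c} t * (ennreal (1 / pi) * (indicator {s..} r * ennreal (w r)))"
        proof (cases "0 < r \<and> r < 1 \<and> r * cis t \<in> S")
          case True
          then have "s \<le> r" "t \<in> {a-c..a+c}" using sub[OF t, of r] by auto
          moreover have "ennreal (r * w r / pi) \<le> ennreal (1 / pi) * ennreal (w r)"
            using True mult_right_mono[of r 1 "w r"]
            by (subst ennreal_mult[symmetric]) (auto intro!: ennreal_leI divide_right_mono)
          ultimately show ?thesis using True by simp
        next
          case False
          then show ?thesis by (cases "r = 0"; cases "r \<in> {0..<1}") (auto simp: w_support)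
        qed
      qed
      then show ?thesis using True by (auto simp: nn_integral_cmult split: split_indicator)
    qed simp
  qed
  also have "\<dots> = (\<integral>\<^sup>+t. indicator {a-c..a+c} t * (ennreal (1 / pi) * ennreal (tail w s)) \<partial>lborel)"
    using s by (simp add: nn_integral_cmult nn_integral_tail)
  also have "\<dots> = ennreal (2 * c) * (ennreal (1 / pi) * ennreal (tail w s))"
    using c by (simp add: nn_integral_multc)
  also have "\<dots> = ennreal (2 * c * (1 / pi * tail w s))"
    using c s tail_nonneg[of s] by (simp add: ennreal_mult[symmetric])
  finally have "measure \<mu> S \<le> 2 * c * (1 / pi * tail w s)"
    using c s tail_nonneg[of s] by (simp add: emeasure_eq_measure)
  also have "\<dots> = (2 / pi) * (c * tail w s)" by simp
  also have "\<dots> \<le> 1 * (c * tail w s)"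
    using c s tail_nonneg[of s] pi_ge_two by (intro mult_right_mono) auto
  finally show ?thesis by simp
qed

text \<open>The angular width is at most 2 < 2 pi, so the sector does not overlap itself; the factor
  \<open>s\<close> is the least radius in it.\<close>

lemma measure_sector_ge:
  assumes S: "S \<in> sets borel" "S \<subseteq> unit_disc" and s: "0 \<le> s" "s \<le> s'" and c: "0 \<le> c" "c \<le> 1"
    and sub: "\<And>r t. \<bar>t - a\<bar> \<le> c \<Longrightarrow> s \<le> r \<Longrightarrow> r < s' \<Longrightarrow> r < 1 \<Longrightarrow> complex_of_real r * cis t \<in> S"
  shows "2 / pi * c * s * (tail w s - tail w s') \<le> measure \<mu> S"
proof -
  interpret finite_measure "\<mu>" by (rule finite_measure_weighted_area)
  have ts: "(\<integral>\<^sup>+r. indicator {s..<s'} r * ennreal (w r) \<partial>lborel) = ennreal (tail w s - tail w s')"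
  proof -
    have "(\<integral>\<^sup>+r. indicator {s..<s'} r * ennreal (w r) \<partial>lborel) = (\<integral>\<^sup>+r. ennreal (indicator {s..} r * w r - indicator {s'..} r * w r) \<partial>lborel)"
      using s by (auto intro!: nn_integral_cong split: split_indicator)
    also have "\<dots> = ennreal (LINT r|lborel. indicator {s..} r * w r - indicator {s'..} r * w r)"
      using s by (intro nn_integral_eq_integral Bochner_Integration.integrable_diff integrable_bounded_mult_w[where B=1])
        (auto split: split_indicator)
    also have "(LINT r|lborel. indicator {s..} r * w r - indicator {s'..} r * w r) = tail w s - tail w s'"
      using s tail_eq[of s] tail_eq[of s']
      by (subst Bochner_Integration.integral_diff) (auto intro!: integrable_bounded_mult_w[where B=1] split: split_indicator)
    finally show ?thesis .
  qed
  have "ennreal (2 / pi * c * s * (tail w s - tail w s')) = ennreal (2 * c) * (ennreal (s / pi) * ennreal (tail w s - tail w s'))"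
    using c s tail_antimono[of s s'] by (simp add: ennreal_mult[symmetric] mult_ac)
  also have "\<dots> = (\<integral>\<^sup>+t. indicator {a-c..a+c} t * (ennreal (s / pi) * ennreal (tail w s - tail w s')) \<partial>lborel)"
    using c by (simp add: nn_integral_multc)
  also have "\<dots> = (\<integral>\<^sup>+t. indicator {a-c..a+c} t * (\<integral>\<^sup>+r. ennreal (s / pi) * (indicator {s..<s'} r * ennreal (w r)) \<partial>lborel) \<partial>lborel)"
    by (simp add: nn_integral_cmult ts)
  also have "\<dots> \<le> (\<integral>\<^sup>+t. indicator {a-pi<..<a-pi+2*pi} t * (\<integral>\<^sup>+r. ennreal (r * w r / pi) * indicator S (r * cis t) \<partial>lborel) \<partial>lborel)"
  proof (rule nn_integral_mono)
    fix t :: real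
    show "indicator {a-c..a+c} t * (\<integral>\<^sup>+r. ennreal (s / pi) * (indicator {s..<s'} r * ennreal (w r)) \<partial>lborel)
      \<le> indicator {a-pi<..<a-pi+2*pi} t * (\<integral>\<^sup>+r. ennreal (r * w r / pi) * indicator S (r * cis t) \<partial>lborel)"
    proof (cases "t \<in> {a-c..a+c}")
      case True
      then have t: "\<bar>t - a\<bar> \<le> c" "t \<in> {a-pi<..<a-pi+2*pi}" using c pi_gt3 by auto
      have "(\<integral>\<^sup>+r. ennreal (s / pi) * (indicator {s..<s'} r * ennreal (w r)) \<partial>lborel) \<le>
         (\<integral>\<^sup>+r. ennreal (r * w r / pi) * indicator S (r * cis t) \<partial>lborel)"
      proof (rule nn_integral_mono)
        fix r :: real
        show "ennreal (s / pi) * (indicator {s..<s'} r * ennreal (w r)) \<le> ennreal (r * w r / pi) * indicator S (r * cis t)"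
        proof (cases "r \<in> {s..<s'} \<and> r < 1")
          case True
          then have "r * cis t \<in> S" using sub[OF t(1), of r] by auto
          moreover have "ennreal (s / pi) * ennreal (w r) \<le> ennreal (r * w r / pi)"
            using True s mult_right_mono[of s r "w r"]
            by (subst ennreal_mult[symmetric]) (auto intro!: ennreal_leI divide_right_mono)
          ultimately show ?thesis using True s by simp
        next
          case False
          then have "r \<notin> {s..<s'} \<or> w r = 0" using w_support[of r] by auto
          then show ?thesis by auto
        qed
      qed
      then show ?thesis using t(2) True by simp
    qed simp
  qed
  also have "\<dots> = emeasure \<mu> S"
    by (rule emeasure_weighted_area_Borel[symmetric]) fact+
  finally show ?thesis
    by (simp add: emeasure_eq_measure)
qed

end

section \<open>Mass of sets of bounded hyperbolic size\<close>

context regular_weight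
begin

text \<open>Near the boundary such a set lies in a sector of width and depth of order 1 - |u|, whose
  tail is comparable to h; away from the boundary the total mass suffices.\<close>

lemma measure_ball_le:
  assumes L: "0 \<le> L"
  obtains C where "0 < C" "\<And>u S. norm u < 1 \<Longrightarrow> S \<in> sets borel \<Longrightarrow> S \<subseteq> unit_disc \<Longrightarrow>
    (\<And>\<zeta>. \<zeta> \<in> S \<Longrightarrow> norm (\<zeta> - u) \<le> L * (1 - norm u)) \<Longrightarrow>
    measure \<mu> S \<le> C * (h (1 - norm u) * (1 - norm u))"
proof -
  interpret finite_measure "\<mu>" by (rule finite_measure_weighted_area)
  \<comment> \<open>Below this threshold (L + 1) t < 1/2, so u and S stay outside the disc of radius
    1/2. There |u| r >= 1/4, and the distance controls the angle with the factor 4 L.\<close>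
  define t0 where "t0 = 1 / (2 * (L + 1))"
  have t0: "0 < t0" using L by (simp add: t0_def)
  define M where "M = measure \<mu> unit_disc"
  have M0: "0 \<le> M" by (simp add: M_def)
  define C1 where "C1 = M / (h t0 * t0)"
  define C2 where "C2 = 4 * L * (A * (A * (L + 1) ^ g))"
  have C1: "0 \<le> C1" "0 \<le> C2" using h_pos[OF t0] t0 M0 L A1 by (auto simp: C1_def C2_def)
  have "measure \<mu> S \<le> (C1 + C2 + 1) * (h (1 - norm u) * (1 - norm u))"
    if u: "norm u < 1" and S: "S \<in> sets borel" "S \<subseteq> unit_disc"
      and d: "\<And>\<zeta>. \<zeta> \<in> S \<Longrightarrow> norm (\<zeta> - u) \<le> L * (1 - norm u)" for u S
  proof -
    define t where "t = 1 - norm u"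
    have t: "0 < t" "t \<le> 1" using u by (auto simp: t_def)
    have ht: "0 < h t" by (rule h_pos) fact
    show ?thesis
    proof (cases "t0 \<le> t")
      case True
      have "measure \<mu> S \<le> M"
        unfolding M_def using S by (intro finite_measure_mono sets_weighted_area_Borel) auto
      also have "\<dots> = C1 * (h t0 * t0)" using h_pos[OF t0] t0 by (simp add: C1_def)
      also have "\<dots> \<le> C1 * (h t * t)" using True t0 C1 h_mono[OF t0 True] h_pos[OF t0]
        by (intro mult_left_mono mult_mono) auto
      also have "\<dots> \<le> (C1 + C2 + 1) * (h t * t)" using C1 t ht by (intro mult_right_mono) auto
      finally show ?thesis by (simp add: t_def)
    next
      case False
      then have small: "(L + 1) * t < 1 / 2" using L by (simp add: t0_def field_simps)
      define s where "s = 1 - (L + 1) * t"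
      have s: "1 / 2 \<le> s" "s < 1" using small t L by (auto simp: s_def intro: mult_pos_pos)
      have un: "1 / 2 \<le> norm u"
      proof -
        have "t \<le> (L + 1) * t" using t L by (simp add: algebra_simps)
        then show ?thesis using small by (simp add: t_def)
      qed
      obtain a where a: "u = of_real (norm u) * cis a" using polar_form by blast
      have "measure \<mu> S \<le> (4 * L * t) * tail w s"
      proof (rule measure_sector_le[OF S, where a=a])
        fix r \<theta> :: real
        assume \<theta>: "\<bar>\<theta> - a\<bar> \<le> pi" and r: "0 < r" "r < 1" and z: "of_real r * cis \<theta> \<in> S"
        have dz: "norm (of_real r * cis \<theta> - u) \<le> L * t" using d[OF z] by (simp add: t_def)
        have "norm u - r \<le> norm (of_real r * cis \<theta> - u)"
          using norm_triangle_ineq3[of "of_real r * cis \<theta>" u] r by (simp add: norm_mult)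
        then have rs: "s \<le> r" using dz by (simp add: s_def t_def algebra_simps)
        have "norm (of_real r * cis \<theta> - u) = norm (cis a * (of_real r * cis (\<theta> - a) - of_real (norm u)))"
        proof -
          have "of_real r * cis \<theta> - u = cis a * (of_real r * cis (\<theta> - a) - of_real (norm u))"
            by (subst a) (simp add: algebra_simps cis_mult)
          then show ?thesis by (rule arg_cong)
        qed
        also have "\<dots> = norm (of_real r * cis (\<theta> - a) - of_real (norm u))" by (simp add: norm_mult)
        also have "\<dots> = norm (of_real (norm u) * (1 - of_real (r / norm u) * cis (\<theta> - a)))"
        proof -
          have "u \<noteq> 0" using un by auto
          then show ?thesis by (simp add: right_diff_distrib norm_minus_commute)
        qed
        also have "\<dots> = norm u * norm (1 - of_real (r / norm u) * cis (\<theta> - a))" by (simp add: norm_mult)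
        finally have eq: "norm (of_real r * cis \<theta> - u) = norm u * norm (1 - of_real (r / norm u) * cis (\<theta> - a))" .
        have "(r / norm u) * (\<theta> - a)\<^sup>2 / 4 \<le> (norm (1 - of_real (r / norm u) * cis (\<theta> - a)))\<^sup>2"
        proof -
          have "0 \<le> r / norm u" using r by simp
          from norm_one_minus_cis_sq[OF \<theta> this] show ?thesis
            using zero_le_power2[of "1 - r / norm u"] by linarith
        qed
        then have "(norm u)\<^sup>2 * ((r / norm u) * (\<theta> - a)\<^sup>2 / 4) \<le> (norm u)\<^sup>2 * (norm (1 - of_real (r / norm u) * cis (\<theta> - a)))\<^sup>2"
          by (intro mult_left_mono) auto
        also have "\<dots> = (norm (of_real r * cis \<theta> - u))\<^sup>2" unfolding eq by (simp add: power_mult_distrib)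
        also have "\<dots> \<le> (L * t)\<^sup>2" using dz by (intro power_mono) auto
        finally have "(norm u)\<^sup>2 * ((r / norm u) * (\<theta> - a)\<^sup>2 / 4) \<le> (L * t)\<^sup>2" .
        have 1: "norm u * r * (\<theta> - a)\<^sup>2 / 4 \<le> (L * t)\<^sup>2"
        proof -
          have "norm u \<noteq> 0" using un by auto
          then have "(norm u)\<^sup>2 * ((r / norm u) * (\<theta> - a)\<^sup>2 / 4) = norm u * r * (\<theta> - a)\<^sup>2 / 4"
            by (simp add: power2_eq_square)
          then show ?thesis using \<open>(norm u)\<^sup>2 * ((r / norm u) * (\<theta> - a)\<^sup>2 / 4) \<le> (L * t)\<^sup>2\<close> by (simp only:)
        qed
        have "1 / 2 * (1 / 2) \<le> norm u * r" using un rs s by (intro mult_mono) auto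
        then have "1 / 4 * ((\<theta> - a)\<^sup>2 / 4) \<le> norm u * r * ((\<theta> - a)\<^sup>2 / 4)" by (intro mult_right_mono) auto
        then have "(\<theta> - a)\<^sup>2 \<le> (4 * L * t)\<^sup>2" using 1 by (simp add: power_mult_distrib)
        then have "\<bar>\<theta> - a\<bar> \<le> \<bar>4 * L * t\<bar>" by (simp only: abs_le_square_iff)
        also have "\<bar>4 * L * t\<bar> = 4 * L * t" using L t by (intro abs_of_nonneg) auto
        finally have "\<bar>\<theta> - a\<bar> \<le> 4 * L * t" .
        then show "s \<le> r \<and> \<bar>\<theta> - a\<bar> \<le> 4 * L * t" using rs by simp
      qed (use s L t in auto)
      also have "\<dots> \<le> (4 * L * t) * (A * (A * (L + 1) ^ g * h t))"
      proof (rule mult_left_mono)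
        have x: "1 \<le> 1 / ((L + 1) * t)" "1 - 1 / (1 / ((L + 1) * t)) = s"
          using small L t by (auto simp: s_def)
        have "tail w s \<le> A * h ((L + 1) * t)" using tail_le[OF x(1)] unfolding x(2) h_def .
        also have "h ((L + 1) * t) \<le> A * ((L + 1) * t / t) ^ g * h t"
          using small L t by (intro h_power_law) (auto simp: algebra_simps)
        also have "(L + 1) * t / t = L + 1" using t by simp
        finally show "tail w s \<le> A * (A * (L + 1) ^ g * h t)" using A1 by (simp add: mult_left_mono)
      qed (use L t in auto)
      also have "\<dots> = C2 * (h t * t)" by (simp add: C2_def)
      also have "\<dots> \<le> (C1 + C2 + 1) * (h t * t)" using C1 t ht by (intro mult_right_mono) auto
      finally show ?thesis by (simp add: t_def)
    qed
  qed
  then show thesis using C1 by (intro that[of "C1 + C2 + 1"]) auto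
qed

text \<open>With this constant the decay of the moments makes the tail at \<open>1 - t / (2 Kd)\<close> at most half a constant
  multiple of the tail at \<open>1 - t / 2\<close>, so the annulus in between carries a fixed proportion of the mass.\<close>

definition Kd :: real where "Kd = (2 * A ^ 3) powr (1 / e)"

lemma Kd_ge: "4 \<le> Kd"
proof -
  have A3: "1 \<le> A ^ 3" using A1 by (rule one_le_power)
  have "4 = (2::real) powr 2" by simp
  also have "\<dots> \<le> 2 powr (1 / e)" using e0 e_half by (intro powr_mono) (auto simp: field_simps)
  also have "\<dots> \<le> (2 * A ^ 3) powr (1 / e)" using A3 e0 by (intro powr_mono2) auto
  finally show ?thesis by (simp add: Kd_def)
qed

text \<open>Contains the annular sector 1 - t/2 <= r < 1 - t / (2 Kd) of half width t about the
  argument of u, with t = 1 - |u|, where mass is guaranteed even if the weight vanishes near u.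
  Euclidean conditions make it easy to place in several hyperbolic discs.\<close>

definition core :: "complex \<Rightarrow> complex set" where
  "core u = {\<zeta>. norm \<zeta> < 1 \<and> norm (\<zeta> - u) \<le> 2 * (1 - norm u) \<and> 1 - norm u \<le> 2 * Kd * (1 - norm \<zeta>)}"

lemma core_borel: "core u \<in> sets borel" unfolding core_def by measurable

lemma core_subset: "core u \<subseteq> unit_disc" by (auto simp: core_def)

lemma measure_core_ge:
  obtains c where "0 < c" "\<And>u. norm u < 1 \<Longrightarrow> c * (h (1 - norm u) * (1 - norm u)) \<le> measure \<mu> (core u)"
proof -
  define c where "c = 1 / (8 * A * (A * 2 ^ g))"
  have "c * (h (1 - norm u) * (1 - norm u)) \<le> measure \<mu> (core u)" if u: "norm u < 1" for u
  proof -
    define t where "t = 1 - norm u"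
    have t: "0 < t" "t \<le> 1" using u by (auto simp: t_def)
    obtain a where a: "u = of_real (norm u) * cis a" using polar_form by blast
    define s s' where "s = 1 - t / 2" and "s' = 1 - t / (2 * Kd)"
    have tK: "t / (2 * Kd) \<le> t / 2" using t Kd_ge by (intro divide_left_mono) auto
    have s: "1 / 2 \<le> s" "s \<le> s'" "s' < 1" using tK t Kd_ge by (auto simp: s_def s'_def)
    have "2 / pi * t * s * (tail w s - tail w s') \<le> measure \<mu> (core u)"
    proof (rule measure_sector_ge[OF core_borel core_subset, where a=a])
      fix r \<theta> :: real
      assume \<theta>: "\<bar>\<theta> - a\<bar> \<le> t" and r: "s \<le> r" "r < s'" "r < 1"
      have r0: "0 < r" using r s by auto
      have nz: "norm (of_real r * cis \<theta>) = r" using r0 by (simp add: norm_mult)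
      have "of_real r * cis \<theta> - u = cis a * (of_real r * (cis (\<theta> - a) - 1) + of_real (r - norm u))"
        by (subst a) (simp add: algebra_simps cis_mult)
      then have "norm (of_real r * cis \<theta> - u) = norm (of_real r * (cis (\<theta> - a) - 1) + of_real (r - norm u))"
        by (simp only: norm_mult norm_cis mult_1_left)
      also have "\<dots> \<le> norm (of_real r * (cis (\<theta> - a) - 1)) + norm (complex_of_real (r - norm u))"
        by (rule norm_triangle_ineq)
      also have "\<dots> \<le> t + t"
      proof (rule add_mono)
        have "norm (of_real r * (cis (\<theta> - a) - 1)) \<le> 1 * \<bar>\<theta> - a\<bar>"
          unfolding norm_mult using r0 r by (intro mult_mono norm_cis_minus_1_le) auto
        then show "norm (of_real r * (cis (\<theta> - a) - 1)) \<le> t" using \<theta> by simp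
        have "1 + norm u \<le> 2 * r" using r(1) unfolding s_def t_def by argo
        then have "\<bar>r - norm u\<bar> \<le> t" using r t unfolding t_def abs_le_iff by (intro conjI) linarith+
        then show "norm (complex_of_real (r - norm u)) \<le> t" unfolding norm_of_real .
      qed
      finally have "norm (of_real r * cis \<theta> - u) \<le> 2 * (1 - norm u)" by (simp add: t_def)
      moreover have "1 - norm u \<le> 2 * Kd * (1 - norm (of_real r * cis \<theta>))"
      proof -
        have "t / (2 * Kd) \<le> 1 - r" using r by (simp add: s'_def)
        then show ?thesis unfolding nz t_def[symmetric] using Kd_ge by (simp add: field_simps)
      qed
      ultimately show "of_real r * cis \<theta> \<in> core u" using nz r by (simp add: core_def)
    qed (use s t in auto)
    moreover have "c * (h t * t) \<le> 2 / pi * t * s * (tail w s - tail w s')"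
    proof -
      have x: "1 \<le> 1 / (t / 2)" "1 - 1 / (1 / (t / 2)) = s" using t by (auto simp: s_def)
      have ts: "h (t / 2) / A \<le> tail w s"
        using moment_le[OF x(1)] A1 unfolding x(2) h_def by (simp add: field_simps)
      have x': "1 \<le> 1 / (t / (2 * Kd))" "1 - 1 / (1 / (t / (2 * Kd))) = s'" using t Kd_ge by (auto simp: s'_def)
      have "tail w s' \<le> A * h (t / (2 * Kd))" using tail_le[OF x'(1)] unfolding x'(2) h_def .
      also have "\<dots> \<le> A * (A * ((t / (2 * Kd)) / (t / 2)) powr e * h (t / 2))"
        using t tK Kd_ge A1 by (intro mult_left_mono h_decay) auto
      also have "(t / (2 * Kd)) / (t / 2) = 1 / Kd" using t Kd_ge by simp
      also have "(1 / Kd) powr e = 1 / (2 * A ^ 3)"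
        using e0 A1 Kd_ge by (simp add: powr_divide Kd_def powr_powr)
      also have "A * (A * (1 / (2 * A ^ 3)) * h (t / 2)) = h (t / 2) / (2 * A)"
        using A1 by (simp add: power3_eq_cube)
      \<comment> \<open>The tail at s is at least h (t/2) / A, and the choice of \<open>Kd\<close>
        made the tail at s' at most half of that.\<close>
      finally have "tail w s - tail w s' \<ge> h (t / 2) / (2 * A)" using ts by (simp add: field_simps)
      moreover have "h t \<le> A * (t / (t / 2)) ^ g * h (t / 2)" using t by (intro h_power_law) auto
      then have "h t / (A * 2 ^ g) \<le> h (t / 2)" using t A1 by (simp add: field_simps)
      then have "h t / (A * 2 ^ g) / (2 * A) \<le> h (t / 2) / (2 * A)" using A1 by (intro divide_right_mono) auto
      ultimately have diff: "h t / (A * 2 ^ g) / (2 * A) \<le> tail w s - tail w s'" by linarith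
      have ht: "0 < h t" using t by (intro h_pos)
      have "1 / 4 \<le> 2 / pi * s"
      proof -
        have "2 / pi * (1 / 2) \<le> 2 / pi * s" using s by (intro mult_left_mono) auto
        moreover have "1 / 4 \<le> 2 / pi * (1 / 2)" using pi_less_4 by (simp add: field_simps)
        ultimately show ?thesis by linarith
      qed
      then have "1 / 4 * t * (h t / (A * 2 ^ g) / (2 * A)) \<le> (2 / pi * s) * t * (tail w s - tail w s')"
        using diff t ht A1 s by (intro mult_mono) auto
      then show ?thesis by (simp add: c_def mult_ac)
    qed
    ultimately show ?thesis by (simp add: t_def)
  qed
  moreover have "0 < c" using A1 by (simp add: c_def)
  ultimately show thesis using that by blast
qed

text \<open>The radius is large enough for a hyperbolic disc to contain the cores of all centres nearby;
  \<open>147 = 3 (2 + 5)\<^sup>2\<close> comes from the comparison of hyperbolic and Euclidean distance.\<close>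

definition r0 :: real where "r0 = artanh (sqrt (1 - 1 / (147 * Kd))) + 1"

lemma in_hyp_ball_r0:
  assumes z: "norm z < 1" and \<zeta>: "norm \<zeta> < 1"
    and a: "norm (\<zeta> - z) \<le> 5 * (1 - norm z)" and b: "1 - norm z \<le> 3 * Kd * (1 - norm \<zeta>)"
  shows "\<zeta> \<in> hyp_ball z r0"
proof -
  define q where "q = sqrt (1 - 1 / (147 * Kd))"
  have K: "0 < 1 / (147 * Kd)" "1 / (147 * Kd) \<le> 1" using Kd_ge by auto
  then have q: "0 \<le> q" "q < 1" "q\<^sup>2 = 1 - 1 / (147 * Kd)" by (auto simp: q_def)
  have "(norm (disc_aut z \<zeta>))\<^sup>2 \<le> 1 - 1 / (3 * Kd * (2 + 5)\<^sup>2)"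
    using z \<zeta> a b Kd_ge by (intro norm_disc_aut_sq_le) auto
  also have "\<dots> = q\<^sup>2" using q by simp
  finally have "norm (disc_aut z \<zeta>) \<le> q" using q(1) by (rule power2_le_imp_le)
  also have "q = tanh (artanh q)" using q by (intro tanh_artanh_real[symmetric]) auto
  also have "\<dots> < tanh r0" unfolding r0_def q_def by simp
  finally show ?thesis using z \<zeta> by (simp add: hyp_ball_eq)
qed

lemma r0_pos: "0 < r0"
proof -
  have "0 \<in> hyp_ball 0 r0" using Kd_ge by (intro in_hyp_ball_r0) auto
  then show ?thesis by (simp add: hyp_ball_def hyp_dist_def disc_aut_def)
qed

text \<open>Here 1 - |u| <= 2 (1 - |v|) and 1 - |v| <= 3/2 (1 - |u|). So the distance is at most 2 *
  2 + 1 = 5 times 1 - |v|, and 2 Kd becomes 3 Kd, the constants that fixed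
  \<open>r0\<close>.\<close>

lemma core_subset_hyp_ball:
  assumes u: "norm u < 1" and v: "norm v < 1" and d: "norm (v - u) \<le> (1 - norm u) / 2"
  shows "core u \<subseteq> hyp_ball v r0"
proof
  fix \<zeta> assume \<zeta>: "\<zeta> \<in> core u"
  have n: "\<bar>norm v - norm u\<bar> \<le> (1 - norm u) / 2" using norm_triangle_ineq3[of v u] d by linarith
  have "norm (\<zeta> - v) \<le> norm (\<zeta> - u) + norm (v - u)" using norm_triangle_ineq4[of "\<zeta> - u" "v - u"] by simp
  also have "\<dots> \<le> 5 * (1 - norm v)"
  proof -
    have "norm (\<zeta> - u) \<le> 2 * (1 - norm u)" using \<zeta> by (simp add: core_def)
    moreover have "2 * (norm v - norm u) \<le> 1 - norm u" using n unfolding abs_le_iff by simp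
    moreover have "2 * norm (v - u) \<le> 1 - norm u" using d by simp
    ultimately show ?thesis by argo
  qed
  finally have 1: "norm (\<zeta> - v) \<le> 5 * (1 - norm v)" .
  have "1 - norm v \<le> 3 / 2 * (1 - norm u)" using n unfolding abs_le_iff by argo
  also have "\<dots> \<le> 3 / 2 * (2 * Kd * (1 - norm \<zeta>))" using \<zeta> unfolding core_def by (intro mult_left_mono) auto
  finally have 2: "1 - norm v \<le> 3 * Kd * (1 - norm \<zeta>)" by simp
  show "\<zeta> \<in> hyp_ball v r0" using 1 2 v \<zeta> by (intro in_hyp_ball_r0) (auto simp: core_def)
qed

lemma measure_hyp_ball_ge:
  obtains c where "0 < c" "\<And>u r. norm u < 1 \<Longrightarrow> r0 \<le> r \<Longrightarrow> c * (h (1 - norm u) * (1 - norm u)) \<le> measure \<mu> (hyp_ball u r)"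
proof -
  interpret finite_measure "\<mu>" by (rule finite_measure_weighted_area)
  obtain c where c: "0 < c" "\<And>u. norm u < 1 \<Longrightarrow> c * (h (1 - norm u) * (1 - norm u)) \<le> measure \<mu> (core u)"
    using measure_core_ge by blast
  have "c * (h (1 - norm u) * (1 - norm u)) \<le> measure \<mu> (hyp_ball u r)" if u: "norm u < 1" and r: "r0 \<le> r" for u r
  proof -
    have "measure \<mu> (core u) \<le> measure \<mu> (hyp_ball u r)"
      using core_subset_hyp_ball[OF u u] hyp_ball_mono[OF r, of u] u
      by (intro finite_measure_mono sets_weighted_area_Borel hyp_ball_borel hyp_ball_subset) auto
    then show ?thesis using c(2)[OF u] by linarith
  qed
  then show thesis using c(1) that by blast
qed

lemma measure_hyp_ball_le:
  assumes r: "0 < r"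
  obtains C where "0 < C" "\<And>u. norm u < 1 \<Longrightarrow> measure \<mu> (hyp_ball u r) \<le> C * (h (1 - norm u) * (1 - norm u))"
proof -
  define s where "s = tanh r"
  have s: "0 < s" "s < 1" using r by (auto simp: s_def tanh_real_lt_1)
  then have L: "0 \<le> 2 * s / (1 - s)" by simp
  obtain C where C: "0 < C" "\<And>u S. norm u < 1 \<Longrightarrow> S \<in> sets borel \<Longrightarrow> S \<subseteq> unit_disc \<Longrightarrow>
    (\<And>\<zeta>. \<zeta> \<in> S \<Longrightarrow> norm (\<zeta> - u) \<le> 2 * s / (1 - s) * (1 - norm u)) \<Longrightarrow>
    measure \<mu> S \<le> C * (h (1 - norm u) * (1 - norm u))"
    using measure_ball_le[OF L] by blast
  have "measure \<mu> (hyp_ball u r) \<le> C * (h (1 - norm u) * (1 - norm u))" if u: "norm u < 1" for u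
  proof (rule C(2)[OF u hyp_ball_borel[OF u] hyp_ball_subset])
    fix \<zeta> assume "\<zeta> \<in> hyp_ball u r"
    then show "norm (\<zeta> - u) \<le> 2 * s / (1 - s) * (1 - norm u)"
      using u s by (intro dist_le_of_norm_disc_aut) (auto simp: hyp_ball_eq s_def)
  qed
  then show thesis using C(1) that by blast
qed

end

subsection \<open>Oscillation over hyperbolic discs\<close>

lemma le_one_plus_powr:
  fixes x :: real
  assumes "0 \<le> x" "1 \<le> p"
  shows "x \<le> 1 + x powr p"
proof (cases "x \<le> 1")
  case True
  then show ?thesis using powr_ge_zero[of x p] by linarith
next
  case False
  then have "x powr 1 \<le> x powr p" using assms by (intro powr_mono) auto
  then show ?thesis using False by simp
qed

lemma norm_diff_powr_le:
  fixes a b c :: complex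
  assumes "0 \<le> p"
  shows "norm (a - c) powr p \<le> 2 powr p * (norm (a - b) powr p + norm (b - c) powr p)"
proof -
  let ?m = "max (norm (a - b)) (norm (b - c))"
  have "norm (a - c) \<le> 2 * ?m" using norm_triangle_ineq[of "a - b" "b - c"] by simp
  then have "norm (a - c) powr p \<le> (2 * ?m) powr p" using assms by (intro powr_mono2) auto
  also have "\<dots> = 2 powr p * ?m powr p" by (rule powr_mult)
  also have "?m powr p \<le> norm (a - b) powr p + norm (b - c) powr p"
    by (simp add: max_def)
  finally show ?thesis by (simp add: mult_left_mono)
qed

context finite_measure
begin

lemma integrable_indicat: "S \<in> sets M \<Longrightarrow> integrable M (indicat_real S)"
  using integrable_mult_indicator[of S M "\<lambda>_. 1 :: real"] by simp

lemma integrable_of_integrable_powr: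
  fixes q :: "'a \<Rightarrow> real"
  assumes m: "q \<in> borel_measurable M" and nn: "\<And>x. 0 \<le> q x" and p: "1 \<le> p" and i: "integrable M (\<lambda>x. q x powr p)"
  shows "integrable M q"
proof (rule Bochner_Integration.integrable_bound)
  show "integrable M (\<lambda>x. 1 + q x powr p)" using i by auto
  show "AE x in M. norm (q x) \<le> norm (1 + q x powr p)"
    using le_one_plus_powr[OF nn p] nn by (intro AE_I2) auto
qed fact

lemma set_integral_mono_integrable:
  fixes f q :: "'a \<Rightarrow> real"
  assumes "S \<in> sets M" "integrable M f" "integrable M q" "\<And>x. x \<in> S \<Longrightarrow> f x \<le> q x"
  shows "(LINT x:S|M. f x) \<le> (LINT x:S|M. q x)"
  unfolding set_lebesgue_integral_def
proof (rule integral_mono)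
  show "integrable M (\<lambda>x. indicat_real S x *\<^sub>R f x)" "integrable M (\<lambda>x. indicat_real S x *\<^sub>R q x)"
    using assms by (intro integrable_mult_indicator; simp)+
qed (use assms in \<open>auto split: split_indicator\<close>)

lemma set_integral_const_add:
  fixes q :: "'a \<Rightarrow> real"
  assumes "S \<in> sets M" "integrable M q"
  shows "(LINT x:S|M. c + k * q x) = c * measure M S + k * (LINT x:S|M. q x)"
proof -
  have i: "integrable M (\<lambda>x. indicat_real S x *\<^sub>R q x)" "integrable M (\<lambda>x. indicat_real S x)"
    using assms by (intro integrable_mult_indicator integrable_indicat; simp)+
  have "(LINT x:S|M. c + k * q x) = (LINT x|M. c * indicat_real S x + k * (indicat_real S x *\<^sub>R q x))"
    unfolding set_lebesgue_integral_def by (intro Bochner_Integration.integral_cong) (auto simp: algebra_simps)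
  also have "\<dots> = c * measure M S + k * (LINT x:S|M. q x)"
    using i assms by (subst Bochner_Integration.integral_add) (auto simp: set_lebesgue_integral_def)
  finally show ?thesis .
qed

text \<open>Stands in for the Hoelder inequality: pointwise q <= B + B^(1-p) q^p, each of the two
  terms contributing B times the measure.\<close>

lemma set_integral_le_of_powr:
  fixes q :: "'a \<Rightarrow> real"
  assumes S: "S \<in> sets M" and m: "q \<in> borel_measurable M" and nn: "\<And>x. 0 \<le> q x" and p: "1 \<le> p"
    and i: "integrable M (\<lambda>x. q x powr p)" and B: "0 < B" and le: "(LINT x:S|M. q x powr p) \<le> B powr p * measure M S"
  shows "(LINT x:S|M. q x) \<le> 2 * B * measure M S"
proof -
  have "q x \<le> B + B powr (1 - p) * q x powr p" for x
  proof -
    have "q x / B \<le> 1 + (q x / B) powr p" using nn[of x] B p by (intro le_one_plus_powr) auto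
    then have "q x \<le> B * (1 + (q x / B) powr p)" using B by (simp add: field_simps)
    also have "\<dots> = B + B powr (1 - p) * q x powr p"
      using B nn[of x] by (simp add: powr_divide powr_diff field_simps)
    finally show ?thesis .
  qed
  then have "(LINT x:S|M. q x) \<le> (LINT x:S|M. B + B powr (1 - p) * q x powr p)"
    using S integrable_of_integrable_powr[OF m nn p i] i by (intro set_integral_mono_integrable) auto
  also have "\<dots> = B * measure M S + B powr (1 - p) * (LINT x:S|M. q x powr p)"
    using S i by (rule set_integral_const_add)
  also have "\<dots> \<le> B * measure M S + B powr (1 - p) * (B powr p * measure M S)"
    using le by (intro add_left_mono mult_left_mono) auto
  also have "\<dots> = 2 * B * measure M S" using B by (simp add: powr_diff)
  finally show ?thesis .
qed

lemma set_integral_norm_mean_le: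
  fixes f :: "'a \<Rightarrow> complex"
  assumes S: "S \<in> sets M" and i: "integrable M f" and pos: "0 < measure M S"
    and le: "(LINT x:S|M. norm (f x - c)) \<le> B * measure M S"
  shows "norm ((LINT x:S|M. f x) / of_real (measure M S) - c) \<le> B"
proof -
  have i': "integrable M (\<lambda>x. indicat_real S x *\<^sub>R f x)" "integrable M (\<lambda>x. indicat_real S x *\<^sub>R c)"
    using S i by (auto intro!: integrable_mult_indicator)
  have "(LINT x:S|M. f x - c) = (LINT x:S|M. f x) - of_real (measure M S) * c"
  proof -
    have "(LINT x:S|M. f x - c) = (LINT x|M. indicat_real S x *\<^sub>R f x - indicat_real S x *\<^sub>R c)"
      unfolding set_lebesgue_integral_def by (simp add: scaleR_right_diff_distrib)
    also have "\<dots> = (LINT x:S|M. f x) - (LINT x|M. indicat_real S x *\<^sub>R c)"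
      using i' by (simp add: set_lebesgue_integral_def)
    also have "(LINT x|M. indicat_real S x *\<^sub>R c) = of_real (measure M S) * c"
      using S integrable_indicat[OF S] by (subst integral_scaleR_left) (auto simp: scaleR_conv_of_real)
    finally show ?thesis .
  qed
  then have "(LINT x:S|M. f x) / of_real (measure M S) - c = (LINT x:S|M. f x - c) / of_real (measure M S)"
    using pos by (simp add: field_simps)
  then have "norm ((LINT x:S|M. f x) / of_real (measure M S) - c) = norm (LINT x:S|M. f x - c) / measure M S"
    using pos by (simp add: norm_divide)
  moreover have "norm (LINT x:S|M. f x - c) \<le> (LINT x:S|M. norm (f x - c))"
    unfolding set_lebesgue_integral_def
    using integral_norm_bound[of M "\<lambda>x. indicat_real S x *\<^sub>R (f x - c)"] by simp
  then have "norm (LINT x:S|M. f x - c) / measure M S \<le> B"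
    using le pos by (simp add: divide_le_eq)
  ultimately show ?thesis by simp
qed

end

section \<open>Means and oscillation of a weighted p-integrable function\<close>

context borel_weight
begin

lemma Lp_measurable: "f \<in> Lp_weighted w p \<Longrightarrow> f \<in> borel_measurable \<mu>"
  unfolding Lp_weighted_def weighted_area_def by simp

lemma Lp_integrable_powr_diff:
  assumes f: "f \<in> Lp_weighted w p" and p: "1 \<le> p"
  shows "integrable \<mu> (\<lambda>z. norm (f z - c) powr p)"
proof (rule Bochner_Integration.integrable_bound)
  interpret finite_measure "\<mu>" by (rule finite_measure_weighted_area)
  show "integrable \<mu> (\<lambda>z. 2 powr p * (norm (f z) powr p + norm c powr p))"
    using f by (auto simp: Lp_weighted_def)
  show "AE z in \<mu>. norm (norm (f z - c) powr p) \<le> norm (2 powr p * (norm (f z) powr p + norm c powr p))"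
  proof (rule AE_I2)
    fix z
    have "norm (f z - c) powr p \<le> 2 powr p * (norm (f z - 0) powr p + norm (0 - c) powr p)"
      using p by (intro norm_diff_powr_le) simp
    then show "norm (norm (f z - c) powr p) \<le> norm (2 powr p * (norm (f z) powr p + norm c powr p))" by simp
  qed
  have [measurable]: "f \<in> borel_measurable \<mu>" using f by (rule Lp_measurable)
  show "(\<lambda>z. norm (f z - c) powr p) \<in> borel_measurable \<mu>" by measurable
qed

lemma Lp_integrable:
  assumes f: "f \<in> Lp_weighted w p" and p: "1 \<le> p"
  shows "integrable \<mu> f"
proof -
  interpret finite_measure "\<mu>" by (rule finite_measure_weighted_area)
  have [measurable]: "f \<in> borel_measurable \<mu>" using f by (rule Lp_measurable)
  have "integrable \<mu> (\<lambda>z. norm (f z))"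
  proof (rule integrable_of_integrable_powr[OF _ _ p])
    show "integrable \<mu> (\<lambda>z. norm (f z) powr p)"
      using Lp_integrable_powr_diff[OF f p, of 0] by simp
  qed auto
  then show ?thesis using integrable_norm_iff[of f "\<mu>"] by simp
qed

lemma sets_hyp_ball: "norm z < 1 \<Longrightarrow> hyp_ball z r \<in> sets \<mu>"
  by (intro sets_weighted_area_Borel hyp_ball_borel hyp_ball_subset)

lemma hyp_mean_diff_le:
  assumes f: "f \<in> Lp_weighted w p" and p: "1 \<le> p" and z: "norm z < 1" and pos: "0 < measure \<mu> (hyp_ball z r)"
    and B: "0 < B" and le: "(LINT \<zeta>:hyp_ball z r|\<mu>. norm (f \<zeta> - c) powr p) \<le> B powr p * measure \<mu> (hyp_ball z r)"
  shows "norm (hyp_mean w r f z - c) \<le> 2 * B"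
proof -
  interpret finite_measure "\<mu>" by (rule finite_measure_weighted_area)
  have [measurable]: "f \<in> borel_measurable \<mu>" using f by (rule Lp_measurable)
  have "(LINT \<zeta>:hyp_ball z r|\<mu>. norm (f \<zeta> - c)) \<le> 2 * B * measure \<mu> (hyp_ball z r)"
    using le B p by (intro set_integral_le_of_powr[where p=p] sets_hyp_ball z Lp_integrable_powr_diff f) auto
  then show ?thesis
    unfolding hyp_mean_def by (intro set_integral_norm_mean_le sets_hyp_ball z pos Lp_integrable[OF f p])
qed

text \<open>Oscillation about any constant suffices. The factor 8 is 2 for the triangle inequality,
  2 for the distance of the mean from c, and 2 for adding two terms inside the p-th root.\<close>

lemma mean_osc_le:
  assumes f: "f \<in> Lp_weighted w p" and p: "1 \<le> p" and z: "norm z < 1" and pos: "0 < measure \<mu> (hyp_ball z r)"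
    and B: "0 < B" and le: "(LINT \<zeta>:hyp_ball z r|\<mu>. norm (f \<zeta> - c) powr p) \<le> B powr p * measure \<mu> (hyp_ball z r)"
  shows "mean_osc w p r f z \<le> 8 * B"
proof -
  interpret finite_measure "\<mu>" by (rule finite_measure_weighted_area)
  let ?F = "hyp_mean w r f z" and ?m = "measure \<mu> (hyp_ball z r)"
  have F: "norm (?F - c) \<le> 2 * B" by (rule hyp_mean_diff_le) fact+
  have "(LINT \<zeta>:hyp_ball z r|\<mu>. norm (f \<zeta> - ?F) powr p)
     \<le> (LINT \<zeta>:hyp_ball z r|\<mu>. 2 powr p * (2 * B) powr p + 2 powr p * norm (f \<zeta> - c) powr p)"
  proof (rule set_integral_mono_integrable)
    fix \<zeta>
    have "norm (f \<zeta> - ?F) powr p \<le> 2 powr p * (norm (f \<zeta> - c) powr p + norm (c - ?F) powr p)"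
      using p by (intro norm_diff_powr_le) auto
    also have "norm (c - ?F) powr p \<le> (2 * B) powr p"
      using F p by (intro powr_mono2) (auto simp: norm_minus_commute)
    finally show "norm (f \<zeta> - ?F) powr p \<le> 2 powr p * (2 * B) powr p + 2 powr p * norm (f \<zeta> - c) powr p"
      by (simp add: algebra_simps)
  qed (auto intro!: sets_hyp_ball z Lp_integrable_powr_diff[OF f p])
  also have "\<dots> = 2 powr p * (2 * B) powr p * ?m + 2 powr p * (LINT \<zeta>:hyp_ball z r|\<mu>. norm (f \<zeta> - c) powr p)"
    by (intro set_integral_const_add sets_hyp_ball z Lp_integrable_powr_diff[OF f p])
  also have "\<dots> \<le> 2 powr p * (2 * B) powr p * ?m + 2 powr p * (B powr p * ?m)"
    using le by (intro add_left_mono mult_left_mono) auto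
  also have "\<dots> \<le> 2 powr p * (2 * B) powr p * ?m + 2 powr p * ((2 * B) powr p * ?m)"
    using B p by (intro add_left_mono mult_left_mono mult_right_mono powr_mono2) auto
  also have "\<dots> = 2 * (2 powr p * (2 * B) powr p * ?m)" by simp
  also have "\<dots> \<le> 2 powr p * (2 powr p * (2 * B) powr p * ?m)"
    using p powr_mono[of 1 p 2] by (intro mult_right_mono) auto
  also have "\<dots> = (8 * B) powr p * ?m"
    by (simp add: mult.assoc[symmetric] flip: powr_mult)
  finally have "(LINT \<zeta>:hyp_ball z r|\<mu>. norm (f \<zeta> - ?F) powr p) / ?m \<le> (8 * B) powr p"
    using pos by (simp add: field_simps)
  moreover have "0 \<le> (LINT \<zeta>:hyp_ball z r|\<mu>. norm (f \<zeta> - ?F) powr p)"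
    unfolding set_lebesgue_integral_def by (intro Bochner_Integration.integral_nonneg) auto
  ultimately have "mean_osc w p r f z \<le> ((8 * B) powr p) powr (1 / p)"
    unfolding mean_osc_def using p pos by (intro powr_mono2) auto
  also have "\<dots> = 8 * B" using B p by (simp add: powr_powr)
  finally show ?thesis .
qed

lemma set_integral_of_mean_osc:
  assumes p: "1 \<le> p" and pos: "0 < measure \<mu> (hyp_ball z r)"
    and B: "0 < B" and le: "mean_osc w p r f z \<le> B"
  shows "(LINT \<zeta>:hyp_ball z r|\<mu>. norm (f \<zeta> - hyp_mean w r f z) powr p) \<le> B powr p * measure \<mu> (hyp_ball z r)"
proof -
  let ?I = "LINT \<zeta>:hyp_ball z r|\<mu>. norm (f \<zeta> - hyp_mean w r f z) powr p"
  let ?m = "measure \<mu> (hyp_ball z r)"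
  have I: "0 \<le> ?I" unfolding set_lebesgue_integral_def by (intro Bochner_Integration.integral_nonneg) auto
  have "(?I / ?m) = ((?I / ?m) powr (1 / p)) powr p" using I pos p by (simp add: powr_powr)
  also have "\<dots> \<le> B powr p"
    using le p unfolding mean_osc_def by (intro powr_mono2) auto
  finally show ?thesis using pos by (simp add: field_simps)
qed

end

section \<open>Comparison of means at different centres\<close>

context regular_weight
begin

text \<open>At pseudohyperbolic distance 1/5 the Euclidean distance is at most half of 1 - |u|, as
  \<open>core_subset_hyp_ball\<close> requires.\<close>

definition b0 :: real where "b0 = artanh (1/5)"

lemma tanh_b0: "tanh b0 = 1/5" unfolding b0_def by (rule tanh_artanh_real) simp

lemma b0_pos: "0 < b0"
proof -
  have "0 < tanh b0" unfolding tanh_b0 by simp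
  then show ?thesis by simp
qed

lemma dist_le_of_hyp_dist_b0:
  assumes "norm u < 1" "norm v < 1" "hyp_dist u v \<le> b0"
  shows "norm (v - u) \<le> (1 - norm u) / 2"
proof -
  have "norm (disc_aut u v) \<le> 1/5"
    using assms tanh_hyp_dist[of u v] tanh_b0 tanh_real_le_iff[of "hyp_dist u v" b0] by simp
  then have "norm (v - u) \<le> 2 * (1/5) / (1 - 1/5) * (1 - norm u)"
    using assms by (intro dist_le_of_norm_disc_aut) auto
  then show ?thesis by simp
qed

lemma h_le_of_le:
  assumes "0 < s" "t \<le> 1" "t \<le> L * s" "1 \<le> L" "0 < t"
  shows "h t \<le> A * L ^ g * h s"
proof (cases "t \<le> s")
  case True
  have "h t \<le> 1 * 1 * h s" using True assms h_mono[of t s] by simp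
  also have "\<dots> \<le> A * L ^ g * h s"
    using assms A1 h_pos[of s] by (intro mult_right_mono mult_mono one_le_power) auto
  finally show ?thesis .
next
  case False
  then have "h t \<le> A * (t / s) ^ g * h s" using assms by (intro h_power_law) auto
  also have "\<dots> \<le> A * L ^ g * h s"
    using assms A1 h_pos[of s] by (intro mult_right_mono mult_left_mono power_mono) (auto simp: field_simps)
  finally show ?thesis .
qed

lemma measure_hyp_ball_pos: "norm z < 1 \<Longrightarrow> r0 \<le> r \<Longrightarrow> 0 < measure \<mu> (hyp_ball z r)"
proof -
  assume z: "norm z < 1" and r: "r0 \<le> r"
  obtain c where c: "0 < c" "\<And>u r. norm u < 1 \<Longrightarrow> r0 \<le> r \<Longrightarrow> c * (h (1 - norm u) * (1 - norm u)) \<le> measure \<mu> (hyp_ball u r)"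
    using measure_hyp_ball_ge by blast
  have "0 < c * (h (1 - norm z) * (1 - norm z))" using c(1) z h_pos[of "1 - norm z"] by simp
  then show ?thesis using c(2)[OF z r] by linarith
qed

text \<open>Both means are compared with \<open>f\<close> on \<open>core u\<close>, which lies in
  both discs and has mass comparable to each; averaging the triangle inequality over it eliminates
  \<open>f\<close>.\<close>

lemma hyp_mean_close:
  obtains C where "1 \<le> C" "\<And>f p B u v. 1 \<le> p \<Longrightarrow> f \<in> Lp_weighted w p \<Longrightarrow> 0 < B \<Longrightarrow>
      (\<And>z. norm z < 1 \<Longrightarrow> mean_osc w p r0 f z \<le> B) \<Longrightarrow> norm u < 1 \<Longrightarrow> norm v < 1 \<Longrightarrow> hyp_dist u v \<le> b0 \<Longrightarrow>
      norm (hyp_mean w r0 f v - hyp_mean w r0 f u) \<le> C * B"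
proof -
  interpret finite_measure "\<mu>" by (rule finite_measure_weighted_area)
  obtain c where c: "0 < c" "\<And>u. norm u < 1 \<Longrightarrow> c * (h (1 - norm u) * (1 - norm u)) \<le> measure \<mu> (core u)"
    using measure_core_ge by blast
  obtain C1 where C1: "0 < C1" "\<And>u. norm u < 1 \<Longrightarrow> measure \<mu> (hyp_ball u r0) \<le> C1 * (h (1 - norm u) * (1 - norm u))"
    using measure_hyp_ball_le[OF r0_pos] by blast
  define C where "C = max 1 ((2 * C1 + 2 * C1 * (A * 2 ^ g * 2)) / c)"
  have "norm (hyp_mean w r0 f v - hyp_mean w r0 f u) \<le> C * B"
    if p: "1 \<le> p" and f: "f \<in> Lp_weighted w p" and B: "0 < B" and osc: "\<And>z. norm z < 1 \<Longrightarrow> mean_osc w p r0 f z \<le> B"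
      and u: "norm u < 1" and v: "norm v < 1" and d: "hyp_dist u v \<le> b0" for f p B u v
  proof -
    have [measurable]: "f \<in> borel_measurable \<mu>" using f by (rule Lp_measurable)
    let ?m = "measure \<mu>"
    have i: "integrable \<mu> (\<lambda>\<zeta>. norm (f \<zeta> - k))" for k
      using Lp_integrable[OF f p] finite_emeasure_space by (intro integrable_norm Bochner_Integration.integrable_diff) (auto simp: top.not_eq_extremum)
    have L1: "(LINT \<zeta>:hyp_ball x r0|\<mu>. norm (f \<zeta> - hyp_mean w r0 f x)) \<le> 2 * B * ?m (hyp_ball x r0)"
      if x: "norm x < 1" for x
      using p B x osc[OF x] f by (intro set_integral_le_of_powr[where p=p] sets_hyp_ball Lp_integrable_powr_diff set_integral_of_mean_osc measure_hyp_ball_pos) auto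
    have close: "norm (v - u) \<le> (1 - norm u) / 2" using u v d by (rule dist_le_of_hyp_dist_b0)
    have sub: "core u \<subseteq> hyp_ball u r0" "core u \<subseteq> hyp_ball v r0"
      using u v close by (intro core_subset_hyp_ball; simp)+
    have cs: "core u \<in> sets \<mu>" by (intro sets_weighted_area_Borel core_borel core_subset)
    have L2: "(LINT \<zeta>:core u|\<mu>. norm (f \<zeta> - hyp_mean w r0 f x)) \<le> 2 * B * ?m (hyp_ball x r0)"
      if x: "norm x < 1" "core u \<subseteq> hyp_ball x r0" for x
    proof -
      have "(LINT \<zeta>:core u|\<mu>. norm (f \<zeta> - hyp_mean w r0 f x)) \<le> (LINT \<zeta>:hyp_ball x r0|\<mu>. norm (f \<zeta> - hyp_mean w r0 f x))"
        unfolding set_lebesgue_integral_def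
        using cs x sets_hyp_ball i by (intro integral_mono integrable_mult_indicator) (auto split: split_indicator)
      then show ?thesis using L1[OF x(1)] by linarith
    qed
    let ?d = "norm (hyp_mean w r0 f v - hyp_mean w r0 f u)"
    have "?d * ?m (core u) = (LINT \<zeta>:core u|\<mu>. ?d)"
      using set_integral_const_add[OF cs, of "\<lambda>_. 0" ?d 0] by simp
    also have "\<dots> \<le> (LINT \<zeta>:core u|\<mu>. norm (f \<zeta> - hyp_mean w r0 f u) + norm (f \<zeta> - hyp_mean w r0 f v))"
    proof (rule set_integral_mono_integrable[OF cs])
      show "?d \<le> norm (f \<zeta> - hyp_mean w r0 f u) + norm (f \<zeta> - hyp_mean w r0 f v)" for \<zeta>
        using norm_triangle_ineq4[of "f \<zeta> - hyp_mean w r0 f u" "f \<zeta> - hyp_mean w r0 f v"] by simp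
    qed (use i in auto)
    also have "\<dots> = (LINT \<zeta>:core u|\<mu>. norm (f \<zeta> - hyp_mean w r0 f u)) + (LINT \<zeta>:core u|\<mu>. norm (f \<zeta> - hyp_mean w r0 f v))"
    proof -
      have si: "set_integrable \<mu> (core u) (\<lambda>\<zeta>. norm (f \<zeta> - k))" for k
        unfolding set_integrable_def by (intro integrable_mult_indicator cs i)
      show ?thesis by (intro set_integral_add si)
    qed
    also have "\<dots> \<le> 2 * B * ?m (hyp_ball u r0) + 2 * B * ?m (hyp_ball v r0)"
      using u v sub by (intro add_mono L2)
    also have "\<dots> \<le> 2 * B * (C1 * (h (1 - norm u) * (1 - norm u))) + 2 * B * (C1 * ((A * 2 ^ g * 2) * (h (1 - norm u) * (1 - norm u))))"
    proof (intro add_mono mult_left_mono)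
      have n: "norm u - norm v \<le> (1 - norm u) / 2" using norm_triangle_ineq3[of v u] close by linarith
      then have t: "1 - norm v \<le> 2 * (1 - norm u)" using u by argo
      have "?m (hyp_ball v r0) \<le> C1 * (h (1 - norm v) * (1 - norm v))" by (rule C1(2)[OF v])
      also have "\<dots> \<le> C1 * ((A * 2 ^ g * h (1 - norm u)) * (2 * (1 - norm u)))"
        using t u v C1(1) A1 h_pos[of "1 - norm u"] by (intro mult_left_mono mult_mono h_le_of_le) auto
      finally show "?m (hyp_ball v r0) \<le> C1 * ((A * 2 ^ g * 2) * (h (1 - norm u) * (1 - norm u)))" by (simp only: mult_ac)
    qed (use C1 u B in auto)
    also have "\<dots> = B * ((2 * C1 + 2 * C1 * (A * 2 ^ g * 2)) / c) * (c * (h (1 - norm u) * (1 - norm u)))"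
    proof -
      have "2 * B * (C1 * X) + 2 * B * (C1 * (Y * X)) = B * ((2 * C1 + 2 * C1 * Y) / c) * (c * X)" for X Y
        using c(1) by (simp add: field_simps)
      then show ?thesis .
    qed
    also have "\<dots> \<le> B * C * ?m (core u)"
      using c u B C1(1) A1 h_pos[of "1 - norm u"] by (intro mult_mono mult_left_mono) (auto simp: C_def)
    finally have "?d * ?m (core u) \<le> B * C * ?m (core u)" .
    moreover have "0 < c * (h (1 - norm u) * (1 - norm u))" using c(1) u h_pos[of "1 - norm u"] by simp
    then have "0 < ?m (core u)" using c(2)[OF u] by linarith
    ultimately show ?thesis by (simp add: mult.commute)
  qed
  moreover have "1 \<le> C" by (simp add: C_def)
  ultimately show thesis using that by blast
qed

text \<open>A chain of about \<open>hyp_dist z u / b0\<close> points on the geodesic from \<open>z\<close> to \<open>u\<close>.\<close>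

lemma hyp_mean_diff:
  obtains C where "1 \<le> C" "\<And>f p B z u. 1 \<le> p \<Longrightarrow> f \<in> Lp_weighted w p \<Longrightarrow> 0 < B \<Longrightarrow>
      (\<And>z. norm z < 1 \<Longrightarrow> mean_osc w p r0 f z \<le> B) \<Longrightarrow> norm z < 1 \<Longrightarrow> norm u < 1 \<Longrightarrow>
      norm (hyp_mean w r0 f u - hyp_mean w r0 f z) \<le> C * (1 + hyp_dist z u) * B"
proof -
  obtain C where C: "1 \<le> C" "\<And>f p B u v. 1 \<le> p \<Longrightarrow> f \<in> Lp_weighted w p \<Longrightarrow> 0 < B \<Longrightarrow>
      (\<And>z. norm z < 1 \<Longrightarrow> mean_osc w p r0 f z \<le> B) \<Longrightarrow> norm u < 1 \<Longrightarrow> norm v < 1 \<Longrightarrow> hyp_dist u v \<le> b0 \<Longrightarrow>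
      norm (hyp_mean w r0 f v - hyp_mean w r0 f u) \<le> C * B"
    using hyp_mean_close by blast
  \<comment> \<open>The number of links is at most 1 + hyp_dist z u / b0.\<close>
  define C' where "C' = C * max 1 (1 / b0)"
  have "norm (hyp_mean w r0 f u - hyp_mean w r0 f z) \<le> C' * (1 + hyp_dist z u) * B"
    if p: "1 \<le> p" and f: "f \<in> Lp_weighted w p" and B: "0 < B" and osc: "\<And>z. norm z < 1 \<Longrightarrow> mean_osc w p r0 f z \<le> B"
      and z: "norm z < 1" and u: "norm u < 1" for f p B z u
  proof -
    have chain: "norm u < 1 \<Longrightarrow> hyp_dist z u \<le> real (Suc n) * b0 \<Longrightarrow> norm (hyp_mean w r0 f u - hyp_mean w r0 f z) \<le> real (Suc n) * (C * B)" for n u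
    proof (induction n arbitrary: u)
      case 0
      then show ?case using C(2)[OF p f B osc z] by simp
    next
      case (Suc n)
      have "hyp_dist z u \<le> real (Suc n) * b0 + b0" using Suc.prems by (simp add: algebra_simps)
      then obtain v where v: "norm v < 1" "hyp_dist z v \<le> real (Suc n) * b0" "hyp_dist v u \<le> b0"
        using b0_pos hyp_dist_intermediate[OF z Suc.prems(1), of "real (Suc n) * b0" b0] by auto
      have "norm (hyp_mean w r0 f u - hyp_mean w r0 f z) \<le> norm (hyp_mean w r0 f u - hyp_mean w r0 f v) + norm (hyp_mean w r0 f v - hyp_mean w r0 f z)"
        using norm_triangle_ineq[of "hyp_mean w r0 f u - hyp_mean w r0 f v" "hyp_mean w r0 f v - hyp_mean w r0 f z"] by simp
      also have "\<dots> \<le> C * B + real (Suc n) * (C * B)"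
        by (intro add_mono Suc.IH v C(2)[OF p f B osc v(1) Suc.prems(1) v(3)])
      finally show ?case by (simp add: algebra_simps)
    qed
    define n where "n = nat \<lfloor>hyp_dist z u / b0\<rfloor>"
    have d0: "0 \<le> hyp_dist z u / b0" using hyp_dist_nonneg[OF z u] b0_pos by simp
    have n: "real n \<le> hyp_dist z u / b0" "hyp_dist z u / b0 \<le> real (Suc n)"
    proof -
      have "real n = of_int \<lfloor>hyp_dist z u / b0\<rfloor>" using d0 by (simp add: n_def)
      then show "real n \<le> hyp_dist z u / b0" "hyp_dist z u / b0 \<le> real (Suc n)"
        using floor_correct[of "hyp_dist z u / b0"] unfolding of_nat_Suc by linarith+
    qed
    then have "hyp_dist z u \<le> real (Suc n) * b0" using b0_pos by (simp add: field_simps)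
    then have "norm (hyp_mean w r0 f u - hyp_mean w r0 f z) \<le> real (Suc n) * (C * B)" using u by (intro chain)
    also have "\<dots> \<le> (max 1 (1 / b0) * (1 + hyp_dist z u)) * (C * B)"
    proof (rule mult_right_mono)
      have "real (Suc n) \<le> 1 * 1 + 1 / b0 * hyp_dist z u" using n(1) by simp
      also have "\<dots> \<le> max 1 (1 / b0) * 1 + max 1 (1 / b0) * hyp_dist z u"
        using hyp_dist_nonneg[OF z u] by (intro add_mono mult_right_mono) auto
      finally show "real (Suc n) \<le> max 1 (1 / b0) * (1 + hyp_dist z u)" by (simp add: distrib_left)
    qed (use C B in auto)
    finally show ?thesis by (simp add: C'_def mult_ac)
  qed
  moreover have "1 \<le> C'" unfolding C'_def using mult_mono[of 1 C 1 "max 1 (1 / b0)"] C(1) by simp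
  ultimately show thesis using that by blast
qed

text \<open>Splits at the mean over the disc of centre u: the first part is ordinary oscillation,
  the second is the difference of two means bounded along the chain.\<close>

lemma local_oscillation:
  obtains C where "1 \<le> C" "\<And>f p B z u. 1 \<le> p \<Longrightarrow> f \<in> Lp_weighted w p \<Longrightarrow> 0 < B \<Longrightarrow>
      (\<And>z. norm z < 1 \<Longrightarrow> mean_osc w p r0 f z \<le> B) \<Longrightarrow> norm z < 1 \<Longrightarrow> norm u < 1 \<Longrightarrow>
      (LINT \<zeta>:hyp_ball u r0|\<mu>. norm (f \<zeta> - hyp_mean w r0 f z) powr p) \<le>
        (C * (1 + hyp_dist z u) * B) powr p * measure \<mu> (hyp_ball u r0)"
proof -
  interpret finite_measure "\<mu>" by (rule finite_measure_weighted_area)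
  obtain C where C: "1 \<le> C" "\<And>f p B z u. 1 \<le> p \<Longrightarrow> f \<in> Lp_weighted w p \<Longrightarrow> 0 < B \<Longrightarrow>
      (\<And>z. norm z < 1 \<Longrightarrow> mean_osc w p r0 f z \<le> B) \<Longrightarrow> norm z < 1 \<Longrightarrow> norm u < 1 \<Longrightarrow>
      norm (hyp_mean w r0 f u - hyp_mean w r0 f z) \<le> C * (1 + hyp_dist z u) * B"
    using hyp_mean_diff by blast
  have "(LINT \<zeta>:hyp_ball u r0|\<mu>. norm (f \<zeta> - hyp_mean w r0 f z) powr p) \<le>
        (4 * C * (1 + hyp_dist z u) * B) powr p * measure \<mu> (hyp_ball u r0)"
    if p: "1 \<le> p" and f: "f \<in> Lp_weighted w p" and B: "0 < B" and osc: "\<And>z. norm z < 1 \<Longrightarrow> mean_osc w p r0 f z \<le> B"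
      and z: "norm z < 1" and u: "norm u < 1" for f p B z u
  proof -
    let ?m = "measure \<mu> (hyp_ball u r0)"
    define E where "E = C * (1 + hyp_dist z u) * B"
    have "1 * 1 \<le> C * (1 + hyp_dist z u)" using C(1) hyp_dist_nonneg[OF z u] by (intro mult_mono) auto
    then have BE: "B \<le> E" using B mult_right_mono[of 1 "C * (1 + hyp_dist z u)" B] by (simp add: E_def)
    have d: "norm (hyp_mean w r0 f u - hyp_mean w r0 f z) \<le> E" unfolding E_def using p f B osc z u by (rule C(2))
    have "(LINT \<zeta>:hyp_ball u r0|\<mu>. norm (f \<zeta> - hyp_mean w r0 f z) powr p)
       \<le> (LINT \<zeta>:hyp_ball u r0|\<mu>. 2 powr p * E powr p + 2 powr p * norm (f \<zeta> - hyp_mean w r0 f u) powr p)"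
    proof (rule set_integral_mono_integrable)
      fix \<zeta>
      have "norm (f \<zeta> - hyp_mean w r0 f z) powr p \<le> 2 powr p * (norm (f \<zeta> - hyp_mean w r0 f u) powr p + norm (hyp_mean w r0 f u - hyp_mean w r0 f z) powr p)"
        using p by (intro norm_diff_powr_le) auto
      also have "norm (hyp_mean w r0 f u - hyp_mean w r0 f z) powr p \<le> E powr p"
        using d p by (intro powr_mono2) auto
      finally show "norm (f \<zeta> - hyp_mean w r0 f z) powr p \<le> 2 powr p * E powr p + 2 powr p * norm (f \<zeta> - hyp_mean w r0 f u) powr p"
        by (simp add: algebra_simps)
    qed (auto intro!: sets_hyp_ball u Lp_integrable_powr_diff[OF f p])
    also have "\<dots> = 2 powr p * E powr p * ?m + 2 powr p * (LINT \<zeta>:hyp_ball u r0|\<mu>. norm (f \<zeta> - hyp_mean w r0 f u) powr p)"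
      by (intro set_integral_const_add sets_hyp_ball u Lp_integrable_powr_diff[OF f p])
    also have "\<dots> \<le> 2 powr p * E powr p * ?m + 2 powr p * (B powr p * ?m)"
      using u by (intro add_left_mono mult_left_mono set_integral_of_mean_osc p B osc measure_hyp_ball_pos) auto
    also have "\<dots> \<le> 2 powr p * E powr p * ?m + 2 powr p * (E powr p * ?m)"
      using B BE p by (intro add_left_mono mult_left_mono mult_right_mono powr_mono2) auto
    also have "\<dots> = 2 * (2 powr p * E powr p * ?m)" by simp
    also have "\<dots> \<le> 2 powr p * (2 powr p * E powr p * ?m)"
      using p powr_mono[of 1 p 2] by (intro mult_right_mono) auto
    also have "\<dots> = (4 * E) powr p * ?m"
      by (simp add: mult.assoc[symmetric] flip: powr_mult)
    finally show ?thesis by (simp add: E_def mult_ac)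
  qed
  moreover have "1 \<le> 4 * C" using C(1) by simp
  ultimately show thesis using that by blast
qed

end

subsection \<open>A Forelli--Rudin estimate\<close>

lemma nn_integral_powr_Icc_le:
  fixes q a b :: real
  assumes "q < -1" "0 < a" "a \<le> b"
  shows "(\<integral>\<^sup>+t. ennreal (t powr q) * indicator {a..b} t \<partial>lborel) \<le> ennreal (a powr (q + 1) / (- (q + 1)))"
proof -
  have "(\<integral>\<^sup>+t. ennreal (t powr q) * indicator {a..b} t \<partial>lborel) = ennreal (b powr (q + 1) / (q + 1) - a powr (q + 1) / (q + 1))"
  proof (rule nn_integral_FTC_Icc)
    fix t assume "t \<in> {a..b}"
    then have "0 < t" using assms by auto
    then have "((\<lambda>t. t powr (q + 1)) has_real_derivative (q + 1) * t powr (q + 1 - 1)) (at t)"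
      by (rule has_real_derivative_powr)
    from DERIV_cdivide[OF this, of "q + 1"]
    show "((\<lambda>t. t powr (q + 1) / (q + 1)) has_real_derivative t powr q) (at t)"
      using assms by simp
  qed (use assms in auto)
  also have "\<dots> \<le> ennreal (a powr (q + 1) / (- (q + 1)))"
  proof (rule ennreal_leI)
    have "b powr (q + 1) / (q + 1) \<le> 0" using assms by (simp add: divide_le_0_iff)
    then show "b powr (q + 1) / (q + 1) - a powr (q + 1) / (q + 1) \<le> a powr (q + 1) / (- (q + 1))"
      by (simp add: minus_divide_right[symmetric] del: minus_add_distrib)
  qed
  finally show ?thesis .
qed

lemma nn_integral_powr_from_0:
  fixes q b :: real
  assumes "-1 < q" "0 \<le> b"
  shows "(\<integral>\<^sup>+t. ennreal (t powr q) * indicator {0..b} t \<partial>lborel) = ennreal (b powr (q + 1) / (q + 1))"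
  using has_integral_powr_from_0[of q b] assms by (intro nn_integral_has_integral_lebesgue') auto

lemma nn_integral_symmetric_le:
  fixes F :: "real \<Rightarrow> ennreal"
  assumes [measurable]: "F \<in> borel_measurable borel"
  shows "(\<integral>\<^sup>+t. indicator {a-pi<..<a-pi+2*pi} t * F \<bar>t - a\<bar> \<partial>lborel) \<le> 2 * (\<integral>\<^sup>+t. F t * indicator {0..pi} t \<partial>lborel)"
proof -
  have "(\<integral>\<^sup>+t. indicator {a-pi<..<a-pi+2*pi} t * F \<bar>t - a\<bar> \<partial>lborel) = (\<integral>\<^sup>+t. indicator {-pi<..<pi} t * F \<bar>t\<bar> \<partial>lborel)"
    by (subst nn_integral_real_affine[where c=1 and t=a]) (auto intro!: nn_integral_cong split: split_indicator)
  also have "\<dots> \<le> (\<integral>\<^sup>+t. F t * indicator {0..pi} t + F (- t) * indicator {0..pi} (- t) \<partial>lborel)"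
    by (intro nn_integral_mono) (auto split: split_indicator)
  also have "\<dots> = (\<integral>\<^sup>+t. F t * indicator {0..pi} t \<partial>lborel) + (\<integral>\<^sup>+t. F (- t) * indicator {0..pi} (- t) \<partial>lborel)"
    by (intro nn_integral_add) auto
  also have "(\<integral>\<^sup>+t. F (- t) * indicator {0..pi} (- t) \<partial>lborel) = (\<integral>\<^sup>+t. F t * indicator {0..pi} t \<partial>lborel)"
    using nn_integral_real_affine[of "\<lambda>t. F t * indicator {0..pi} t" "-1" 0] by simp
  finally show ?thesis unfolding mult_2 .
qed

text \<open>For s < 1/2 the modulus exceeds 1/2 while 1 - s + |t| <= 9/2, whence the 9; for s >= 1/2
  the quadratic bound already allows the better constant 4.\<close>

lemma norm_one_minus_cis_ge:
  assumes "\<bar>t\<bar> \<le> pi" "0 \<le> s" "s < 1"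
  shows "((1 - s) + \<bar>t\<bar>) / 9 \<le> norm (1 - of_real s * cis t)"
proof (cases "s < 1/2")
  case True
  have "1 - s \<le> norm (1 - of_real s * cis t)"
    using norm_triangle_ineq2[of 1 "of_real s * cis t"] assms by (simp add: norm_mult)
  moreover have "(1 - s) + \<bar>t\<bar> \<le> 9 / 2"
    using assms pi_less_4 pi_approx by simp
  ultimately show ?thesis using True by simp
next
  case False
  have sq: "x\<^sup>2 + y\<^sup>2 \<ge> (x + y)\<^sup>2 / 2" for x y :: real
    using zero_le_power2[of "x - y"] by (simp add: power2_eq_square algebra_simps)
  have "(((1 - s) + \<bar>t\<bar>) / 9)\<^sup>2 \<le> ((1 - s) + \<bar>t\<bar>)\<^sup>2 / 16" by (simp add: power_divide)
  also have "\<dots> \<le> ((1 - s)\<^sup>2 + \<bar>t\<bar>\<^sup>2) / 8" using sq[of "1 - s" "\<bar>t\<bar>"] by simp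
  also have "\<dots> \<le> (1 - s)\<^sup>2 + s * t\<^sup>2 / 4"
  proof -
    have "1/2 * t\<^sup>2 \<le> s * t\<^sup>2" using False by (intro mult_right_mono) auto
    moreover have "(1 - s)\<^sup>2 / 8 \<le> (1 - s)\<^sup>2" by simp
    moreover have "\<bar>t\<bar>\<^sup>2 = t\<^sup>2" by simp
    ultimately show ?thesis unfolding add_divide_distrib by argo
  qed
  also have "\<dots> \<le> (norm (1 - of_real s * cis t))\<^sup>2" using assms by (intro norm_one_minus_cis_sq) auto
  finally show ?thesis by (rule power2_le_imp_le) simp
qed

text \<open>The modulus is comparable to (1 - s) + |t|, so the integral reduces to a power. The
  constant 324 = 2 * 81 * 2 comes from symmetry, 9^2, and -(q + 1) >= 1/2.\<close>

lemma angular_integral_le: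
  assumes s: "0 \<le> s" "s < 1" and \<epsilon>: "0 < \<epsilon>" "\<epsilon> \<le> 1/4"
  shows "(\<integral>\<^sup>+t. indicator {a-pi<..<a-pi+2*pi} t * ennreal (norm (1 - of_real s * cis (t - a)) powr (-2 + 2 * \<epsilon>)) \<partial>lborel)
     \<le> ennreal (324 * (1 - s) powr (-1 + 2 * \<epsilon>))"
proof -
  define q where "q = -2 + 2 * \<epsilon>"
  have q: "q < -1" "-2 \<le> q" "1/2 \<le> - (q + 1)" using \<epsilon> by (auto simp: q_def)
  let ?x = "1 - s"
  have x: "0 < ?x" using s by simp
  have pt: "norm (1 - of_real s * cis t) powr q \<le> 81 * (?x + \<bar>t\<bar>) powr q" if "\<bar>t\<bar> \<le> pi" for t
  proof -
    have "norm (1 - of_real s * cis t) powr q \<le> ((?x + \<bar>t\<bar>) / 9) powr q"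
      using norm_one_minus_cis_ge[OF that s] x q by (intro powr_mono2') auto
    also have "\<dots> = (?x + \<bar>t\<bar>) powr q * 9 powr (- q)"
    proof -
      have "((?x + \<bar>t\<bar>) / 9) powr q = (?x + \<bar>t\<bar>) powr q / 9 powr q" by (simp add: powr_divide)
      moreover have "(9::real) powr (- q) = 1 / 9 powr q" by (rule powr_minus_divide)
      ultimately show ?thesis by simp
    qed
    also have "\<dots> \<le> (?x + \<bar>t\<bar>) powr q * 9 powr 2" using q by (intro mult_left_mono powr_mono) auto
    finally show ?thesis by (simp add: mult.commute)
  qed
  have "(\<integral>\<^sup>+t. indicator {a-pi<..<a-pi+2*pi} t * ennreal (norm (1 - of_real s * cis (t - a)) powr q) \<partial>lborel)
    \<le> (\<integral>\<^sup>+t. indicator {a-pi<..<a-pi+2*pi} t * ennreal (81 * (?x + \<bar>t - a\<bar>) powr q) \<partial>lborel)"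
    using pt by (intro nn_integral_mono) (auto intro!: ennreal_leI split: split_indicator)
  also have "\<dots> \<le> 2 * (\<integral>\<^sup>+t. ennreal (81 * (?x + t) powr q) * indicator {0..pi} t \<partial>lborel)"
    by (rule nn_integral_symmetric_le[of "\<lambda>t. ennreal (81 * (?x + t) powr q)"]) simp
  also have "(\<integral>\<^sup>+t. ennreal (81 * (?x + t) powr q) * indicator {0..pi} t \<partial>lborel) = ennreal 81 * (\<integral>\<^sup>+t. ennreal ((?x + t) powr q) * indicator {0..pi} t \<partial>lborel)"
    by (subst nn_integral_cmult[symmetric]) (auto intro!: nn_integral_cong simp: ennreal_mult mult.assoc)
  also have "(\<integral>\<^sup>+t. ennreal ((?x + t) powr q) * indicator {0..pi} t \<partial>lborel) = (\<integral>\<^sup>+t. ennreal (t powr q) * indicator {?x..?x+pi} t \<partial>lborel)"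
  proof -
    have "indicator {?x..?x+pi} (?x + t) = (indicator {0..pi} t :: ennreal)" for t
      by (simp split: split_indicator)
    then show ?thesis
      using nn_integral_real_affine[of "\<lambda>t. ennreal (t powr q) * indicator {?x..?x+pi} t" 1 ?x] by simp
  qed
  also have "\<dots> \<le> ennreal (?x powr (q + 1) / (- (q + 1)))"
    using q x pi_ge_zero by (intro nn_integral_powr_Icc_le) auto
  also have "\<dots> \<le> ennreal (2 * ?x powr (q + 1))"
  proof (rule ennreal_leI)
    have "?x powr (q + 1) / (- (q + 1)) \<le> ?x powr (q + 1) / (1/2)" using q by (intro divide_left_mono) auto
    then show "?x powr (q + 1) / (- (q + 1)) \<le> 2 * ?x powr (q + 1)" by simp
  qed
  finally have "(\<integral>\<^sup>+t. indicator {a-pi<..<a-pi+2*pi} t * ennreal (norm (1 - of_real s * cis (t - a)) powr q) \<partial>lborel)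
     \<le> 2 * (ennreal 81 * ennreal (2 * ?x powr (q + 1)))" by (simp add: mult_left_mono)
  also have "\<dots> = ennreal (324 * ?x powr (q + 1))"
    by (simp add: ennreal_mult[symmetric] flip: ennreal_numeral)
  also have "q + 1 = -1 + 2 * \<epsilon>" by (simp add: q_def)
  finally show ?thesis unfolding q_def .
qed

text \<open>Split at t = d: below, Y is at least d and t^(-1+\<epsilon>) is integrable at 0; above,
  Y is at least t and the exponent -2 + 3\<epsilon> is below -1 by at least 1/4.\<close>

lemma radial_integral_le:
  assumes d: "0 < d" "d \<le> 1" and \<epsilon>: "0 < \<epsilon>" "\<epsilon> \<le> 1/4"
    and Y: "\<And>t. 0 < t \<Longrightarrow> t \<le> 1 \<Longrightarrow> d \<le> Y t \<and> t \<le> Y t" and [measurable]: "Y \<in> borel_measurable borel"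
  shows "(\<integral>\<^sup>+t. ennreal (t powr (-1 + \<epsilon>) * Y t powr (-1 + 2 * \<epsilon>)) * indicator {0..1} t \<partial>lborel) \<le> ennreal ((1 / \<epsilon> + 4) * d powr (-1 + 3 * \<epsilon>))"
proof -
  have "(\<integral>\<^sup>+t. ennreal (t powr (-1 + \<epsilon>) * Y t powr (-1 + 2 * \<epsilon>)) * indicator {0..1} t \<partial>lborel)
    \<le> (\<integral>\<^sup>+t. ennreal (d powr (-1 + 2 * \<epsilon>)) * (ennreal (t powr (-1 + \<epsilon>)) * indicator {0..d} t) + ennreal (t powr (-2 + 3 * \<epsilon>)) * indicator {d..1} t \<partial>lborel)"
  proof (rule nn_integral_mono)
    fix t :: real
    show "ennreal (t powr (-1 + \<epsilon>) * Y t powr (-1 + 2 * \<epsilon>)) * indicator {0..1} t \<le>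
      ennreal (d powr (-1 + 2 * \<epsilon>)) * (ennreal (t powr (-1 + \<epsilon>)) * indicator {0..d} t) + ennreal (t powr (-2 + 3 * \<epsilon>)) * indicator {d..1} t"
    proof (cases "0 < t \<and> t \<le> 1")
      case True
      show ?thesis
      proof (cases "t \<le> d")
        case td: True
        have "Y t powr (-1 + 2 * \<epsilon>) \<le> d powr (-1 + 2 * \<epsilon>)"
          using Y[of t] True d \<epsilon> by (intro powr_mono2') auto
        then have "t powr (-1 + \<epsilon>) * Y t powr (-1 + 2 * \<epsilon>) \<le> d powr (-1 + 2 * \<epsilon>) * t powr (-1 + \<epsilon>)"
          by (simp add: mult.commute mult_left_mono)
        then have "ennreal (t powr (-1 + \<epsilon>) * Y t powr (-1 + 2 * \<epsilon>)) \<le> ennreal (d powr (-1 + 2 * \<epsilon>)) * ennreal (t powr (-1 + \<epsilon>))"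
          by (subst ennreal_mult[symmetric]) (auto intro: ennreal_leI)
        then show ?thesis using True td by (auto simp: add_increasing2)
      next
        case False
        have "Y t powr (-1 + 2 * \<epsilon>) \<le> t powr (-1 + 2 * \<epsilon>)"
          using Y[of t] True d \<epsilon> by (intro powr_mono2') auto
        then have "t powr (-1 + \<epsilon>) * Y t powr (-1 + 2 * \<epsilon>) \<le> t powr (-1 + \<epsilon>) * t powr (-1 + 2 * \<epsilon>)"
          by (intro mult_left_mono) auto
        also have "\<dots> = t powr (-2 + 3 * \<epsilon>)" by (simp add: powr_add[symmetric])
        finally have "ennreal (t powr (-1 + \<epsilon>) * Y t powr (-1 + 2 * \<epsilon>)) \<le> ennreal (t powr (-2 + 3 * \<epsilon>))" by (rule ennreal_leI)
        then show ?thesis using True False by auto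
      qed
    next
      case False
      then show ?thesis by (cases "t = 0") auto
    qed
  qed
  also have "\<dots> = ennreal (d powr (-1 + 2 * \<epsilon>)) * (\<integral>\<^sup>+t. ennreal (t powr (-1 + \<epsilon>)) * indicator {0..d} t \<partial>lborel) + (\<integral>\<^sup>+t. ennreal (t powr (-2 + 3 * \<epsilon>)) * indicator {d..1} t \<partial>lborel)"
    by (subst nn_integral_add) (auto simp: nn_integral_cmult)
  also have "\<dots> \<le> ennreal (d powr (-1 + 2 * \<epsilon>)) * ennreal (d powr \<epsilon> / \<epsilon>) + ennreal (4 * d powr (-1 + 3 * \<epsilon>))"
  proof (intro add_mono mult_left_mono)
    show "(\<integral>\<^sup>+t. ennreal (t powr (-1 + \<epsilon>)) * indicator {0..d} t \<partial>lborel) \<le> ennreal (d powr \<epsilon> / \<epsilon>)"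
      using nn_integral_powr_from_0[of "-1 + \<epsilon>" d] d \<epsilon> by simp
    have "(\<integral>\<^sup>+t. ennreal (t powr (-2 + 3 * \<epsilon>)) * indicator {d..1} t \<partial>lborel) \<le> ennreal (d powr ((-2 + 3 * \<epsilon>) + 1) / (- ((-2 + 3 * \<epsilon>) + 1)))"
      using d \<epsilon> by (intro nn_integral_powr_Icc_le) auto
    also have "\<dots> \<le> ennreal (4 * d powr (-1 + 3 * \<epsilon>))"
    proof (rule ennreal_leI)
      have "d powr (-1 + 3 * \<epsilon>) / (1 - 3 * \<epsilon>) \<le> d powr (-1 + 3 * \<epsilon>) / (1/4)"
        using \<epsilon> by (intro divide_left_mono) auto
      then show "d powr ((-2 + 3 * \<epsilon>) + 1) / (- ((-2 + 3 * \<epsilon>) + 1)) \<le> 4 * d powr (-1 + 3 * \<epsilon>)" by simp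
    qed
    finally show "(\<integral>\<^sup>+t. ennreal (t powr (-2 + 3 * \<epsilon>)) * indicator {d..1} t \<partial>lborel) \<le> ennreal (4 * d powr (-1 + 3 * \<epsilon>))" .
  qed simp
  also have "\<dots> = ennreal (d powr (-1 + 2 * \<epsilon>) * (d powr \<epsilon> / \<epsilon>) + 4 * d powr (-1 + 3 * \<epsilon>))"
  proof -
    have "ennreal (d powr (-1 + 2 * \<epsilon>)) * ennreal (d powr \<epsilon> / \<epsilon>) = ennreal (d powr (-1 + 2 * \<epsilon>) * (d powr \<epsilon> / \<epsilon>))"
      using \<epsilon> by (intro ennreal_mult[symmetric]) auto
    then show ?thesis using \<epsilon> by (simp only:) (intro ennreal_plus[symmetric]; simp)
  qed
  also have "d powr (-1 + 2 * \<epsilon>) * (d powr \<epsilon> / \<epsilon>) = 1 / \<epsilon> * d powr (-1 + 3 * \<epsilon>)"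
    by (simp add: powr_add[symmetric])
  finally show ?thesis by (simp add: distrib_right)
qed

text \<open>The exponents are those left over in the kernel estimate. The exponent 3\<epsilon> on
  the right cancels the loss (1 - |z|)^(-3\<epsilon>) there, leaving exactly 1 / (1 - |z|).\<close>

theorem Forelli_Rudin:
  assumes \<epsilon>: "0 < \<epsilon>" "\<epsilon> \<le> 1/4" and z: "norm z < 1"
  shows "(\<integral>\<^sup>+u. indicator unit_disc u * ennreal ((1 - norm u) powr (-1 + \<epsilon>) * norm (1 - cnj z * u) powr (-2 + 2 * \<epsilon>)) \<partial>lborel)
    \<le> ennreal (324 * (1 / \<epsilon> + 4) * (1 - norm z) powr (-1 + 3 * \<epsilon>))"
proof -
  obtain a where a: "z = of_real (norm z) * cis a" using polar_form by blast
  let ?d = "1 - norm z"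
  have [measurable]: "unit_disc \<in> sets borel" by simp
  define Q where "Q r t = norm (1 - of_real (norm z * r) * cis (t - a)) powr (-2 + 2 * \<epsilon>)" for r t
  have "(\<integral>\<^sup>+u. indicator unit_disc u * ennreal ((1 - norm u) powr (-1 + \<epsilon>) * norm (1 - cnj z * u) powr (-2 + 2 * \<epsilon>)) \<partial>lborel)
    = (\<integral>\<^sup>+t. indicator {a-pi<..<a-pi+2*pi} t * (\<integral>\<^sup>+r. indicator {0<..} r * ennreal r * (indicator unit_disc (of_real r * cis t) * ennreal ((1 - norm (of_real r * cis t)) powr (-1 + \<epsilon>) * norm (1 - cnj z * (of_real r * cis t)) powr (-2 + 2 * \<epsilon>))) \<partial>lborel) \<partial>lborel)"
    by (rule nn_integral_polar) measurable
  also have "\<dots> \<le> (\<integral>\<^sup>+t. \<integral>\<^sup>+r. indicator {a-pi<..<a-pi+2*pi} t * (indicator {0..1} (1 - r) * ennreal ((1 - r) powr (-1 + \<epsilon>)) * ennreal (Q r t)) \<partial>lborel \<partial>lborel)"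
  proof (rule nn_integral_mono)
    fix t :: real
    have "(\<integral>\<^sup>+r. indicator {0<..} r * ennreal r * (indicator unit_disc (of_real r * cis t) * ennreal ((1 - norm (of_real r * cis t)) powr (-1 + \<epsilon>) * norm (1 - cnj z * (of_real r * cis t)) powr (-2 + 2 * \<epsilon>))) \<partial>lborel)
      \<le> (\<integral>\<^sup>+r. indicator {0..1} (1 - r) * ennreal ((1 - r) powr (-1 + \<epsilon>)) * ennreal (Q r t) \<partial>lborel)"
    proof (rule nn_integral_mono)
      fix r :: real
      show "indicator {0<..} r * ennreal r * (indicator unit_disc (of_real r * cis t) * ennreal ((1 - norm (of_real r * cis t)) powr (-1 + \<epsilon>) * norm (1 - cnj z * (of_real r * cis t)) powr (-2 + 2 * \<epsilon>)))
        \<le> indicator {0..1} (1 - r) * ennreal ((1 - r) powr (-1 + \<epsilon>)) * ennreal (Q r t)"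
      proof (cases "0 < r \<and> r < 1")
        case True
        have eq0: "cnj z * (of_real r * cis t) = of_real (norm z * r) * cis (t - a)"
          by (subst a) (simp add: cis_cnj cis_mult mult_ac)
        have eq: "norm (1 - cnj z * (of_real r * cis t)) powr (-2 + 2 * \<epsilon>) = Q r t" unfolding Q_def eq0 ..
        have "ennreal r * ennreal ((1 - r) powr (-1 + \<epsilon>) * Q r t) \<le> 1 * ennreal ((1 - r) powr (-1 + \<epsilon>) * Q r t)"
          using True by (intro mult_right_mono) (auto simp: ennreal_le_1)
        then show ?thesis unfolding eq using True by (simp add: norm_mult ennreal_mult Q_def)
      next
        case False
        then show ?thesis by (auto simp: norm_mult split: split_indicator)
      qed
    qed
    then show "indicator {a-pi<..<a-pi+2*pi} t * (\<integral>\<^sup>+r. indicator {0<..} r * ennreal r * (indicator unit_disc (of_real r * cis t) * ennreal ((1 - norm (of_real r * cis t)) powr (-1 + \<epsilon>) * norm (1 - cnj z * (of_real r * cis t)) powr (-2 + 2 * \<epsilon>))) \<partial>lborel)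
      \<le> (\<integral>\<^sup>+r. indicator {a-pi<..<a-pi+2*pi} t * (indicator {0..1} (1 - r) * ennreal ((1 - r) powr (-1 + \<epsilon>)) * ennreal (Q r t)) \<partial>lborel)"
      by (auto split: split_indicator)
  qed
  also have "\<dots> = (\<integral>\<^sup>+r. \<integral>\<^sup>+t. indicator {a-pi<..<a-pi+2*pi} t * (indicator {0..1} (1 - r) * ennreal ((1 - r) powr (-1 + \<epsilon>)) * ennreal (Q r t)) \<partial>lborel \<partial>lborel)"
    unfolding Q_def by (rule lborel_pair.Fubini'[symmetric]) measurable
  also have "\<dots> = (\<integral>\<^sup>+r. indicator {0..1} (1 - r) * ennreal ((1 - r) powr (-1 + \<epsilon>)) * (\<integral>\<^sup>+t. indicator {a-pi<..<a-pi+2*pi} t * ennreal (Q r t) \<partial>lborel) \<partial>lborel)"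
    unfolding Q_def by (intro nn_integral_cong, subst nn_integral_cmult[symmetric]) (auto simp: mult_ac)
  also have "\<dots> \<le> (\<integral>\<^sup>+r. indicator {0..1} (1 - r) * ennreal ((1 - r) powr (-1 + \<epsilon>)) * ennreal (324 * (1 - norm z * r) powr (-1 + 2 * \<epsilon>)) \<partial>lborel)"
  proof (rule nn_integral_mono)
    fix r :: real
    show "indicator {0..1} (1 - r) * ennreal ((1 - r) powr (-1 + \<epsilon>)) * (\<integral>\<^sup>+t. indicator {a-pi<..<a-pi+2*pi} t * ennreal (Q r t) \<partial>lborel)
      \<le> indicator {0..1} (1 - r) * ennreal ((1 - r) powr (-1 + \<epsilon>)) * ennreal (324 * (1 - norm z * r) powr (-1 + 2 * \<epsilon>))"
    proof (cases "1 - r \<in> {0..1}")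
      case True
      have "norm z * r \<le> norm z * 1" using True by (intro mult_left_mono) auto
      then have "norm z * r < 1" "0 \<le> norm z * r" using z True by auto
      then show ?thesis unfolding Q_def using \<epsilon> by (intro mult_left_mono angular_integral_le) auto
    qed simp
  qed
  also have "\<dots> = (\<integral>\<^sup>+r. indicator {0..1} r * ennreal (r powr (-1 + \<epsilon>)) * ennreal (324 * (1 - norm z * (1 - r)) powr (-1 + 2 * \<epsilon>)) \<partial>lborel)"
    using nn_integral_real_affine[of "\<lambda>r. indicator {0..1} r * ennreal (r powr (-1 + \<epsilon>)) * ennreal (324 * (1 - norm z * (1 - r)) powr (-1 + 2 * \<epsilon>))" "-1" 1]
    by simp
  also have "\<dots> = ennreal 324 * (\<integral>\<^sup>+t. ennreal (t powr (-1 + \<epsilon>) * (1 - norm z * (1 - t)) powr (-1 + 2 * \<epsilon>)) * indicator {0..1} t \<partial>lborel)"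
    by (subst nn_integral_cmult[symmetric]) (auto intro!: nn_integral_cong simp: ennreal_mult mult_ac)
  also have "\<dots> \<le> ennreal 324 * ennreal ((1 / \<epsilon> + 4) * ?d powr (-1 + 3 * \<epsilon>))"
  proof (intro mult_left_mono radial_integral_le \<epsilon>)
    fix t :: real assume t: "0 < t" "t \<le> 1"
    have "norm z * (1 - t) \<le> norm z * 1" "norm z * (1 - t) \<le> 1 * (1 - t)"
      using t z by (intro mult_left_mono mult_right_mono; simp)+
    then show "?d \<le> 1 - norm z * (1 - t) \<and> t \<le> 1 - norm z * (1 - t)" by simp
  qed (use z in auto)
  also have "\<dots> = ennreal (324 * (1 / \<epsilon> + 4) * ?d powr (-1 + 3 * \<epsilon>))"
    using \<epsilon> by (simp add: ennreal_mult[symmetric] mult.assoc flip: ennreal_numeral)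
  finally show ?thesis .
qed

subsection \<open>Averaging and change of radius\<close>

lemma emeasure_ball_complex: "0 \<le> r \<Longrightarrow> emeasure lborel (ball (c::complex) r) = ennreal (pi * r\<^sup>2)"
  by (simp add: emeasure_ball unit_ball_vol_2)

context borel_weight
begin

text \<open>Indicator of |\<zeta> - u| < (1 - |u|) / 4, written through a difference so that joint
  measurability in both variables is immediate.\<close>

definition near :: "complex \<Rightarrow> complex \<Rightarrow> ennreal" where
  "near u \<zeta> = indicator {0<..} ((1 - norm u) / 4 - norm (\<zeta> - u))"

text \<open>Continuous substitute for a covering by small discs: each point is seen by a fixed
  proportion of centres u, measured by du / (1 - |u|)^2, and Tonelli exchanges the
  integrals.\<close>

lemma nn_integral_averaging:
  assumes m: "q \<in> borel_measurable \<mu>"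
  shows "(\<integral>\<^sup>+\<zeta>. q \<zeta> \<partial>\<mu>) \<le>
    27 * (\<integral>\<^sup>+u. indicator unit_disc u * (ennreal (1 / (1 - norm u)\<^sup>2) * (\<integral>\<^sup>+\<zeta>. q \<zeta> * near u \<zeta> \<partial>\<mu>)) \<partial>lborel)"
proof -
  interpret finite_measure "\<mu>" by (rule finite_measure_weighted_area)
  interpret P: pair_sigma_finite "\<mu>" "lborel :: complex measure" ..
  have [measurable]: "unit_disc \<in> sets borel" by simp
  have [measurable]: "(\<lambda>p. q (fst p)) \<in> borel_measurable (\<mu> \<Otimes>\<^sub>M (lborel :: complex measure))"
    by (rule measurable_compose[OF measurable_fst m])
  have [measurable]: "(\<lambda>p. fst p) \<in> borel_measurable (\<mu> \<Otimes>\<^sub>M (lborel :: complex measure))"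
    by (rule measurable_compose[OF measurable_fst measurable_ident_weighted_area])
  let ?k = "\<lambda>u. indicator unit_disc u * ennreal (1 / (1 - norm u)\<^sup>2) :: ennreal"
  have near_m: "(\<lambda>u. near u \<zeta>) \<in> borel_measurable borel" for \<zeta>
    unfolding near_def by measurable
  have near_m': "(\<lambda>\<zeta>. near u \<zeta>) \<in> borel_measurable \<mu>" for u
    by (rule measurable_weighted_area) (simp add: near_def)
  have kernel: "1 \<le> 27 * (\<integral>\<^sup>+u. ?k u * near u \<zeta> \<partial>lborel)" if \<zeta>: "\<zeta> \<in> unit_disc" for \<zeta>
  proof -
    define t where "t = 1 - norm \<zeta>"
    have t: "0 < t" using \<zeta> by (simp add: t_def)
    \<comment> \<open>For |\<zeta> - u| < t/8 the distance 1 - |u| lies between 7t/8 and 9t/8, and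
      t/8 is below a quarter of 7t/8. The ball has area pi t^2 / 64, so the integral is at least
      pi/81, and 27 pi / 81 > 1.\<close>
    have "ennreal (64 / 81 / t\<^sup>2) * indicator (ball \<zeta> (t / 8)) u \<le> ?k u * near u \<zeta>" for u
    proof (cases "u \<in> ball \<zeta> (t / 8)")
      case True
      then have d: "norm (\<zeta> - u) < t / 8" by (simp add: dist_norm)
      have n: "\<bar>norm \<zeta> - norm u\<bar> < t / 8" using d norm_triangle_ineq3[of \<zeta> u] by linarith
      then have b: "7 * t / 8 \<le> 1 - norm u" "1 - norm u \<le> 9 * t / 8" unfolding t_def abs_less_iff by argo+
      then have u: "norm u < 1" using t by argo
      have "norm (\<zeta> - u) < (1 - norm u) / 4" using d b t by argo
      then have "near u \<zeta> = 1" by (simp add: near_def)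
      moreover have "ennreal (64 / 81 / t\<^sup>2) \<le> ennreal (1 / (1 - norm u)\<^sup>2)"
      proof (rule ennreal_leI)
        have "1 / (9 * t / 8)\<^sup>2 \<le> 1 / (1 - norm u)\<^sup>2"
          using b u t by (intro divide_left_mono power_mono) auto
        then show "64 / 81 / t\<^sup>2 \<le> 1 / (1 - norm u)\<^sup>2" by (simp add: power_divide power_mult_distrib)
      qed
      ultimately show ?thesis using True u by simp
    qed simp
    then have "(\<integral>\<^sup>+u. ennreal (64 / 81 / t\<^sup>2) * indicator (ball \<zeta> (t / 8)) u \<partial>lborel) \<le> (\<integral>\<^sup>+u. ?k u * near u \<zeta> \<partial>lborel)"
      by (rule nn_integral_mono)
    also have "(\<integral>\<^sup>+u. ennreal (64 / 81 / t\<^sup>2) * indicator (ball \<zeta> (t / 8)) u \<partial>lborel) = ennreal (64 / 81 / t\<^sup>2) * ennreal (pi * (t / 8)\<^sup>2)"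
      using t by (subst nn_integral_cmult_indicator) (simp_all add: emeasure_ball_complex)
    also have "\<dots> = ennreal (pi / 81)"
      using t by (simp add: ennreal_mult[symmetric] power_divide)
    finally have "ennreal 27 * ennreal (pi / 81) \<le> ennreal 27 * (\<integral>\<^sup>+u. ?k u * near u \<zeta> \<partial>lborel)" by (rule mult_left_mono) simp
    moreover have "1 \<le> ennreal 27 * ennreal (pi / 81)"
    proof -
      have "ennreal 1 \<le> ennreal (27 * (pi / 81))" using pi_gt3 by (intro ennreal_leI) simp
      also have "ennreal (27 * (pi / 81)) = ennreal 27 * ennreal (pi / 81)" by (rule ennreal_mult) auto
      finally show ?thesis by (simp only: ennreal_1)
    qed
    ultimately show ?thesis by simp
  qed
  have "(\<integral>\<^sup>+\<zeta>. q \<zeta> \<partial>\<mu>) \<le> (\<integral>\<^sup>+\<zeta>. 27 * (\<integral>\<^sup>+u. q \<zeta> * (?k u * near u \<zeta>) \<partial>lborel) \<partial>\<mu>)"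
  proof (rule nn_integral_mono)
    fix \<zeta> assume "\<zeta> \<in> space \<mu>"
    then have "q \<zeta> * 1 \<le> q \<zeta> * (27 * (\<integral>\<^sup>+u. ?k u * near u \<zeta> \<partial>lborel))"
      by (intro mult_left_mono kernel) (auto simp: space_weighted_area)
    also have "\<dots> = 27 * (\<integral>\<^sup>+u. q \<zeta> * (?k u * near u \<zeta>) \<partial>lborel)"
      using near_m by (subst nn_integral_cmult) (auto simp: mult_ac)
    finally show "q \<zeta> \<le> 27 * (\<integral>\<^sup>+u. q \<zeta> * (?k u * near u \<zeta>) \<partial>lborel)" by simp
  qed
  also have "\<dots> = 27 * (\<integral>\<^sup>+\<zeta>. (\<integral>\<^sup>+u. q \<zeta> * (?k u * near u \<zeta>) \<partial>lborel) \<partial>\<mu>)"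
  proof (rule nn_integral_cmult)
    have "(\<lambda>p. q (fst p) * (?k (snd p) * near (snd p) (fst p))) \<in> borel_measurable (\<mu> \<Otimes>\<^sub>M (lborel :: complex measure))"
      unfolding near_def by measurable
    then show "(\<lambda>\<zeta>. \<integral>\<^sup>+u. q \<zeta> * (?k u * near u \<zeta>) \<partial>lborel) \<in> borel_measurable \<mu>"
      by (intro lborel.borel_measurable_nn_integral) (simp add: split_beta')
  qed
  also have "(\<integral>\<^sup>+\<zeta>. (\<integral>\<^sup>+u. q \<zeta> * (?k u * near u \<zeta>) \<partial>lborel) \<partial>\<mu>) = (\<integral>\<^sup>+u. (\<integral>\<^sup>+\<zeta>. q \<zeta> * (?k u * near u \<zeta>) \<partial>\<mu>) \<partial>lborel)"
  proof (rule P.Fubini'[symmetric])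
    show "(\<lambda>(\<zeta>, u). q \<zeta> * (?k u * near u \<zeta>)) \<in> borel_measurable (\<mu> \<Otimes>\<^sub>M (lborel :: complex measure))"
      unfolding near_def split_beta' by measurable
  qed
  also have "\<dots> = (\<integral>\<^sup>+u. indicator unit_disc u * (ennreal (1 / (1 - norm u)\<^sup>2) * (\<integral>\<^sup>+\<zeta>. q \<zeta> * near u \<zeta> \<partial>\<mu>)) \<partial>lborel)"
  proof (rule nn_integral_cong)
    fix u
    have "(\<integral>\<^sup>+\<zeta>. q \<zeta> * (?k u * near u \<zeta>) \<partial>\<mu>) = (\<integral>\<^sup>+\<zeta>. ?k u * (q \<zeta> * near u \<zeta>) \<partial>\<mu>)"
      by (simp only: mult_ac)
    also have "\<dots> = ?k u * (\<integral>\<^sup>+\<zeta>. q \<zeta> * near u \<zeta> \<partial>\<mu>)"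
      using m near_m' by (intro nn_integral_cmult) auto
    finally show "(\<integral>\<^sup>+\<zeta>. q \<zeta> * (?k u * near u \<zeta>) \<partial>\<mu>) = indicator unit_disc u * (ennreal (1 / (1 - norm u)\<^sup>2) * (\<integral>\<^sup>+\<zeta>. q \<zeta> * near u \<zeta> \<partial>\<mu>))"
      by (simp only: mult.assoc)
  qed
  finally show ?thesis .
qed

lemma nearD:
  assumes "near u \<zeta> \<noteq> 0"
  shows "norm (\<zeta> - u) < (1 - norm u) / 4" "3 / 4 * (1 - norm u) \<le> 1 - norm \<zeta>" "1 - norm \<zeta> \<le> 5 / 4 * (1 - norm u)"
proof -
  show d: "norm (\<zeta> - u) < (1 - norm u) / 4" using assms by (auto simp: near_def indicator_def split: if_splits)
  then have "\<bar>norm \<zeta> - norm u\<bar> < (1 - norm u) / 4" using norm_triangle_ineq3[of \<zeta> u] by linarith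
  then show "3 / 4 * (1 - norm u) \<le> 1 - norm \<zeta>" "1 - norm \<zeta> \<le> 5 / 4 * (1 - norm u)" unfolding abs_less_iff by argo+
qed

lemma nn_integral_set_eq:
  fixes q :: "complex \<Rightarrow> real"
  assumes "S \<in> sets \<mu>" "integrable \<mu> q" "\<And>\<zeta>. 0 \<le> q \<zeta>"
  shows "(\<integral>\<^sup>+\<zeta>. ennreal (q \<zeta>) * indicator S \<zeta> \<partial>\<mu>) = ennreal (LINT \<zeta>:S|\<mu>. q \<zeta>)"
proof -
  have "(\<integral>\<^sup>+\<zeta>. ennreal (q \<zeta>) * indicator S \<zeta> \<partial>\<mu>) = (\<integral>\<^sup>+\<zeta>. ennreal (indicat_real S \<zeta> *\<^sub>R q \<zeta>) \<partial>\<mu>)"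
    by (intro nn_integral_cong) (auto split: split_indicator)
  also have "\<dots> = ennreal (LINT \<zeta>:S|\<mu>. q \<zeta>)"
    unfolding set_lebesgue_integral_def using assms
    by (intro nn_integral_eq_integral integrable_mult_indicator) auto
  finally show ?thesis .
qed

lemma BMO_seminorm_le: "(\<And>z. norm z < 1 \<Longrightarrow> mean_osc w p r f z \<le> B) \<Longrightarrow> BMO_seminorm w p r f \<le> ennreal B"
  unfolding BMO_seminorm_def by (intro SUP_least ennreal_leI) auto

lemma mean_osc_le_of_seminorm:
  assumes "BMO_seminorm w p r f \<le> ennreal B" "0 \<le> B" "norm z < 1"
  shows "mean_osc w p r f z \<le> B"
proof -
  have "ennreal (mean_osc w p r f z) \<le> BMO_seminorm w p r f"
    unfolding BMO_seminorm_def using assms by (intro SUP_upper) auto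
  then show ?thesis using assms by (metis ennreal_le_iff order_trans)
qed

end

context regular_weight
begin

lemma near_imp_hyp_ball:
  assumes "norm u < 1" "norm \<zeta> < 1" "near u \<zeta> \<noteq> 0"
  shows "\<zeta> \<in> hyp_ball u r0"
proof (rule in_hyp_ball_r0[OF assms(1,2)])
  show "norm (\<zeta> - u) \<le> 5 * (1 - norm u)" using nearD(1)[OF assms(3)] assms(1) by argo
  have "1 - norm u \<le> 4 / 3 * (1 - norm \<zeta>)" using nearD(2)[OF assms(3)] by argo
  also have "\<dots> \<le> 3 * Kd * (1 - norm \<zeta>)" using Kd_ge assms(2) by (intro mult_right_mono) auto
  finally show "1 - norm u \<le> 3 * Kd * (1 - norm \<zeta>)" .
qed

text \<open>The easy direction: the smaller disc lies in the larger one and their masses are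
  comparable.\<close>

lemma mean_osc_r0_le:
  assumes r: "r0 \<le> r"
  obtains C where "1 \<le> C" "\<And>f p B z. 1 \<le> p \<Longrightarrow> f \<in> Lp_weighted w p \<Longrightarrow> 0 < B \<Longrightarrow>
      (\<And>z. norm z < 1 \<Longrightarrow> mean_osc w p r f z \<le> B) \<Longrightarrow> norm z < 1 \<Longrightarrow> mean_osc w p r0 f z \<le> C * B"
proof -
  interpret finite_measure "\<mu>" by (rule finite_measure_weighted_area)
  obtain c where c: "0 < c" "\<And>u r. norm u < 1 \<Longrightarrow> r0 \<le> r \<Longrightarrow> c * (h (1 - norm u) * (1 - norm u)) \<le> measure \<mu> (hyp_ball u r)"
    using measure_hyp_ball_ge by blast
  have "0 < r" using r r0_pos by simp
  then obtain C1 where C1: "0 < C1" "\<And>u. norm u < 1 \<Longrightarrow> measure \<mu> (hyp_ball u r) \<le> C1 * (h (1 - norm u) * (1 - norm u))"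
    using measure_hyp_ball_le by blast
  define K where "K = max 1 (C1 / c)"
  have K: "1 \<le> K" by (simp add: K_def)
  have cmp: "measure \<mu> (hyp_ball z r) \<le> K * measure \<mu> (hyp_ball z r0)" if z: "norm z < 1" for z
  proof -
    have "measure \<mu> (hyp_ball z r) \<le> C1 / c * (c * (h (1 - norm z) * (1 - norm z)))" using C1(2)[OF z] c(1) by simp
    also have "\<dots> \<le> C1 / c * measure \<mu> (hyp_ball z r0)" using c C1(1) z by (intro mult_left_mono) auto
    also have "\<dots> \<le> K * measure \<mu> (hyp_ball z r0)" by (intro mult_right_mono) (auto simp: K_def)
    finally show ?thesis .
  qed
  have "mean_osc w p r0 f z \<le> (8 * K) * B"
    if p: "1 \<le> p" and f: "f \<in> Lp_weighted w p" and B: "0 < B" and osc: "\<And>z. norm z < 1 \<Longrightarrow> mean_osc w p r f z \<le> B"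
      and z: "norm z < 1" for f p B z
  proof -
    let ?F = "hyp_mean w r f z"
    have "(LINT \<zeta>:hyp_ball z r0|\<mu>. norm (f \<zeta> - ?F) powr p) \<le> (LINT \<zeta>:hyp_ball z r|\<mu>. norm (f \<zeta> - ?F) powr p)"
      unfolding set_lebesgue_integral_def
      using sets_hyp_ball[OF z] Lp_integrable_powr_diff[OF f p] hyp_ball_mono[OF r, of z]
      by (intro integral_mono integrable_mult_indicator) (auto split: split_indicator)
    also have "\<dots> \<le> B powr p * measure \<mu> (hyp_ball z r)"
      using p z r B osc by (intro set_integral_of_mean_osc measure_hyp_ball_pos) auto
    also have "\<dots> \<le> B powr p * (K * measure \<mu> (hyp_ball z r0))"
      using z by (intro mult_left_mono cmp) auto
    also have "\<dots> \<le> B powr p * (K powr p * measure \<mu> (hyp_ball z r0))"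
      using K p powr_mono[of 1 p K] by (intro mult_left_mono mult_right_mono) auto
    also have "\<dots> = (K * B) powr p * measure \<mu> (hyp_ball z r0)"
      by (simp add: powr_mult mult_ac)
    finally have "mean_osc w p r0 f z \<le> 8 * (K * B)"
      using K B p f z by (intro mean_osc_le measure_hyp_ball_pos) auto
    then show ?thesis by simp
  qed
  moreover have "1 \<le> 8 * K" using K by simp
  ultimately show thesis using that by blast
qed

text \<open>The averaging inequality distributes the large disc over discs of radius
  \<open>r0\<close> with nearby centres. Their hyperbolic distance from z is bounded, so the
  oscillation about the mean at z is bounded on each of them.\<close>

lemma mean_osc_r_le:
  assumes r: "r0 \<le> r"
  obtains C where "1 \<le> C" "\<And>f p B z. 1 \<le> p \<Longrightarrow> f \<in> Lp_weighted w p \<Longrightarrow> 0 < B \<Longrightarrow>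
      (\<And>z. norm z < 1 \<Longrightarrow> mean_osc w p r0 f z \<le> B) \<Longrightarrow> norm z < 1 \<Longrightarrow> mean_osc w p r f z \<le> C * B"
proof -
  interpret finite_measure "\<mu>" by (rule finite_measure_weighted_area)
  obtain c where c: "0 < c" "\<And>u r. norm u < 1 \<Longrightarrow> r0 \<le> r \<Longrightarrow> c * (h (1 - norm u) * (1 - norm u)) \<le> measure \<mu> (hyp_ball u r)"
    using measure_hyp_ball_ge by blast
  obtain C1 where C1: "0 < C1" "\<And>u. norm u < 1 \<Longrightarrow> measure \<mu> (hyp_ball u r0) \<le> C1 * (h (1 - norm u) * (1 - norm u))"
    using measure_hyp_ball_le[OF r0_pos] by blast
  obtain C2 where C2: "1 \<le> C2" "\<And>f p B z u. 1 \<le> p \<Longrightarrow> f \<in> Lp_weighted w p \<Longrightarrow> 0 < B \<Longrightarrow>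
      (\<And>z. norm z < 1 \<Longrightarrow> mean_osc w p r0 f z \<le> B) \<Longrightarrow> norm z < 1 \<Longrightarrow> norm u < 1 \<Longrightarrow>
      (LINT \<zeta>:hyp_ball u r0|\<mu>. norm (f \<zeta> - hyp_mean w r0 f z) powr p) \<le>
        (C2 * (1 + hyp_dist z u) * B) powr p * measure \<mu> (hyp_ball u r0)"
    using local_oscillation by blast
  \<comment> \<open>Exponent 1 suffices here, as only boundedness of the distance is needed, not a
    small power.\<close>
  obtain C3 where C3: "0 < C3" "\<And>z u. norm z < 1 \<Longrightarrow> norm u < 1 \<Longrightarrow>
      1 + hyp_dist z u \<le> C3 * ((norm (1 - cnj z * u))\<^sup>2 / ((1 - norm z) * (1 - norm u))) powr 1"
    using one_plus_hyp_dist_le[of 1] by auto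
  define s where "s = tanh r"
  have rp: "0 < r" using r r0_pos by simp
  have s: "0 < s" "s < 1" using rp by (auto simp: s_def tanh_real_lt_1)
  define L where "L = 2 * s / (1 - s)"
  have L: "0 \<le> L" using s by (simp add: L_def)
  define M where "M = 2 * (1 + L)"
  have M: "2 \<le> M" using L by (simp add: M_def)
  define H where "H = C3 * ((2 + M)\<^sup>2 * M)"
  have H: "0 \<le> H" using C3 M by (simp add: H_def)
  have geo: "norm (u - z) \<le> M * (1 - norm z) \<and> 1 - norm u \<le> M * (1 - norm z) \<and> 1 - norm z \<le> M * (1 - norm u) \<and> 1 + hyp_dist z u \<le> H"
    if z: "norm z < 1" and u: "norm u < 1" and \<zeta>: "\<zeta> \<in> hyp_ball z r" and n: "near u \<zeta> \<noteq> 0" for z u \<zeta>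
  proof -
    have \<zeta>': "norm \<zeta> < 1" "norm (disc_aut z \<zeta>) < s" using \<zeta> z by (auto simp: hyp_ball_eq s_def)
    have d1: "norm (\<zeta> - z) \<le> L * (1 - norm z)"
      unfolding L_def using z \<zeta>' s by (intro dist_le_of_norm_disc_aut) auto
    have d2: "norm (z - \<zeta>) \<le> L * (1 - norm \<zeta>)"
      unfolding L_def using z \<zeta>' s by (intro dist_le_of_norm_disc_aut) (auto simp: norm_disc_aut_commute[of \<zeta> z])
    have e1: "1 - norm \<zeta> \<le> (1 + L) * (1 - norm z)"
      using d1 norm_triangle_ineq2[of z \<zeta>] by (simp add: norm_minus_commute algebra_simps)
    have e2: "1 - norm z \<le> (1 + L) * (1 - norm \<zeta>)"
      using d2 norm_triangle_ineq2[of \<zeta> z] by (simp add: norm_minus_commute algebra_simps)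
    note nD = nearD[OF n]
    have a1: "1 - norm u \<le> M * (1 - norm z)"
    proof -
      have "1 - norm u \<le> 4 / 3 * (1 - norm \<zeta>)" using nD(2) by argo
      also have "\<dots> \<le> 4 / 3 * ((1 + L) * (1 - norm z))" using e1 by (intro mult_left_mono) auto
      also have "\<dots> \<le> 2 * ((1 + L) * (1 - norm z))" using L z by (intro mult_right_mono) auto
      finally show ?thesis by (simp only: M_def mult.assoc)
    qed
    have a2: "1 - norm z \<le> M * (1 - norm u)"
    proof -
      have "1 - norm z \<le> (1 + L) * (5 / 4 * (1 - norm u))"
        by (rule order_trans[OF e2]) (intro mult_left_mono nD(3), use L in simp)
      also have "\<dots> = 5 / 4 * ((1 + L) * (1 - norm u))" by simp
      also have "\<dots> \<le> 2 * ((1 + L) * (1 - norm u))" using L u by (intro mult_right_mono) auto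
      finally show ?thesis by (simp only: M_def mult.assoc)
    qed
    have a3: "norm (u - z) \<le> M * (1 - norm z)"
    proof -
      have "norm (u - z) \<le> norm (\<zeta> - u) + norm (\<zeta> - z)" using norm_triangle_ineq4[of "\<zeta> - z" "\<zeta> - u"] by simp
      also have "\<dots> \<le> (1 - norm u) / 4 + L * (1 - norm z)" using less_imp_le[OF nD(1)] d1 by (rule add_mono)
      also have "\<dots> \<le> M * (1 - norm z) / 4 + L * (1 - norm z)" using a1 by (intro add_right_mono divide_right_mono) auto
      also have "\<dots> = (M / 4 + L) * (1 - norm z)" by (simp add: algebra_simps)
      also have "\<dots> \<le> M * (1 - norm z)" using z L by (intro mult_right_mono) (auto simp: M_def)
      finally show ?thesis .
    qed
    have Q: "norm (1 - cnj z * u) \<le> (2 + M) * (1 - norm z)"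
      using norm_one_minus_cnj_mult_le[OF z, of u] a3 by (simp add: algebra_simps)
    have "1 + hyp_dist z u \<le> C3 * ((norm (1 - cnj z * u))\<^sup>2 / ((1 - norm z) * (1 - norm u)))"
      using C3(2)[OF z u] z u by simp
    also have "\<dots> \<le> C3 * ((2 + M)\<^sup>2 * M)"
    proof (intro mult_left_mono)
      have "(norm (1 - cnj z * u))\<^sup>2 \<le> ((2 + M) * (1 - norm z))\<^sup>2" using Q by (intro power_mono) auto
      also have "\<dots> = (2 + M)\<^sup>2 * ((1 - norm z) * (1 - norm z))" by (simp add: power2_eq_square)
      also have "\<dots> \<le> (2 + M)\<^sup>2 * ((1 - norm z) * (M * (1 - norm u)))" using a2 z by (intro mult_left_mono) auto
      also have "\<dots> = (2 + M)\<^sup>2 * M * ((1 - norm z) * (1 - norm u))" by simp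
      finally show "(norm (1 - cnj z * u))\<^sup>2 / ((1 - norm z) * (1 - norm u)) \<le> (2 + M)\<^sup>2 * M"
        using z u by (subst pos_divide_le_eq) auto
    qed (use C3 in simp)
    finally show ?thesis using a1 a2 a3 by (simp add: H_def)
  qed
  \<comment> \<open>27 from averaging, pi M^2 from the area of the admissible centres, M^2 from 1 /
    (1 - |u|)^2, and the rest from the mass of the discs, divided by c. As N multiplies a p-th
    power, N' >= 1 is used to get N <= N'^p.\<close>
  define N where "N = 27 * (pi * M\<^sup>2 * M\<^sup>2 * (C1 * (A * M ^ g * M)) / c)"
  define N' where "N' = max 1 N"
  define K where "K = N' * (C2 * (H + 1))"
  have "1 * 1 \<le> C2 * (H + 1)" using C2 H by (intro mult_mono) auto
  then have CH: "1 \<le> C2 * (H + 1)" by simp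
  have N': "1 \<le> N'" by (simp add: N'_def)
  have "1 * 1 \<le> N' * (C2 * (H + 1))" using N' CH by (intro mult_mono) auto
  then have K: "1 \<le> K" by (simp add: K_def)
  have "mean_osc w p r f z \<le> (8 * K) * B"
    if p: "1 \<le> p" and f: "f \<in> Lp_weighted w p" and B: "0 < B" and osc: "\<And>z. norm z < 1 \<Longrightarrow> mean_osc w p r0 f z \<le> B"
      and z: "norm z < 1" for f p B z
  proof -
    have [measurable]: "f \<in> borel_measurable \<mu>" using f by (rule Lp_measurable)
    let ?F = "hyp_mean w r0 f z"
    let ?t = "1 - norm z"
    have t: "0 < ?t" "?t \<le> 1" using z by auto
    have ht: "0 < h ?t" using t by (intro h_pos)
    have [measurable]: "hyp_ball z r \<in> sets \<mu>" using z by (rule sets_hyp_ball)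
    define q where "q \<zeta> = ennreal (norm (f \<zeta> - ?F) powr p) * indicator (hyp_ball z r) \<zeta>" for \<zeta>
    have qm: "q \<in> borel_measurable \<mu>" unfolding q_def by measurable
    define W where "W = (C2 * (H + 1) * B) powr p * (C1 * ((A * M ^ g * h ?t) * (M * ?t)))"
    have W0: "0 \<le> W" unfolding W_def using C1 M A1 t ht by simp
    have inner: "indicator unit_disc u * (ennreal (1 / (1 - norm u)\<^sup>2) * (\<integral>\<^sup>+\<zeta>. q \<zeta> * near u \<zeta> \<partial>\<mu>))
      \<le> ennreal (M\<^sup>2 / ?t\<^sup>2 * W) * indicator (cball z (M * ?t)) u" for u
    proof (cases "norm u < 1 \<and> (\<exists>\<zeta>\<in>hyp_ball z r. near u \<zeta> \<noteq> 0)")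
      case True
      then have u: "norm u < 1" by simp
      have g1: "norm (u - z) \<le> M * ?t" "1 - norm u \<le> M * ?t" "?t \<le> M * (1 - norm u)" "1 + hyp_dist z u \<le> H"
        using True geo[OF z u] by auto
      have "(\<integral>\<^sup>+\<zeta>. q \<zeta> * near u \<zeta> \<partial>\<mu>) \<le> (\<integral>\<^sup>+\<zeta>. ennreal (norm (f \<zeta> - ?F) powr p) * indicator (hyp_ball u r0) \<zeta> \<partial>\<mu>)"
      proof (rule nn_integral_mono)
        fix \<zeta> assume "\<zeta> \<in> space \<mu>"
        then have "near u \<zeta> \<noteq> 0 \<Longrightarrow> \<zeta> \<in> hyp_ball u r0" using u by (intro near_imp_hyp_ball) (auto simp: space_weighted_area)
        moreover have "near u \<zeta> \<le> 1" by (simp add: near_def indicator_def)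
        ultimately show "q \<zeta> * near u \<zeta> \<le> ennreal (norm (f \<zeta> - ?F) powr p) * indicator (hyp_ball u r0) \<zeta>"
          by (cases "near u \<zeta> = 0") (auto simp: q_def near_def indicator_def)
      qed
      also have "\<dots> = ennreal (LINT \<zeta>:hyp_ball u r0|\<mu>. norm (f \<zeta> - ?F) powr p)"
        by (intro nn_integral_set_eq sets_hyp_ball u Lp_integrable_powr_diff f p) auto
      also have "\<dots> \<le> ennreal W"
      proof (rule ennreal_leI)
        have "(LINT \<zeta>:hyp_ball u r0|\<mu>. norm (f \<zeta> - ?F) powr p) \<le> (C2 * (1 + hyp_dist z u) * B) powr p * measure \<mu> (hyp_ball u r0)"
          using p f B osc z u by (rule C2(2))
        also have "\<dots> \<le> (C2 * (H + 1) * B) powr p * (C1 * ((A * M ^ g * h ?t) * (M * ?t)))"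
        proof (intro mult_mono powr_mono2)
          have "measure \<mu> (hyp_ball u r0) \<le> C1 * (h (1 - norm u) * (1 - norm u))" by (rule C1(2)[OF u])
          also have "\<dots> \<le> C1 * ((A * M ^ g * h ?t) * (M * ?t))"
            using g1 t u C1(1) M A1 ht by (intro mult_left_mono mult_mono h_le_of_le) auto
          finally show "measure \<mu> (hyp_ball u r0) \<le> C1 * ((A * M ^ g * h ?t) * (M * ?t))" .
        qed (use p C2 g1 B H hyp_dist_nonneg[OF z u] in auto)
        finally show "(LINT \<zeta>:hyp_ball u r0|\<mu>. norm (f \<zeta> - ?F) powr p) \<le> W" by (simp add: W_def)
      qed
      finally have I: "(\<integral>\<^sup>+\<zeta>. q \<zeta> * near u \<zeta> \<partial>\<mu>) \<le> ennreal W" .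
      have "1 / (1 - norm u)\<^sup>2 \<le> M\<^sup>2 / ?t\<^sup>2"
      proof -
        have "?t\<^sup>2 \<le> (M * (1 - norm u))\<^sup>2" using g1 t by (intro power_mono) auto
        moreover have "1 / y\<^sup>2 \<le> M\<^sup>2 / x\<^sup>2" if "x\<^sup>2 \<le> (M * y)\<^sup>2" "0 < x" "0 < y" for x y :: real
          using that by (simp add: field_simps power_mult_distrib)
        ultimately show ?thesis using t u by simp
      qed
      then have "ennreal (1 / (1 - norm u)\<^sup>2) * (\<integral>\<^sup>+\<zeta>. q \<zeta> * near u \<zeta> \<partial>\<mu>) \<le> ennreal (M\<^sup>2 / ?t\<^sup>2) * ennreal W"
        using I by (intro mult_mono ennreal_leI) auto
      also have "\<dots> = ennreal (M\<^sup>2 / ?t\<^sup>2 * W)" using W0 by (intro ennreal_mult[symmetric]) auto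
      finally show ?thesis using u g1(1) by (simp add: dist_norm norm_minus_commute)
    next
      case False
      have "indicator unit_disc u * (ennreal (1 / (1 - norm u)\<^sup>2) * (\<integral>\<^sup>+\<zeta>. q \<zeta> * near u \<zeta> \<partial>\<mu>)) = 0"
      proof (cases "norm u < 1")
        case True
        then have "q \<zeta> * near u \<zeta> = 0" for \<zeta> using False by (auto simp: q_def indicator_def)
        then have "(\<integral>\<^sup>+\<zeta>. q \<zeta> * near u \<zeta> \<partial>\<mu>) = (\<integral>\<^sup>+\<zeta>. 0 \<partial>\<mu>)"
          by (intro nn_integral_cong)
        then show ?thesis by simp
      qed simp
      then show ?thesis by (simp only: zero_le)
    qed
    have "ennreal (LINT \<zeta>:hyp_ball z r|\<mu>. norm (f \<zeta> - ?F) powr p) = (\<integral>\<^sup>+\<zeta>. q \<zeta> \<partial>\<mu>)"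
      unfolding q_def by (intro nn_integral_set_eq[symmetric] sets_hyp_ball z Lp_integrable_powr_diff f p) auto
    also have "\<dots> \<le> 27 * (\<integral>\<^sup>+u. indicator unit_disc u * (ennreal (1 / (1 - norm u)\<^sup>2) * (\<integral>\<^sup>+\<zeta>. q \<zeta> * near u \<zeta> \<partial>\<mu>)) \<partial>lborel)"
      using qm by (rule nn_integral_averaging)
    also have "\<dots> \<le> 27 * (\<integral>\<^sup>+u. ennreal (M\<^sup>2 / ?t\<^sup>2 * W) * indicator (cball z (M * ?t)) u \<partial>lborel)"
      by (intro mult_left_mono nn_integral_mono inner) auto
    also have "(\<integral>\<^sup>+u. ennreal (M\<^sup>2 / ?t\<^sup>2 * W) * indicator (cball z (M * ?t)) u \<partial>lborel) = ennreal (M\<^sup>2 / ?t\<^sup>2 * W) * ennreal (pi * (M * ?t)\<^sup>2)"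
      using M t by (subst nn_integral_cmult_indicator) (simp_all add: emeasure_cball unit_ball_vol_2)
    also have "27 * (ennreal (M\<^sup>2 / ?t\<^sup>2 * W) * ennreal (pi * (M * ?t)\<^sup>2)) = ennreal (27 * (M\<^sup>2 / ?t\<^sup>2 * W * (pi * (M * ?t)\<^sup>2)))"
      using W0 by (simp add: ennreal_mult[symmetric] flip: ennreal_numeral)
    also have "27 * (M\<^sup>2 / ?t\<^sup>2 * W * (pi * (M * ?t)\<^sup>2)) = 27 * (pi * M\<^sup>2 * M\<^sup>2) * W"
    proof -
      have gen: "27 * (x / y\<^sup>2 * W * (pi * (x * y\<^sup>2))) = 27 * (pi * x * x) * W" if "y \<noteq> 0" for x y :: real
        using that by simp
      show ?thesis unfolding power_mult_distrib by (rule gen) (use t in simp)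
    qed
    also have "\<dots> = N * (C2 * (H + 1) * B) powr p * (c * (h ?t * ?t))"
      using c(1) by (simp add: N_def W_def)
    finally have "(LINT \<zeta>:hyp_ball z r|\<mu>. norm (f \<zeta> - ?F) powr p) \<le> N * (C2 * (H + 1) * B) powr p * (c * (h ?t * ?t))"
      using c(1) t ht C1(1) M A1 by (subst (asm) ennreal_le_iff) (auto simp: N_def)
    also have "\<dots> \<le> (N' * (C2 * (H + 1) * B)) powr p * measure \<mu> (hyp_ball z r)"
    proof (intro mult_mono c(2) z r)
      have "N \<le> N' powr p" using N' p powr_mono[of 1 p N'] by (simp add: N'_def)
      then show "N * (C2 * (H + 1) * B) powr p \<le> (N' * (C2 * (H + 1) * B)) powr p"
        unfolding powr_mult[of N'] by (intro mult_right_mono) auto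
    qed (use c(1) t ht in auto)
    finally have "(LINT \<zeta>:hyp_ball z r|\<mu>. norm (f \<zeta> - ?F) powr p) \<le> (K * B) powr p * measure \<mu> (hyp_ball z r)"
      by (simp add: K_def mult_ac)
    then have "mean_osc w p r f z \<le> 8 * (K * B)"
      using K B p f z r by (intro mean_osc_le measure_hyp_ball_pos) auto
    then show ?thesis by simp
  qed
  moreover have "1 \<le> 8 * K" using K by simp
  ultimately show thesis using that by blast
qed

end

subsection \<open>Boundedness on BMO\<close>

lemma Forelli_Rudin_measurable:
  "(\<lambda>u. indicator unit_disc u * ennreal ((1 - norm u) powr a * norm (1 - cnj z * u) powr b)) \<in> borel_measurable lborel"
proof -
  have [measurable]: "unit_disc \<in> sets borel" by simp
  show ?thesis by measurable
qed

text \<open>Collects the factors of the final estimate: 1/t^2 from averaging, (t/d)^(2\<epsilon>) /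
  Q^2 from the kernel, (Q^2 / (d t))^\<epsilon> from the oscillation, and t from the mass of the
  disc, whose factor h t cancels against the kernel.\<close>

lemma powr_weight_identity:
  fixes t d Q :: real
  assumes "0 < t" "0 < d" "0 < Q"
  shows "1 / t\<^sup>2 * ((t / d) powr (2 * \<epsilon>) / Q\<^sup>2) * (Q\<^sup>2 / (d * t)) powr \<epsilon> * t
    = d powr (-3 * \<epsilon>) * (t powr (-1 + \<epsilon>) * Q powr (-2 + 2 * \<epsilon>))"
proof -
  define T D' q where "T = ln t" and "D' = ln d" and "q = ln Q"
  have e: "t = exp T" "d = exp D'" "Q = exp q" using assms by (auto simp: T_def D'_def q_def)
  show ?thesis
    unfolding e by (simp add: powr_def exp_add[symmetric] exp_diff[symmetric] exp_minus[symmetric] exp_of_nat_mult[symmetric]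
      ln_div ln_mult power2_eq_square divide_inverse algebra_simps)
qed

context borel_weight
begin

text \<open>Constants are projected to constants, so a mean of \<open>f\<close> may be subtracted for free.\<close>

lemma deriv_projection_minus_const:
  assumes f: "integrable \<mu> f" and z: "norm z < 1"
  shows "deriv (bergman_projection w f) z = (LINT \<zeta>|\<mu>. (f \<zeta> - c) * (cnj \<zeta> * kernel_deriv (z * cnj \<zeta>)))"
    and "integrable \<mu> (\<lambda>\<zeta>. (f \<zeta> - c) * (cnj \<zeta> * kernel_deriv (z * cnj \<zeta>)))"
proof -
  interpret finite_measure "\<mu>" by (rule finite_measure_weighted_area)
  have ic: "integrable \<mu> (\<lambda>_. c)" by simp
  have "diffs (fcoef (\<lambda>_. c)) n = 0" for n
    using integral_cnj_power[of "Suc n"] by (simp add: diffs_def fcoef_def)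
  then have 0: "(LINT \<zeta>|\<mu>. c * (cnj \<zeta> * kernel_deriv (z * cnj \<zeta>))) = 0"
    using deriv_bergman_projection_integral(1)[OF ic z] deriv_bergman_projection[OF ic z] by simp
  note i = deriv_bergman_projection_integral(2)[OF f z] deriv_bergman_projection_integral(2)[OF ic z]
  have eq: "(\<lambda>\<zeta>. (f \<zeta> - c) * (cnj \<zeta> * kernel_deriv (z * cnj \<zeta>))) =
     (\<lambda>\<zeta>. f \<zeta> * (cnj \<zeta> * kernel_deriv (z * cnj \<zeta>)) - c * (cnj \<zeta> * kernel_deriv (z * cnj \<zeta>)))"
    by (simp add: left_diff_distrib)
  show "integrable \<mu> (\<lambda>\<zeta>. (f \<zeta> - c) * (cnj \<zeta> * kernel_deriv (z * cnj \<zeta>)))"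
    unfolding eq using i by (rule Bochner_Integration.integrable_diff)
  show "deriv (bergman_projection w f) z = (LINT \<zeta>|\<mu>. (f \<zeta> - c) * (cnj \<zeta> * kernel_deriv (z * cnj \<zeta>)))"
    unfolding eq using 0 deriv_bergman_projection_integral(1)[OF f z] Bochner_Integration.integral_diff[OF i] by simp
qed

end

context regular_weight
begin

text \<open>Subtracting the mean at z itself ties the growth of the oscillation to the same
  geometric quotient as the kernel, so a positive power of 1 - |u| survives and the integral over
  the centres converges.\<close>

lemma deriv_projection_bound:
  obtains C where "0 < C" "\<And>f p B z. 1 \<le> p \<Longrightarrow> f \<in> Lp_weighted w p \<Longrightarrow> 0 < B \<Longrightarrow>
      (\<And>z. norm z < 1 \<Longrightarrow> mean_osc w p r0 f z \<le> B) \<Longrightarrow> norm z < 1 \<Longrightarrow>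
      norm (deriv (bergman_projection w f) z) * (1 - norm z) \<le> C * B"
proof -
  interpret finite_measure "\<mu>" by (rule finite_measure_weighted_area)
  obtain Ck where Ck: "0 < Ck" "\<And>a. norm a < 1 \<Longrightarrow> norm (kernel_deriv a) \<le> Ck / (h (1 - norm a) * (norm (1 - a))\<^sup>2)"
    using kernel_deriv_bound by blast
  obtain C1 where C1: "0 < C1" "\<And>u. norm u < 1 \<Longrightarrow> measure \<mu> (hyp_ball u r0) \<le> C1 * (h (1 - norm u) * (1 - norm u))"
    using measure_hyp_ball_le[OF r0_pos] by blast
  obtain C2 where C2: "1 \<le> C2" "\<And>f p B z u. 1 \<le> p \<Longrightarrow> f \<in> Lp_weighted w p \<Longrightarrow> 0 < B \<Longrightarrow>
      (\<And>z. norm z < 1 \<Longrightarrow> mean_osc w p r0 f z \<le> B) \<Longrightarrow> norm z < 1 \<Longrightarrow> norm u < 1 \<Longrightarrow>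
      (LINT \<zeta>:hyp_ball u r0|\<mu>. norm (f \<zeta> - hyp_mean w r0 f z) powr p) \<le>
        (C2 * (1 + hyp_dist z u) * B) powr p * measure \<mu> (hyp_ball u r0)"
    using local_oscillation by blast
  \<comment> \<open>The kernel gains t^(2\<epsilon>) and the oscillation loses t^\<epsilon>, leaving
    the integrable power t^(-1+\<epsilon>); the cap on \<open>e\<close> gives \<epsilon> <=
    1/4.\<close>
  define \<epsilon> where "\<epsilon> = e / 2"
  have \<epsilon>: "0 < \<epsilon>" "\<epsilon> \<le> 1/4" "2 * \<epsilon> = e" using e0 e_half by (auto simp: \<epsilon>_def)
  obtain C3 where C3: "0 < C3" "\<And>z u. norm z < 1 \<Longrightarrow> norm u < 1 \<Longrightarrow>
      1 + hyp_dist z u \<le> C3 * ((norm (1 - cnj z * u))\<^sup>2 / ((1 - norm z) * (1 - norm u))) powr \<epsilon>"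
    using one_plus_hyp_dist_le[OF \<epsilon>(1)] by blast
  define G where "G = Ck * (16/9) * (A * 2 ^ g)"
  define K where "K = G * (2 * C2 * C3) * C1"
  have G: "0 < G" "0 < K" using Ck A1 C1 C2 C3 by (auto simp: G_def K_def)
  define C where "C = 27 * K * (324 * (1 / \<epsilon> + 4))"
  have C: "0 < C" unfolding C_def using G \<epsilon> by (intro mult_pos_pos add_pos_pos) auto
  have kd: "norm (cnj \<zeta> * kernel_deriv (z * cnj \<zeta>)) \<le>
      G / h (1 - norm u) * (((1 - norm u) / (1 - norm z)) powr e / (norm (1 - cnj z * u))\<^sup>2)"
    if z: "norm z < 1" and u: "norm u < 1" and \<zeta>: "norm \<zeta> < 1" and n: "near u \<zeta> \<noteq> 0" for z u \<zeta>
  proof -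
    define d t Q where "d = 1 - norm z" and "t = 1 - norm u" and "Q = norm (1 - cnj z * u)"
    have dt: "0 < d" "0 < t" "d \<le> 1" "t \<le> 1" using z u by (auto simp: d_def t_def)
    have Q: "t \<le> Q" "0 < Q" using one_minus_cnj_mult_ge[OF z u] dt unfolding Q_def t_def by auto
    have zz: "norm (z * cnj \<zeta>) < 1"
      using z \<zeta> mult_strict_mono[of "norm z" 1 "norm \<zeta>" 1] by (simp add: norm_mult)
    define x where "x = 1 - norm (z * cnj \<zeta>)"
    have zl: "norm z * norm \<zeta> \<le> norm z" "norm z * norm \<zeta> \<le> norm \<zeta>"
      using z \<zeta> by (auto intro: mult_left_le mult_left_le_one_le)
    then have x: "0 < x" "x \<le> 1" "d \<le> x" "1 - norm \<zeta> \<le> x" using zz by (auto simp: x_def d_def norm_mult)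
    have xt: "3/4 * t \<le> x" using nearD(2)[OF n] x(4) by (simp add: t_def)
    have hp: "0 < h x" "0 < h t" using x dt by (auto intro: h_pos)
    \<comment> \<open>If t <= d, the decay from d to t applies and x >= d. Otherwise the factor
      (t/d)^e is at least 1, and x >= 3t/4 makes doubling sufficient.\<close>
    have hx: "h t \<le> A * 2 ^ g * (t / d) powr e * h x"
    proof (cases "t \<le> d")
      case True
      have "h t \<le> A * (t / d) powr e * h d" using True dt by (intro h_decay) auto
      also have "\<dots> \<le> A * (t / d) powr e * h x" using x dt A1 by (intro mult_left_mono h_mono) auto
      also have "\<dots> \<le> (A * (t / d) powr e * h x) * 2 ^ g"
        using A1 hp by (intro mult_right_le_one_le[THEN order_trans, OF _ _ _ order_refl] order_trans[OF _ mult_left_mono[of 1 "2 ^ g"]]) auto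
      finally show ?thesis by (simp add: mult_ac)
    next
      case False
      have "h t \<le> A * 2 ^ g * h x" using xt x dt by (intro h_le_of_le) auto
      also have "\<dots> \<le> (A * 2 ^ g * h x) * (t / d) powr e"
      proof -
        have "1 \<le> (t / d) powr e" using False dt e0 by (intro ge_one_powr_ge_zero) auto
        then show ?thesis using mult_left_mono[of 1 "(t / d) powr e" "A * 2 ^ g * h x"] A1 hp by simp
      qed
      finally show ?thesis by (simp add: mult_ac)
    qed
    have Q34: "3/4 * Q \<le> norm (1 - z * cnj \<zeta>)"
    proof -
      have "norm (1 - z * cnj u) = norm (cnj (1 - z * cnj u))" by (rule complex_mod_cnj[symmetric])
      then have Q': "Q = norm (1 - z * cnj u)" by (simp add: Q_def)
      have "1 - z * cnj u = (1 - z * cnj \<zeta>) + z * cnj (\<zeta> - u)" by (simp add: algebra_simps)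
      then have "Q \<le> norm (1 - z * cnj \<zeta>) + norm (z * cnj (\<zeta> - u))" unfolding Q' by (metis norm_triangle_ineq)
      moreover have "norm (z * cnj (\<zeta> - u)) \<le> t / 4"
      proof -
        have "norm (z * cnj (\<zeta> - u)) = norm z * norm (\<zeta> - u)" by (simp only: norm_mult complex_mod_cnj)
        also have "\<dots> \<le> 1 * norm (\<zeta> - u)" using z by (intro mult_right_mono) auto
        finally show ?thesis using nearD(1)[OF n] by (simp add: t_def)
      qed
      ultimately show ?thesis using Q(1) by argo
    qed
    have "norm (cnj \<zeta> * kernel_deriv (z * cnj \<zeta>)) \<le> 1 * norm (kernel_deriv (z * cnj \<zeta>))"
      unfolding norm_mult using \<zeta> by (intro mult_right_mono) auto
    also have "\<dots> \<le> Ck / (h x * (norm (1 - z * cnj \<zeta>))\<^sup>2)" using Ck(2)[OF zz] by (simp add: x_def)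
    also have "\<dots> \<le> Ck / ((h t / (A * 2 ^ g * (t / d) powr e)) * (3/4 * Q)\<^sup>2)"
    proof (intro divide_left_mono mult_mono power_mono Q34 mult_pos_pos divide_pos_pos zero_less_power)
      show "h t / (A * 2 ^ g * (t / d) powr e) \<le> h x"
        using hx A1 dt by (simp add: divide_le_eq mult_ac)
      show "0 < norm (1 - z * cnj \<zeta>)" using Q34 Q(2) by argo
    qed (use Ck hp Q A1 dt in auto)
    also have "\<dots> = G / h t * ((t / d) powr e / Q\<^sup>2)"
      using hp Q A1 dt by (simp add: G_def field_simps power2_eq_square)
    finally show ?thesis by (simp add: d_def t_def Q_def)
  qed
  have "norm (deriv (bergman_projection w f) z) * (1 - norm z) \<le> C * B"
    if p: "1 \<le> p" and f: "f \<in> Lp_weighted w p" and B: "0 < B" and osc: "\<And>z. norm z < 1 \<Longrightarrow> mean_osc w p r0 f z \<le> B"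
      and z: "norm z < 1" for f p B z
  proof -
    have fm [measurable]: "f \<in> borel_measurable \<mu>" using f by (rule Lp_measurable)
    define c where "c = hyp_mean w r0 f z"
    define d where "d = 1 - norm z"
    have d: "0 < d" using z by (simp add: d_def)
    have fi: "integrable \<mu> f" using f p by (rule Lp_integrable)
    have fci: "integrable \<mu> (\<lambda>\<zeta>. norm (f \<zeta> - c))" using fi by auto
    define k where "k \<zeta> = cnj \<zeta> * kernel_deriv (z * cnj \<zeta>)" for \<zeta>
    define q where "q \<zeta> = ennreal (norm ((f \<zeta> - c) * k \<zeta>))" for \<zeta>
    note dp = deriv_projection_minus_const[OF fi z, of c, folded k_def]
    have qm: "q \<in> borel_measurable \<mu>"
      unfolding q_def using borel_measurable_integrable[OF dp(2)] by measurable
    have inner: "indicator unit_disc u * (ennreal (1 / (1 - norm u)\<^sup>2) * (\<integral>\<^sup>+\<zeta>. q \<zeta> * near u \<zeta> \<partial>\<mu>))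
       \<le> ennreal (K * B * d powr (-3 * \<epsilon>)) * (indicator unit_disc u * ennreal ((1 - norm u) powr (-1 + \<epsilon>) * norm (1 - cnj z * u) powr (-2 + 2 * \<epsilon>)))" for u
    proof (cases "norm u < 1")
      case u: True
      define t Q where "t = 1 - norm u" and "Q = norm (1 - cnj z * u)"
      have t: "0 < t" using u by (simp add: t_def)
      have Q: "0 < Q" using one_minus_cnj_mult_ge[OF z u] t unfolding Q_def t_def by auto
      have ht: "0 < h t" using t by (rule h_pos)
      define \<kappa> where "\<kappa> = G / h t * ((t / d) powr e / Q\<^sup>2)"
      have \<kappa>: "0 \<le> \<kappa>" using G ht by (simp add: \<kappa>_def)
      have hd0: "0 \<le> hyp_dist z u" by (rule hyp_dist_nonneg[OF z u])
      define E where "E = C2 * (1 + hyp_dist z u) * B"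
      have E: "0 < E" using C2 hd0 B by (simp add: E_def)
      have "(\<integral>\<^sup>+\<zeta>. q \<zeta> * near u \<zeta> \<partial>\<mu>) \<le> (\<integral>\<^sup>+\<zeta>. ennreal \<kappa> * (ennreal (norm (f \<zeta> - c)) * indicator (hyp_ball u r0) \<zeta>) \<partial>\<mu>)"
      proof (rule nn_integral_mono)
        fix \<zeta> assume "\<zeta> \<in> space \<mu>"
        then have \<zeta>: "norm \<zeta> < 1" by (simp add: space_weighted_area)
        show "q \<zeta> * near u \<zeta> \<le> ennreal \<kappa> * (ennreal (norm (f \<zeta> - c)) * indicator (hyp_ball u r0) \<zeta>)"
        proof (cases "near u \<zeta> = 0")
          case False
          then have "\<zeta> \<in> hyp_ball u r0" using u \<zeta> by (intro near_imp_hyp_ball)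
          moreover have "near u \<zeta> = 1" using False by (auto simp: near_def indicator_def split: if_splits)
          moreover have "norm (k \<zeta>) \<le> \<kappa>" unfolding k_def \<kappa>_def t_def Q_def d_def using kd[OF z u \<zeta> False] .
          then have "norm (f \<zeta> - c) * norm (k \<zeta>) \<le> norm (f \<zeta> - c) * \<kappa>" by (intro mult_left_mono) auto
          then have "q \<zeta> \<le> ennreal \<kappa> * ennreal (norm (f \<zeta> - c))"
            unfolding q_def norm_mult using \<kappa> by (subst ennreal_mult[symmetric]) (auto intro!: ennreal_leI simp: mult.commute)
          ultimately show ?thesis by simp
        qed simp
      qed
      also have "\<dots> = ennreal \<kappa> * (\<integral>\<^sup>+\<zeta>. ennreal (norm (f \<zeta> - c)) * indicator (hyp_ball u r0) \<zeta> \<partial>\<mu>)"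
        by (intro nn_integral_cmult borel_measurable_times_ennreal borel_measurable_indicator sets_hyp_ball u
            measurable_compose[OF borel_measurable_integrable[OF fci] measurable_ennreal])
      also have "(\<integral>\<^sup>+\<zeta>. ennreal (norm (f \<zeta> - c)) * indicator (hyp_ball u r0) \<zeta> \<partial>\<mu>) = ennreal (LINT \<zeta>:hyp_ball u r0|\<mu>. norm (f \<zeta> - c))"
        by (intro nn_integral_set_eq sets_hyp_ball u fci) auto
      also have "\<dots> \<le> ennreal (2 * E * (C1 * (h t * t)))"
      proof (rule ennreal_leI)
        have "(LINT \<zeta>:hyp_ball u r0|\<mu>. norm (f \<zeta> - c)) \<le> 2 * E * measure \<mu> (hyp_ball u r0)"
        proof (rule set_integral_le_of_powr[OF sets_hyp_ball[OF u] _ _ p Lp_integrable_powr_diff[OF f p] E])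
          show "(LINT \<zeta>:hyp_ball u r0|\<mu>. norm (f \<zeta> - c) powr p) \<le> E powr p * measure \<mu> (hyp_ball u r0)"
            unfolding E_def c_def using p f B osc z u by (rule C2(2))
        qed auto
        also have "\<dots> \<le> 2 * E * (C1 * (h t * t))"
          unfolding t_def using E u by (intro mult_left_mono C1) auto
        finally show "(LINT \<zeta>:hyp_ball u r0|\<mu>. norm (f \<zeta> - c)) \<le> 2 * E * (C1 * (h t * t))" .
      qed
      finally have "(\<integral>\<^sup>+\<zeta>. q \<zeta> * near u \<zeta> \<partial>\<mu>) \<le> ennreal \<kappa> * ennreal (2 * E * (C1 * (h t * t)))"
        by (simp add: mult_left_mono)
      then have "ennreal (1 / t\<^sup>2) * (\<integral>\<^sup>+\<zeta>. q \<zeta> * near u \<zeta> \<partial>\<mu>) \<le> ennreal (1 / t\<^sup>2) * (ennreal \<kappa> * ennreal (2 * E * (C1 * (h t * t))))"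
        by (rule mult_left_mono) simp
      also have "\<dots> = ennreal (1 / t\<^sup>2 * (\<kappa> * (2 * E * (C1 * (h t * t)))))"
      proof -
        have "ennreal x * (ennreal y * ennreal v) = ennreal (x * (y * v))" if "0 \<le> x" "0 \<le> y" "0 \<le> v" for x y v
          using that by (simp add: ennreal_mult)
        then show ?thesis using \<kappa> E C1(1) ht t by simp
      qed
      also have "\<dots> \<le> ennreal (K * B * d powr (-3 * \<epsilon>) * (t powr (-1 + \<epsilon>) * Q powr (-2 + 2 * \<epsilon>)))"
      proof (rule ennreal_leI)
        have hdX: "1 + hyp_dist z u \<le> C3 * (Q\<^sup>2 / (d * t)) powr \<epsilon>"
          using C3(2)[OF z u] by (simp add: Q_def d_def t_def)
        have "E \<le> C2 * (C3 * (Q\<^sup>2 / (d * t)) powr \<epsilon>) * B"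
          unfolding E_def using hdX C2 B by (intro mult_right_mono mult_left_mono) auto
        then have "1 / t\<^sup>2 * (\<kappa> * (2 * E * (C1 * (h t * t)))) \<le> 1 / t\<^sup>2 * (\<kappa> * (2 * (C2 * (C3 * (Q\<^sup>2 / (d * t)) powr \<epsilon>) * B) * (C1 * (h t * t))))"
          using \<kappa> C1 ht t by (intro mult_left_mono mult_right_mono) auto
        also have "\<dots> = K * B * (1 / t\<^sup>2 * ((t / d) powr (2 * \<epsilon>) / Q\<^sup>2) * (Q\<^sup>2 / (d * t)) powr \<epsilon> * t)"
          using ht by (simp add: \<kappa>_def K_def \<epsilon>(3))
        also have "\<dots> = K * B * (d powr (-3 * \<epsilon>) * (t powr (-1 + \<epsilon>) * Q powr (-2 + 2 * \<epsilon>)))"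
          unfolding powr_weight_identity[OF t d Q] ..
        finally show "1 / t\<^sup>2 * (\<kappa> * (2 * E * (C1 * (h t * t)))) \<le> K * B * d powr (-3 * \<epsilon>) * (t powr (-1 + \<epsilon>) * Q powr (-2 + 2 * \<epsilon>))"
          by (simp only: mult.assoc)
      qed
      also have "\<dots> = ennreal (K * B * d powr (-3 * \<epsilon>)) * ennreal (t powr (-1 + \<epsilon>) * Q powr (-2 + 2 * \<epsilon>))"
        using G B by (intro ennreal_mult) auto
      finally show ?thesis using u by (simp add: t_def Q_def)
    qed simp
    have "ennreal (norm (deriv (bergman_projection w f) z)) \<le> (\<integral>\<^sup>+\<zeta>. q \<zeta> \<partial>\<mu>)"
      unfolding dp(1) q_def by (rule integral_norm_bound_ennreal[OF dp(2)])
    also have "\<dots> \<le> 27 * (\<integral>\<^sup>+u. indicator unit_disc u * (ennreal (1 / (1 - norm u)\<^sup>2) * (\<integral>\<^sup>+\<zeta>. q \<zeta> * near u \<zeta> \<partial>\<mu>)) \<partial>lborel)"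
      using qm by (rule nn_integral_averaging)
    also have "\<dots> \<le> 27 * (\<integral>\<^sup>+u. ennreal (K * B * d powr (-3 * \<epsilon>)) * (indicator unit_disc u * ennreal ((1 - norm u) powr (-1 + \<epsilon>) * norm (1 - cnj z * u) powr (-2 + 2 * \<epsilon>))) \<partial>lborel)"
      by (intro mult_left_mono nn_integral_mono inner) auto
    also have "\<dots> = 27 * (ennreal (K * B * d powr (-3 * \<epsilon>)) * (\<integral>\<^sup>+u. indicator unit_disc u * ennreal ((1 - norm u) powr (-1 + \<epsilon>) * norm (1 - cnj z * u) powr (-2 + 2 * \<epsilon>)) \<partial>lborel))"
    proof -
      show ?thesis unfolding nn_integral_cmult[OF Forelli_Rudin_measurable] by (rule refl)
    qed
    also have "\<dots> \<le> 27 * (ennreal (K * B * d powr (-3 * \<epsilon>)) * ennreal (324 * (1 / \<epsilon> + 4) * d powr (-1 + 3 * \<epsilon>)))"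
      unfolding d_def by (intro mult_left_mono Forelli_Rudin \<epsilon> z) auto
    also have "\<dots> = ennreal (27 * (K * B * d powr (-3 * \<epsilon>) * (324 * (1 / \<epsilon> + 4) * d powr (-1 + 3 * \<epsilon>))))"
      using G B \<epsilon> by (simp add: ennreal_mult[symmetric] flip: ennreal_numeral)
    also have "27 * (K * B * d powr (-3 * \<epsilon>) * (324 * (1 / \<epsilon> + 4) * d powr (-1 + 3 * \<epsilon>))) = C * B * (d powr (-3 * \<epsilon>) * d powr (-1 + 3 * \<epsilon>))"
      by (simp only: C_def mult_ac)
    also have "d powr (-3 * \<epsilon>) * d powr (-1 + 3 * \<epsilon>) = 1 / d"
    proof -
      have "d powr (-3 * \<epsilon>) * d powr (-1 + 3 * \<epsilon>) = d powr (-3 * \<epsilon> + (-1 + 3 * \<epsilon>))" by (rule powr_add[symmetric])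
      also have "-3 * \<epsilon> + (-1 + 3 * \<epsilon>) = - 1" by simp
      also have "d powr - 1 = 1 / d" using d by (simp add: powr_minus_divide)
      finally show ?thesis .
    qed
    finally have "norm (deriv (bergman_projection w f) z) \<le> C * B * (1 / d)"
      using C B d by (subst (asm) ennreal_le_iff) auto
    then show ?thesis using d by (simp add: d_def field_simps)
  qed
  then show thesis using C that by blast
qed

lemma BMO_bound:
  assumes "f \<in> BMO w p r"
  obtains B where "0 < B" "\<And>z. norm z < 1 \<Longrightarrow> mean_osc w p r f z \<le> B"
proof -
  define B where "B = enn2real (BMO_seminorm w p r f) + 1"
  have B: "0 < B" by (simp add: B_def add_nonneg_pos)
  have "BMO_seminorm w p r f < top" using assms by (simp add: BMO_def)
  then have "BMO_seminorm w p r f \<le> ennreal B"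
    unfolding B_def by (cases "BMO_seminorm w p r f") (auto simp: ennreal_leI)
  then have "mean_osc w p r f z \<le> B" if "norm z < 1" for z
    using that B by (intro mean_osc_le_of_seminorm) auto
  then show thesis using B that by blast
qed

theorem BMO_independent_of_radius:
  assumes p: "1 \<le> p" and r: "r0 \<le> r"
  shows "BMO w p r = BMO w p r0"
proof (intro set_eqI iffI)
  obtain C where C: "1 \<le> C" "\<And>f p B z. 1 \<le> p \<Longrightarrow> f \<in> Lp_weighted w p \<Longrightarrow> 0 < B \<Longrightarrow>
      (\<And>z. norm z < 1 \<Longrightarrow> mean_osc w p r f z \<le> B) \<Longrightarrow> norm z < 1 \<Longrightarrow> mean_osc w p r0 f z \<le> C * B"
    using mean_osc_r0_le[OF r] by blast
  fix f assume f: "f \<in> BMO w p r"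
  then have fL: "f \<in> Lp_weighted w p" by (simp add: BMO_def)
  obtain B where B: "0 < B" "\<And>z. norm z < 1 \<Longrightarrow> mean_osc w p r f z \<le> B" using BMO_bound[OF f] by blast
  have "BMO_seminorm w p r0 f \<le> ennreal (C * B)"
    by (rule BMO_seminorm_le) (rule C(2)[OF p fL B])
  then show "f \<in> BMO w p r0" using fL by (auto simp: BMO_def le_less_trans)
next
  obtain C where C: "1 \<le> C" "\<And>f p B z. 1 \<le> p \<Longrightarrow> f \<in> Lp_weighted w p \<Longrightarrow> 0 < B \<Longrightarrow>
      (\<And>z. norm z < 1 \<Longrightarrow> mean_osc w p r0 f z \<le> B) \<Longrightarrow> norm z < 1 \<Longrightarrow> mean_osc w p r f z \<le> C * B"
    using mean_osc_r_le[OF r] by blast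
  fix f assume f: "f \<in> BMO w p r0"
  then have fL: "f \<in> Lp_weighted w p" by (simp add: BMO_def)
  obtain B where B: "0 < B" "\<And>z. norm z < 1 \<Longrightarrow> mean_osc w p r0 f z \<le> B" using BMO_bound[OF f] by blast
  have "BMO_seminorm w p r f \<le> ennreal (C * B)"
    by (rule BMO_seminorm_le) (rule C(2)[OF p fL B])
  then show "f \<in> BMO w p r" using fL by (auto simp: BMO_def le_less_trans)
qed

theorem projection_BMO_bloch:
  assumes p: "1 \<le> p" and r: "r0 \<le> r"
  shows "bounded_into_bloch (bergman_projection w) (BMO w p r0) (BMO_seminorm w p r)"
proof -
  obtain C1 where C1: "1 \<le> C1" "\<And>f p B z. 1 \<le> p \<Longrightarrow> f \<in> Lp_weighted w p \<Longrightarrow> 0 < B \<Longrightarrow>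
      (\<And>z. norm z < 1 \<Longrightarrow> mean_osc w p r f z \<le> B) \<Longrightarrow> norm z < 1 \<Longrightarrow> mean_osc w p r0 f z \<le> C1 * B"
    using mean_osc_r0_le[OF r] by blast
  obtain C2 where C2: "0 < C2" "\<And>f p B z. 1 \<le> p \<Longrightarrow> f \<in> Lp_weighted w p \<Longrightarrow> 0 < B \<Longrightarrow>
      (\<And>z. norm z < 1 \<Longrightarrow> mean_osc w p r0 f z \<le> B) \<Longrightarrow> norm z < 1 \<Longrightarrow>
      norm (deriv (bergman_projection w f) z) * (1 - norm z) \<le> C2 * B"
    using deriv_projection_bound by blast
  define C where "C = 2 * (C2 * C1)"
  have C: "0 < C" using C1 C2 by (simp add: C_def)
  have bd: "bloch_seminorm (bergman_projection w f) \<le> ennreal (C * B)"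
    if f: "f \<in> Lp_weighted w p" and B: "0 < B" and osc: "\<And>z. norm z < 1 \<Longrightarrow> mean_osc w p r f z \<le> B" for f B
    unfolding bloch_seminorm_def
  proof (intro SUP_least ennreal_leI)
    fix z assume "z \<in> unit_disc"
    then have z: "norm z < 1" by simp
    have o: "norm x < 1 \<Longrightarrow> mean_osc w p r0 f x \<le> C1 * B" for x by (rule C1(2)[OF p f B osc])
    have "0 < C1 * B" using C1 B by simp
    note b = C2(2)[OF p f this o z]
    have "1 - (norm z)\<^sup>2 = (1 + norm z) * (1 - norm z)" by (simp add: power2_eq_square algebra_simps)
    also have "\<dots> \<le> 2 * (1 - norm z)" using z by (intro mult_right_mono) auto
    finally have "norm (deriv (bergman_projection w f) z) * (1 - (norm z)\<^sup>2) \<le> norm (deriv (bergman_projection w f) z) * (2 * (1 - norm z))"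
      by (rule mult_left_mono) simp
    also have "\<dots> = 2 * (norm (deriv (bergman_projection w f) z) * (1 - norm z))" by simp
    also have "\<dots> \<le> 2 * (C2 * (C1 * B))" using b by simp
    finally show "norm (deriv (bergman_projection w f) z) * (1 - (norm z)\<^sup>2) \<le> C * B" by (simp add: C_def)
  qed
  have "bergman_projection w f \<in> bloch \<and> bloch_seminorm (bergman_projection w f) \<le> ennreal C * BMO_seminorm w p r f"
    if "f \<in> BMO w p r0" for f
  proof -
    have f: "f \<in> BMO w p r" using that BMO_independent_of_radius[OF p r] by simp
    then have fL: "f \<in> Lp_weighted w p" by (simp add: BMO_def)
    have hol: "bergman_projection w f holomorphic_on unit_disc"
      by (intro bergman_projection_holomorphic Lp_integrable[OF fL p])
    have "BMO_seminorm w p r f < top" using f by (simp add: BMO_def)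
    then obtain \<sigma> where \<sigma>: "0 \<le> \<sigma>" "BMO_seminorm w p r f = ennreal \<sigma>" by (cases "BMO_seminorm w p r f") auto
    \<comment> \<open>The estimates need a positive bound for the oscillation, whereas the seminorm
      may be 0, as for constants; hence the limit \<delta> to 0.\<close>
    have le: "bloch_seminorm (bergman_projection w f) \<le> ennreal (C * \<sigma>) + ennreal \<delta>" if \<delta>: "0 < \<delta>" for \<delta>
    proof -
      have "bloch_seminorm (bergman_projection w f) \<le> ennreal (C * (\<sigma> + \<delta> / C))"
      proof (rule bd[OF fL])
        show "0 < \<sigma> + \<delta> / C" using \<sigma> \<delta> C by (simp add: add_nonneg_pos)
        show "mean_osc w p r f z \<le> \<sigma> + \<delta> / C" if "norm z < 1" for z
        proof -
          have "mean_osc w p r f z \<le> \<sigma>" using \<sigma> that by (intro mean_osc_le_of_seminorm) auto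
          then show ?thesis using \<delta> C by (simp add: add_increasing2)
        qed
      qed
      also have "C * (\<sigma> + \<delta> / C) = C * \<sigma> + \<delta>" using C by (simp add: distrib_left)
      also have "ennreal \<dots> = ennreal (C * \<sigma>) + ennreal \<delta>" using C \<sigma> \<delta> by (intro ennreal_plus) auto
      finally show ?thesis .
    qed
    have "bloch_seminorm (bergman_projection w f) \<le> ennreal (C * \<sigma>)"
      by (rule ennreal_le_epsilon) (rule le)
    then have b: "bloch_seminorm (bergman_projection w f) \<le> ennreal C * BMO_seminorm w p r f"
      unfolding \<sigma>(2) using C \<sigma> by (simp add: ennreal_mult)
    moreover have "ennreal C * BMO_seminorm w p r f < \<infinity>" unfolding \<sigma>(2) by (simp add: ennreal_mult_less_top)
    ultimately show ?thesis using hol by (auto simp: bloch_def le_less_trans)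
  qed
  then show ?thesis unfolding bounded_into_bloch_def using C by blast
qed

theorem BMO_bloch_radius_r0: "1 \<le> p \<Longrightarrow> BMO_bloch_radius w p r0"
  unfolding BMO_bloch_radius_def
  by (intro conjI allI impI ballI r0_pos measure_hyp_ball_pos BMO_independent_of_radius projection_BMO_bloch; simp)

end

section \<open>Bounded functions as a subspace of BMO, and assembly of the equivalence\<close>

context borel_weight
begin

text \<open>Oscillation about the constant 0 is at most the essential supremum, so passing to the
  mean gives BMO seminorm at most 8 times the norm. A single radius at which the projection is
  bounded is enough.\<close>

theorem bounded_Linf_of_BMO_bloch_radius:
  assumes p: "1 < p" and R: "BMO_bloch_radius w p R"
  shows "bounded_into_bloch (bergman_projection w) Linf Linf_norm"
proof -
  interpret finite_measure "\<mu>" by (rule finite_measure_weighted_area)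
  have pos': "\<forall>r\<ge>R. \<forall>z\<in>unit_disc. 0 < measure \<mu> (hyp_ball z r)"
    and bd': "\<forall>r\<ge>R. bounded_into_bloch (bergman_projection w) (BMO w p R) (BMO_seminorm w p r)"
    using R unfolding BMO_bloch_radius_def by blast+
  have pos: "0 < measure \<mu> (hyp_ball z R)" if "norm z < 1" for z
    using pos' that by simp
  have bd: "bounded_into_bloch (bergman_projection w) (BMO w p R) (BMO_seminorm w p R)"
    using bd' by simp
  obtain C where C: "0 < C" "\<And>f. f \<in> BMO w p R \<Longrightarrow> bergman_projection w f \<in> bloch \<and> bloch_seminorm (bergman_projection w f) \<le> ennreal C * BMO_seminorm w p R f"
    using bd unfolding bounded_into_bloch_def by blast
  have "bergman_projection w f \<in> bloch \<and> bloch_seminorm (bergman_projection w f) \<le> ennreal (8 * C) * Linf_norm f"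
    if f: "f \<in> Linf" for f
  proof -
    have fm: "f \<in> borel_measurable disc_area" and fin: "Linf_norm f < top" using f by (auto simp: Linf_def)
    then obtain \<sigma> where \<sigma>: "0 \<le> \<sigma>" "Linf_norm f = ennreal \<sigma>" by (cases "Linf_norm f") auto
    have [measurable]: "f \<in> borel_measurable \<mu>" using fm by (simp add: weighted_area_def)
    have "AE z in disc_area. ennreal (norm (f z)) \<le> Linf_norm f" unfolding Linf_norm_def by (rule esssup_AE)
    then have "AE z in disc_area. norm (f z) \<le> \<sigma>" unfolding \<sigma>(2) using \<sigma>(1) by (auto elim: eventually_mono)
    then have ae: "AE z in \<mu>. norm (f z) \<le> \<sigma>"
      unfolding weighted_area_def
      by (subst AE_density) (auto elim!: eventually_mono simp: disc_area_def intro!: measurable_lebesgue_on_disc)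
    have aep: "AE z in \<mu>. norm (f z) powr p \<le> \<sigma> powr p"
      using ae by eventually_elim (use p in \<open>auto intro: powr_mono2\<close>)
    have "integrable \<mu> (\<lambda>z. norm (f z) powr p)"
      using aep by (intro integrable_const_bound[where B="\<sigma> powr p"]) auto
    then have fL: "f \<in> Lp_weighted w p" using fm by (simp add: Lp_weighted_def)
    have osc: "mean_osc w p R f z \<le> 8 * B" if z: "norm z < 1" and B: "\<sigma> \<le> B" "0 < B" for z B
    proof (rule mean_osc_le[OF fL _ z pos[OF z] B(2)])
      have "(LINT \<zeta>:hyp_ball z R|\<mu>. norm (f \<zeta> - 0) powr p) \<le> (LINT \<zeta>|\<mu>. indicat_real (hyp_ball z R) \<zeta> *\<^sub>R (B powr p))"
        unfolding set_lebesgue_integral_def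
      proof (rule integral_mono_AE)
        show "integrable \<mu> (\<lambda>\<zeta>. indicat_real (hyp_ball z R) \<zeta> *\<^sub>R norm (f \<zeta> - 0) powr p)"
          using p by (intro integrable_mult_indicator sets_hyp_ball z Lp_integrable_powr_diff[OF fL]) auto
        show "integrable \<mu> (\<lambda>\<zeta>. indicat_real (hyp_ball z R) \<zeta> *\<^sub>R (B powr p))"
          by (intro integrable_mult_indicator sets_hyp_ball z) auto
        show "AE \<zeta> in \<mu>. indicat_real (hyp_ball z R) \<zeta> *\<^sub>R norm (f \<zeta> - 0) powr p \<le> indicat_real (hyp_ball z R) \<zeta> *\<^sub>R (B powr p)"
          using ae by eventually_elim (use p B in \<open>auto split: split_indicator intro!: powr_mono2\<close>)
      qed
      also have "\<dots> = B powr p * measure \<mu> (hyp_ball z R)"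
        using sets_hyp_ball[OF z] integrable_indicat[OF sets_hyp_ball[OF z]] by (subst integral_scaleR_left) auto
      finally show "(LINT \<zeta>:hyp_ball z R|\<mu>. norm (f \<zeta> - 0) powr p) \<le> B powr p * measure \<mu> (hyp_ball z R)" .
    qed (use p in auto)
    have sem: "BMO_seminorm w p R f \<le> ennreal (8 * \<sigma>)"
    proof (rule BMO_seminorm_le)
      fix z :: complex assume z: "norm z < 1"
      show "mean_osc w p R f z \<le> 8 * \<sigma>"
      proof (rule field_le_epsilon)
        fix \<delta> :: real assume "0 < \<delta>"
        then show "mean_osc w p R f z \<le> 8 * \<sigma> + \<delta>" using osc[OF z, of "\<sigma> + \<delta> / 8"] \<sigma> by simp
      qed
    qed
    then have fB: "f \<in> BMO w p R" using fL by (auto simp: BMO_def le_less_trans)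
    have "bloch_seminorm (bergman_projection w f) \<le> ennreal C * BMO_seminorm w p R f" using C(2)[OF fB] by simp
    also have "\<dots> \<le> ennreal C * ennreal (8 * \<sigma>)" using sem by (rule mult_left_mono) simp
    also have "\<dots> = ennreal (8 * C) * Linf_norm f" unfolding \<sigma>(2) using C(1) \<sigma>(1)
      by (simp add: ennreal_mult[symmetric] mult_ac del: ennreal_numeral)
    finally show ?thesis using C(2)[OF fB] by simp
  qed
  moreover have "0 < 8 * C" using C by simp
  ultimately show ?thesis unfolding bounded_into_bloch_def by blast
qed

lemma regular_weight_of_classes:
  assumes M: "w \<in> class_M" and D: "w \<in> class_D_hat"
  obtains A e g where "regular_weight w A e g"
proof -
  obtain C where C: "1 \<le> C" "\<And>x. 1 \<le> x \<Longrightarrow> moment w x \<le> C * moment w (2 * x)"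
    using doubling_of_D_hat[OF D] by blast
  obtain A1 g where A1: "1 \<le> A1" "1 \<le> g" "\<And>x y. 1 \<le> x \<Longrightarrow> x \<le> y \<Longrightarrow> moment w x \<le> A1 * (y / x) ^ g * moment w y"
    using moment_power_law[OF C(2,1)] by blast
  obtain A2 e where A2: "1 \<le> A2" "0 < e" "e \<le> 1/2" "\<And>x y. 1 \<le> x \<Longrightarrow> x \<le> y \<Longrightarrow> moment w y \<le> A2 * (x / y) powr e * moment w x"
    using moment_decay[OF M] by blast
  obtain A3 where A3: "1 \<le> A3" "\<And>x. 1 \<le> x \<Longrightarrow> tail w (1 - 1 / x) \<le> A3 * moment w x"
    using tail_le_moment by blast
  obtain A4 where A4: "1 \<le> A4" "\<And>x. 1 \<le> x \<Longrightarrow> moment w x \<le> A4 * tail w (1 - 1 / x)"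
    using moment_le_tail[OF C(2,1)] by blast
  define A where "A = Max {A1, A2, A3, A4}"
  have A: "A1 \<le> A" "A2 \<le> A" "A3 \<le> A" "A4 \<le> A" by (auto simp: A_def)
  have "regular_weight w A e g"
  proof unfold_locales
    show "1 \<le> A" using A A1 by linarith
    fix x y :: real assume x: "1 \<le> x"
    show "tail w (1 - 1 / x) \<le> A * moment w x"
      using A3(2)[OF x] A mult_right_mono[OF A(3) moment_nonneg[of x]] by linarith
    have "0 \<le> tail w (1 - 1 / x)" using x by (intro tail_nonneg) auto
    then show "moment w x \<le> A * tail w (1 - 1 / x)"
      using A4(2)[OF x] A mult_right_mono[OF A(4)] by (meson order_trans)
    assume y: "x \<le> y"
    have "A1 * (y / x) ^ g * moment w y \<le> A * (y / x) ^ g * moment w y"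
      using x y A by (intro mult_right_mono moment_nonneg) auto
    then show "moment w x \<le> A * (y / x) ^ g * moment w y" using A1(3)[OF x y] by linarith
    have "A2 * (x / y) powr e * moment w x \<le> A * (x / y) powr e * moment w x"
      using A by (intro mult_right_mono moment_nonneg) auto
    then show "moment w y \<le> A * (x / y) powr e * moment w x" using A2(4)[OF x y] by linarith
  qed (use A1 A2 in auto)
  then show thesis by (rule that)
qed

end

lemma bergman_projection_cong:
  assumes "weighted_area w = weighted_area \<omega>" "moment w = moment \<omega>"
  shows "bergman_projection w = bergman_projection \<omega>"
  using assms by (intro ext) (simp add: bergman_projection_def bergman_kernel_def)

lemma BMO_bloch_radius_cong:
  assumes wa: "weighted_area w = weighted_area \<omega>" and m: "moment w = moment \<omega>"
  shows "BMO_bloch_radius w p r = BMO_bloch_radius \<omega> p r"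
proof -
  have hm: "hyp_mean w = hyp_mean \<omega>" using wa by (intro ext) (simp add: hyp_mean_def)
  have mo: "mean_osc w = mean_osc \<omega>" using wa hm by (intro ext) (simp add: mean_osc_def)
  have sn: "BMO_seminorm w = BMO_seminorm \<omega>" using mo by (intro ext) (simp add: BMO_seminorm_def)
  have "Lp_weighted w = Lp_weighted \<omega>" using wa by (intro ext) (simp add: Lp_weighted_def)
  then have "BMO w = BMO \<omega>" using sn by (intro ext) (simp add: BMO_def)
  then show ?thesis using sn wa bergman_projection_cong[OF wa m] by (simp add: BMO_bloch_radius_def)
qed

lemma radial_weight_borel: "borel_weight w \<Longrightarrow> radial_weight w"
proof -
  assume "borel_weight w"
  then interpret borel_weight w .
  have "integrable lborel (\<lambda>r. indicat_real {0..<1} r *\<^sub>R w r)"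
    by (intro integrable_mult_indicator w_integrable) auto
  then have "set_integrable lebesgue {0..<1} w"
    unfolding set_integrable_def by (subst integrable_completion) auto
  then show ?thesis using tail_pos by (simp add: radial_weight_def)
qed

theorem theorem1:
  fixes \<omega> :: "real \<Rightarrow> real"
  assumes "\<omega> \<in> class_M"
  shows "(\<forall>p>1.
            ((\<exists>r0. BMO_bloch_radius \<omega> p r0) \<longleftrightarrow>
               bounded_into_bloch (bergman_projection \<omega>) Linf Linf_norm) \<and>
            (bounded_into_bloch (bergman_projection \<omega>) Linf Linf_norm \<longleftrightarrow>
               \<omega> \<in> class_D_hat)) \<and>
         \<comment> \<open>the radius in the first statement can be chosen depending on \<omega> only\<close>
         (\<exists>r0. \<forall>p>1. (\<exists>r. BMO_bloch_radius \<omega> p r) \<longrightarrow> BMO_bloch_radius \<omega> p r0)"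
proof -
  have "radial_weight \<omega>" using assms by (simp add: class_M_def)
  then obtain w where w: "borel_weight w" and wa: "weighted_area w = weighted_area \<omega>"
    and mo: "moment w = moment \<omega>" and tl: "\<And>r. 0 \<le> r \<Longrightarrow> tail w r = tail \<omega> r"
    using borel_weight_version by blast
  interpret borel_weight w by fact
  have rw: "radial_weight w" using w by (rule radial_weight_borel)
  have M: "w \<in> class_M" using assms rw fun_cong[OF mo] unfolding class_M_def by simp
  have D: "w \<in> class_D_hat \<longleftrightarrow> \<omega> \<in> class_D_hat"
    using rw \<open>radial_weight \<omega>\<close> tl unfolding class_D_hat_def by simp
  have R: "BMO_bloch_radius w p r = BMO_bloch_radius \<omega> p r" for p r
    by (rule BMO_bloch_radius_cong[OF wa mo])
  have P: "bergman_projection w = bergman_projection \<omega>" by (rule bergman_projection_cong[OF wa mo])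
  have 12: "bounded_into_bloch (bergman_projection \<omega>) Linf Linf_norm" if "1 < p" "BMO_bloch_radius \<omega> p r" for p r
    using bounded_Linf_of_BMO_bloch_radius[of p r] that by (simp add: R P)
  have 23: "\<omega> \<in> class_D_hat" if "bounded_into_bloch (bergman_projection \<omega>) Linf Linf_norm"
    using D_hat_of_bounded_Linf that rw by (simp add: P D)
  \<comment> \<open>The radius of the locale is built from A and e alone, so the same one works for
    every p.\<close>
  have 31: "\<exists>r0. \<forall>p>1. BMO_bloch_radius \<omega> p r0" if "\<omega> \<in> class_D_hat"
  proof -
    have "w \<in> class_D_hat" using D that by simp
    from regular_weight_of_classes[OF M this] obtain A e g where "regular_weight w A e g" by blast
    then interpret regular_weight w A e g .
    show ?thesis using BMO_bloch_radius_r0 by (intro exI[of _ r0] allI impI) (simp add: R)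
  qed
  \<comment> \<open>For the last conjunct: a radius for one exponent already forces membership in
    \<open>class_D_hat\<close>, and \<open>31\<close> then provides a radius for all exponents; if
    there is none for any exponent, the claim is vacuous.\<close>
  show ?thesis using 12 23 31 by meson
qed

end
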